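(* Let $\Omega\subset\mathbb{C}$ be an exceptional domain which is not a half-plane, and let $u$ be its associated function. Assume that $\Omega$ is invariant under a translation $T(z)=z+\tau$ with $\tau\neq 0$, and that $\Omega/T$ has finite connectivity (its boundary in the cylinder $\mathbb{C}/T$ has finitely many components). Then: (1) $|\nabla u|<1$ in $\Omega$; (2) the boundary of $\Omega/T$ in $\mathbb{C}/T$ is a finite union of Jordan curves; (3) $\Omega/T$ has one or two ends, each asymptotic to a half-cylinder. Precisely, there exists $R>0$ such that all of $\partial\Omega$ lies in the strip $S_R=\{z : |\mathrm{Im}(z/\tau)|<R\}$. Moreover, each of the two half-planes $\{\mathrm{Im}(z/\tau)\geq R\}$ and $\{\mathrm{Im}(z/\tau)\leq -R\}$ is either contained in $\Omega$ or disjoint from $\Omega$, and at least one of them is contained in $\Omega$; (4) on each of these half-planes that is contained in $\Omega$, $\nabla u(z)$ has a limit as $|\mathrm{Im}(z/\tau)|\to\infty$.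
   Context: We identify $\mathbb{R}^2$ with $\mathbb{C}$. An open set $\Omega\subset\mathbb{C}$ with non-empty boundary is a smooth domain if, for each $z_0\in\partial\Omega$, there exist $\varepsilon>0$ and a smooth diffeomorphism $\psi$ from $D(z_0,\varepsilon)$ onto an open set $D\subset\mathbb{R}^2$ such that $\psi(D(z_0,\varepsilon)\cap\Omega)=D\cap\{x_2>0\}$ and $\psi(D(z_0,\varepsilon)\cap\partial\Omega)=D\cap\{x_2=0\}$. An exceptional domain is a smooth, connected, unbounded domain $\Omega\subset\mathbb{C}$ with non-empty boundary that admits a function $u$, harmonic in $\Omega$ and $C^1$ up to the boundary, such that $u>0$ in $\Omega$, $u=0$ on $\partial\Omega$, and $|\nabla u|=1$ on $\partial\Omega$. Such a $u$ is unique (hence $T$-invariant in the periodic case), and we call it the associated function of $\Omega$. *)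

theory Defs
  imports "HOL-Analysis.Analysis"
begin

fun dirderivs :: "complex list \<Rightarrow> (complex \<Rightarrow> 'b::real_normed_vector) \<Rightarrow> complex \<Rightarrow> 'b" where
  "dirderivs [] f = f"
| "dirderivs (v # vs) f = (\<lambda>x. frechet_derivative (dirderivs vs f) (at x) v)"

definition Ck_on :: "nat \<Rightarrow> complex set \<Rightarrow> (complex \<Rightarrow> 'b::real_normed_vector) \<Rightarrow> bool" where
  "Ck_on k S f \<longleftrightarrow>
     (\<forall>vs. length vs < k \<longrightarrow> (\<forall>x\<in>S. dirderivs vs f differentiable (at x))) \<and>
     (\<forall>vs. length vs = k \<longrightarrow> continuous_on S (dirderivs vs f))"

definition smooth_on :: "complex set \<Rightarrow> (complex \<Rightarrow> 'b::real_normed_vector) \<Rightarrow> bool" where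
  "smooth_on S f \<longleftrightarrow> (\<forall>k. Ck_on k S f)"

definition smooth_diffeo :: "(complex \<Rightarrow> complex) \<Rightarrow> complex set \<Rightarrow> complex set \<Rightarrow> bool" where
  "smooth_diffeo \<psi> U D \<longleftrightarrow> open U \<and> open D \<and> smooth_on U \<psi> \<and> inj_on \<psi> U \<and> \<psi> ` U = D \<and>
     (\<exists>\<phi>. smooth_on D \<phi> \<and> (\<forall>x\<in>U. \<phi> (\<psi> x) = x))"

definition smooth_domain :: "complex set \<Rightarrow> bool" where
  "smooth_domain \<Omega> \<longleftrightarrow> open \<Omega> \<and> frontier \<Omega> \<noteq> {} \<and>
     (\<forall>z0\<in>frontier \<Omega>. \<exists>\<epsilon>>0. \<exists>\<psi> D. smooth_diffeo \<psi> (ball z0 \<epsilon>) D \<and>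
        \<psi> ` (ball z0 \<epsilon> \<inter> \<Omega>) = D \<inter> {x. Im x > 0} \<and>
        \<psi> ` (ball z0 \<epsilon> \<inter> frontier \<Omega>) = D \<inter> {x. Im x = 0})"

definition cgrad :: "(complex \<Rightarrow> real) \<Rightarrow> complex \<Rightarrow> complex" where
  "cgrad u x = complex_of_real (frechet_derivative u (at x) 1)
              + \<i> * complex_of_real (frechet_derivative u (at x) \<i>)"

definition harmonic_on :: "complex set \<Rightarrow> (complex \<Rightarrow> real) \<Rightarrow> bool" where
  "harmonic_on S u \<longleftrightarrow> Ck_on 2 S u \<and>
     (\<forall>x\<in>S. dirderivs [1, 1] u x + dirderivs [\<i>, \<i>] u x = 0)"

definition associated_function :: "complex set \<Rightarrow> (complex \<Rightarrow> real) \<Rightarrow> bool" where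
  "associated_function \<Omega> u \<longleftrightarrow>
     harmonic_on \<Omega> u \<and> Ck_on 1 \<Omega> u \<and> continuous_on (closure \<Omega>) u \<and>
     (\<forall>z\<in>\<Omega>. u z > 0) \<and> (\<forall>z\<in>frontier \<Omega>. u z = 0) \<and>
     (\<exists>G. continuous_on (closure \<Omega>) G \<and> (\<forall>z\<in>\<Omega>. G z = cgrad u z) \<and>
          (\<forall>z\<in>frontier \<Omega>. norm (G z) = 1))"

definition exceptional_domain :: "complex set \<Rightarrow> bool" where
  "exceptional_domain \<Omega> \<longleftrightarrow> smooth_domain \<Omega> \<and> connected \<Omega> \<and> \<not> bounded \<Omega> \<and>
     frontier \<Omega> \<noteq> {} \<and> (\<exists>u. associated_function \<Omega> u)"

definition is_half_plane :: "complex set \<Rightarrow> bool" where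
  "is_half_plane \<Omega> \<longleftrightarrow> (\<exists>a b. b \<noteq> 0 \<and> \<Omega> = {z. Im ((z - a) / b) > 0})"

text \<open>The cylinder C/T, T z = z + tau, realised as C - {0} via the homeomorphism
  induced by z \<mapsto> exp(2 pi i z / tau).\<close>
definition cyl :: "complex \<Rightarrow> complex \<Rightarrow> complex" where
  "cyl \<tau> z = exp (2 * of_real pi * \<i> * z / \<tau>)"

definition jordan_curve :: "(real \<Rightarrow> complex) \<Rightarrow> bool" where
  "jordan_curve g \<longleftrightarrow> simple_path g \<and> pathfinish g = pathstart g"

end

theory Submission
  imports Defs "HOL-Complex_Analysis.Complex_Analysis"
begin

text \<open>Write \<open>f = u_x - i u_y\<close>, which is holomorphic with \<open>|f| = 1\<close> on the frontier. Harnack's inequality in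
  a disc touching the frontier gives \<open>u \<le> 2 dist(\<cdot>, \<partial>\<Omega>)\<close>, hence \<open>f\<close> is bounded, and Phragmen-Lindelof with
  a logarithmic barrier gives \<open>|f| \<le> 1\<close>; equality inside forces a half-plane. The difference
  \<open>u(z + \<tau>) - u(z)\<close> is bounded and vanishes on the frontier, so \<open>u\<close> is periodic.

  If a frontier component of the quotient escaped to an end of the cylinder, every high line would meet both
  \<open>\<Omega>\<close> and its complement, so \<open>u\<close> would be bounded there; the line averages of a smooth convex
  truncation of \<open>u\<close> would then be bounded functions of the height whose second derivative is bounded below.
  (Classically: by the flux formula the frontier has length at most \<open>2|\<tau>|\<close> modulo \<open>\<tau>\<close>.) Hence the
  frontier in the cylinder is compact, and the unit field \<open>i\<nabla>u\<close> makes it a finite union of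
  periodic orbits. In the ends, \<open>f\<close> is a bounded holomorphic function of \<open>exp(2\<pi>iz/\<tau>)\<close> near 0 or infinity, so
  it has a limit.\<close>

section \<open>Harmonic functions as real parts\<close>

text \<open>Two obstacles shape the argument. On the frontier itself \<open>u\<close> has no
  two-sided derivative, only a continuous extension of its gradient; so each boundary statement
  (Harnack at a touching point, the tangent direction in a chart) is reached by the mean value
  theorem along points of \<Omega> close to the frontier. And the flux formula would integrate along
  a frontier whose compactness modulo \<tau> is the very thing to be proved. The line averages never
  touch the frontier: a truncation that vanishes for small \<open>u\<close> extends by zero, and its
  level need only suit a window of fixed height, where one period is compact. Finiteness of the
  number of components enters exactly once: if heights are unbounded, then they are unbounded on a
  single connected piece, which sweeps out all high lines. Only the upper end is treated, the lower
  one being the upper end for -\<tau>. For the closed orbits, the field is known on a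
  one-dimensional set only; uniqueness of integral curves therefore comes from the boundary charts,
  not from a Lipschitz condition.\<close>

lemma second_difference_mvt:
  fixes g :: "real \<Rightarrow> real \<Rightarrow> real"
  assumes "h > 0"
    and dx: "\<And>x y. \<lbrakk>a \<le> x; x \<le> a + h; b \<le> y; y \<le> b + h\<rbrakk> \<Longrightarrow>
          ((\<lambda>x. g x y) has_real_derivative gx x y) (at x)"
    and dxy: "\<And>x y. \<lbrakk>a \<le> x; x \<le> a + h; b \<le> y; y \<le> b + h\<rbrakk> \<Longrightarrow>
          ((\<lambda>y. gx x y) has_real_derivative gxy x y) (at y)"
  obtains x y where "a < x" "x < a + h" "b < y" "y < b + h"
    "g (a + h) (b + h) - g (a + h) b - g a (b + h) + g a b = h\<^sup>2 * gxy x y"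
proof -
  have "\<exists>x. a < x \<and> x < a + h \<and> (g (a + h) (b + h) - g (a + h) b) - (g a (b + h) - g a b) =
      (a + h - a) * (gx x (b + h) - gx x b)"
    by (rule MVT2) (use assms in \<open>auto intro!: derivative_intros\<close>)
  then obtain x where x: "a < x" "x < a + h"
    "(g (a + h) (b + h) - g (a + h) b) - (g a (b + h) - g a b) = h * (gx x (b + h) - gx x b)" by auto
  have "\<exists>y. b < y \<and> y < b + h \<and> gx x (b + h) - gx x b = (b + h - b) * gxy x y"
    by (rule MVT2) (use assms x in \<open>auto\<close>)
  then obtain y where "b < y" "y < b + h" "gx x (b + h) - gx x b = h * gxy x y" by auto
  with x show ?thesis by (intro that[of x y]) (auto simp: power2_eq_square algebra_simps)
qed

lemma has_vector_derivative_along_Re: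
  fixes u :: "complex \<Rightarrow> 'b::real_normed_vector"
  assumes "u differentiable (at (Complex x y))"
  shows "((\<lambda>x. u (Complex x y)) has_vector_derivative frechet_derivative u (at (Complex x y)) 1) (at x)"
proof -
  have "(u has_derivative frechet_derivative u (at (Complex x y))) (at (Complex x y) within range (\<lambda>x. Complex x y))"
    using assms by (auto simp: frechet_derivative_works intro: has_derivative_at_withinI)
  moreover have "((\<lambda>x. Complex x y) has_vector_derivative 1) (at x)"
    unfolding Complex_eq by (auto intro!: derivative_eq_intros)
  ultimately show ?thesis
    using vector_derivative_diff_chain_within[of "\<lambda>x. Complex x y" 1 x UNIV u] 
    by (auto simp: o_def)
qed

lemma has_vector_derivative_along_Im:
  fixes u :: "complex \<Rightarrow> 'b::real_normed_vector"
  assumes "u differentiable (at (Complex x y))"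
  shows "((\<lambda>y. u (Complex x y)) has_vector_derivative frechet_derivative u (at (Complex x y)) \<i>) (at y)"
proof -
  have "(u has_derivative frechet_derivative u (at (Complex x y))) (at (Complex x y) within range (\<lambda>y. Complex x y))"
    using assms by (auto simp: frechet_derivative_works intro: has_derivative_at_withinI)
  moreover have "((\<lambda>y. Complex x y) has_vector_derivative \<i>) (at y)"
    unfolding Complex_eq by (auto intro!: derivative_eq_intros)
  ultimately show ?thesis
    using vector_derivative_diff_chain_within[of "\<lambda>y. Complex x y" \<i> y UNIV u] 
    by (auto simp: o_def)
qed

lemma has_real_derivative_along_axes:
  fixes u :: "complex \<Rightarrow> real"
  assumes "u differentiable (at (Complex x y))"
  shows "((\<lambda>x. u (Complex x y)) has_real_derivative frechet_derivative u (at (Complex x y)) 1) (at x)"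
    and "((\<lambda>y. u (Complex x y)) has_real_derivative frechet_derivative u (at (Complex x y)) \<i>) (at y)"
  using has_vector_derivative_along_Re[OF assms] has_vector_derivative_along_Im[OF assms]
  by (simp_all add: has_real_derivative_iff_has_vector_derivative)

text \<open>Schwarz's theorem. The second difference of \<open>u\<close> over a square with corner
  \<open>z\<close> is symmetric in the two coordinates, and \<open>second_difference_mvt\<close>
  evaluates it in either order, giving a value of each mixed derivative near \<open>z\<close>.
  Continuity does the rest.\<close>

lemma Ck_on_2_mixed_derivative:
  fixes u :: "complex \<Rightarrow> real"
  assumes "open S" and u: "Ck_on 2 S u" and z: "z \<in> S"
  shows "dirderivs [1, \<i>] u z = dirderivs [\<i>, 1] u z"
proof (rule ccontr)
  let ?P = "dirderivs [\<i>, 1] u" and ?Q = "dirderivs [1, \<i>] u"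
  assume ne: "?Q z \<noteq> ?P z"
  \<comment> \<open>Half the gap: if values within \<open>e\<close> of the two sides coincide, then
    the gap is less than \<open>e + e\<close>, which is the gap itself.\<close>
  define e where "e = \<bar>?P z - ?Q z\<bar> / 2"
  have "e > 0" using ne by (simp add: e_def)
  have cont: "continuous_on S ?P" "continuous_on S ?Q"
    using u unfolding Ck_on_def by (metis length_Cons list.size(3) numeral_2_eq_2)+
  have d0: "u differentiable (at x)" if "x \<in> S" for x
    using u that unfolding Ck_on_def by (elim conjE allE[of _ "[]"]) auto
  have d1: "dirderivs [v] u differentiable (at x)" if "x \<in> S" for x v
    using u that unfolding Ck_on_def by (elim conjE allE[of _ "[v]"]) auto
  obtain d1 where d1': "d1 > 0" "ball z d1 \<subseteq> S" using \<open>open S\<close> z openE by blast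
  have "isCont ?P z" "isCont ?Q z"
    using cont z \<open>open S\<close> by (auto simp: continuous_on_eq_continuous_at)
  then obtain d2 d3 where d23: "d2 > 0" "\<And>w. dist w z < d2 \<Longrightarrow> dist (?P w) (?P z) < e"
       "d3 > 0" "\<And>w. dist w z < d3 \<Longrightarrow> dist (?Q w) (?Q z) < e"
    using \<open>e > 0\<close> unfolding continuous_at_eps_delta by metis
  define h where "h = min d1 (min d2 d3) / 3"
  have h: "h > 0" using d1' d23 by (auto simp: h_def)
  have near: "dist (Complex x y) z < min d1 (min d2 d3)"
    if "Re z \<le> x" "x \<le> Re z + h" "Im z \<le> y" "y \<le> Im z + h" for x y
  proof -
    have "dist (Complex x y) z \<le> \<bar>x - Re z\<bar> + \<bar>y - Im z\<bar>"
      using cmod_le[of "Complex x y - z"] by (simp add: dist_norm)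
    also have "\<dots> \<le> 2 * h" using that by auto
    also have "\<dots> < 3 * h" using h by simp
    also have "\<dots> = min d1 (min d2 d3)" by (simp add: h_def)
    finally show ?thesis .
  qed
  have inS: "Complex x y \<in> S"
    if "Re z \<le> x" "x \<le> Re z + h" "Im z \<le> y" "y \<le> Im z + h" for x y
    using near[OF that] d1' by (auto simp: mem_ball dist_commute)
  obtain x y where xy: "Re z < x" "x < Re z + h" "Im z < y" "y < Im z + h"
    and eq1: "u (Complex (Re z + h) (Im z + h)) - u (Complex (Re z + h) (Im z)) 
       - u (Complex (Re z) (Im z + h)) + u (Complex (Re z) (Im z)) = h\<^sup>2 * ?P (Complex x y)"
    by (rule second_difference_mvt[OF h, where g = "\<lambda>x y. u (Complex x y)" and a = "Re z" and b = "Im z"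
        and gx = "\<lambda>x y. dirderivs [1] u (Complex x y)" and gxy = "\<lambda>x y. ?P (Complex x y)"])
       (use inS d0 d1 in \<open>auto intro!: has_real_derivative_along_axes\<close>)
  obtain y' x' where xy': "Im z < y'" "y' < Im z + h" "Re z < x'" "x' < Re z + h" 
    and eq2: "u (Complex (Re z + h) (Im z + h)) - u (Complex (Re z) (Im z + h)) 
       - u (Complex (Re z + h) (Im z)) + u (Complex (Re z) (Im z)) = h\<^sup>2 * ?Q (Complex x' y')"
    by (rule second_difference_mvt[OF h, where g = "\<lambda>y x. u (Complex x y)" and b = "Re z" and a = "Im z"
        and gx = "\<lambda>y x. dirderivs [\<i>] u (Complex x y)" and gxy = "\<lambda>y x. ?Q (Complex x y)"])
       (use inS d0 d1 in \<open>auto intro!: has_real_derivative_along_axes\<close>)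
  have "h\<^sup>2 * ?P (Complex x y) = h\<^sup>2 * ?Q (Complex x' y')" using eq1 eq2 by linarith
  then have "?P (Complex x y) = ?Q (Complex x' y')" using h by simp
  moreover have "dist (?P (Complex x y)) (?P z) < e"
    by (rule d23(2)) (use near[of x y] xy in auto)
  moreover have "dist (?Q (Complex x' y')) (?Q z) < e"
    by (rule d23(4)) (use near[of x' y'] xy' in auto)
  ultimately have "dist (?P z) (?Q z) < e + e"
    using dist_triangle_less_add[of "?P z" "?P (Complex x y)" e "?Q z" e] by (metis dist_commute)
  then show False unfolding e_def dist_real_def by simp
qed

text \<open>\<open>cnj (cgrad u z)\<close> is \<open>u_x - i u_y\<close>. Its Cauchy-Riemann
  equations are the symmetry of the mixed second derivatives and Laplace's equation. The second
  conclusion makes \<open>u\<close> locally the real part of a primitive of this function.\<close>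

lemma harmonic_on_gradient:
  assumes "open S" "harmonic_on S u"
  shows "(\<lambda>z. cnj (cgrad u z)) holomorphic_on S"
    and "\<And>z. z \<in> S \<Longrightarrow> (u has_derivative (\<lambda>h. Re (cnj (cgrad u z) * h))) (at z)"
proof -
  have u: "Ck_on 2 S u" using assms by (simp add: harmonic_on_def)
  have d0: "u differentiable (at x)" if "x \<in> S" for x
    using u that unfolding Ck_on_def by (elim conjE allE[of _ "[]"]) auto
  have d1: "dirderivs [v] u differentiable (at x)" if "x \<in> S" for x v
    using u that unfolding Ck_on_def by (elim conjE allE[of _ "[v]"]) auto
  have lin_decomp: "L h = Re h * L 1 + Im h * L \<i>" if "linear L" for L :: "complex \<Rightarrow> real" and h
  proof -
    have "L h = L (Re h *\<^sub>R 1 + Im h *\<^sub>R \<i>)"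
      by (rule arg_cong[where f = L]) (simp add: complex_eq_iff)
    then show ?thesis using that by (simp add: linear_add linear_scale)
  qed
  have lin: "linear (frechet_derivative g (at z))" if "g differentiable at z" for g :: "complex \<Rightarrow> real" and z
    using that unfolding frechet_derivative_works by (rule has_derivative_linear)
  show "(u has_derivative (\<lambda>h. Re (cnj (cgrad u z) * h))) (at z)" if z: "z \<in> S" for z
  proof -
    have "frechet_derivative u (at z) = (\<lambda>h. Re (cnj (cgrad u z) * h))"
      by (intro ext, subst lin_decomp[OF lin[OF d0[OF z]]]) (simp add: cgrad_def)
    then show ?thesis using d0[OF z] by (metis frechet_derivative_works)
  qed
  show "(\<lambda>z. cnj (cgrad u z)) holomorphic_on S"
  proof (rule holomorphic_onI)
    fix z assume z: "z \<in> S"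
    let ?a = "dirderivs [1, 1] u z" and ?b = "dirderivs [\<i>, 1] u z"
    have D: "(dirderivs [v] u has_derivative (\<lambda>h. Re h * dirderivs [1, v] u z + Im h * dirderivs [\<i>, v] u z)) (at z)" for v
    proof -
      have "frechet_derivative (dirderivs [v] u) (at z) = (\<lambda>h. Re h * dirderivs [1, v] u z + Im h * dirderivs [\<i>, v] u z)"
        by (intro ext, subst lin_decomp[OF lin[OF d1[OF z, of v]]]) simp
      then show ?thesis using d1[OF z, of v] by (metis frechet_derivative_works)
    qed
    have "((\<lambda>w. complex_of_real (dirderivs [1] u w) - \<i> * complex_of_real (dirderivs [\<i>] u w)) has_derivative
        (\<lambda>h. complex_of_real (Re h * dirderivs [1, 1] u z + Im h * dirderivs [\<i>, 1] u z) -
             \<i> * complex_of_real (Re h * dirderivs [1, \<i>] u z + Im h * dirderivs [\<i>, \<i>] u z))) (at z)"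
      by (intro derivative_intros has_derivative_of_real D)
    moreover have "dirderivs [1, \<i>] u z = ?b"
      by (rule Ck_on_2_mixed_derivative[OF \<open>open S\<close> u z])
    moreover have "dirderivs [\<i>, \<i>] u z = - ?a"
      using assms(2) z unfolding harmonic_on_def by (metis add_eq_0_iff)
    moreover have "(\<lambda>w. complex_of_real (dirderivs [1] u w) - \<i> * complex_of_real (dirderivs [\<i>] u w)) = (\<lambda>z. cnj (cgrad u z))"
      by (auto simp: cgrad_def fun_eq_iff)
    ultimately have "((\<lambda>z. cnj (cgrad u z)) has_derivative
        (\<lambda>h. complex_of_real (Re h * ?a + Im h * ?b) - \<i> * complex_of_real (Re h * ?b + Im h * (- ?a)))) (at z)"
      by metis
    moreover have "(\<lambda>h. complex_of_real (Re h * ?a + Im h * ?b) - \<i> * complex_of_real (Re h * ?b + Im h * (- ?a)))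
       = (*) (Complex ?a (- ?b))"
      by (auto simp: fun_eq_iff complex_eq_iff)
    ultimately show "(\<lambda>z. cnj (cgrad u z)) field_differentiable at z within S"
      using field_differentiable_def field_differentiable_at_within has_field_derivative_def by metis
  qed
qed

text \<open>Exponentiating turns a local maximum of a real part into one of a modulus.\<close>

lemma local_real_part_maximum_principle:
  fixes v :: "complex \<Rightarrow> real"
  assumes "open V" "bounded V" and cont: "continuous_on (closure V) v"
    and loc: "\<And>z. z \<in> V \<Longrightarrow> \<exists>e>0. \<exists>H. H holomorphic_on ball z e \<and> (\<forall>w\<in>ball z e. v w = Re (H w))"
    and bd: "\<And>z. z \<in> frontier V \<Longrightarrow> v z \<le> B"
    and z: "z \<in> V"
  shows "v z \<le> B"
proof (rule ccontr)
  assume "\<not> v z \<le> B"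
  have cpt: "compact (closure V)" using \<open>bounded V\<close> by simp
  have "closure V \<noteq> {}" using z closure_subset by blast
  from continuous_attains_sup[OF cpt this cont] obtain m where
    m: "m \<in> closure V" "\<And>y. y \<in> closure V \<Longrightarrow> v y \<le> v m" by blast
  have "v m > B" using m(2)[of z] z closure_subset \<open>\<not> v z \<le> B\<close> by force
  define A where "A = {y \<in> closure V. v y = v m}"
  have "A = closure V \<inter> v -` {v m}" by (auto simp: A_def)
  then have "compact A"
    using continuous_closed_preimage[OF cont _ closed_singleton] cpt compact_Int_closed
    by (metis closed_closure compact_eq_bounded_closed bounded_Int)
  moreover have "A \<noteq> {}" using m by (auto simp: A_def)
  moreover have "continuous_on A Re" by (intro continuous_intros)
  \<comment> \<open>The maximum point furthest to the right. Since \<open>v\<close> takes the same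
    value at a point slightly to the right of \<open>p\<close>, that point would be a maximum point
    too; so no connectedness of \<open>V\<close> enters.\<close>
  ultimately obtain p where p: "p \<in> A" "\<And>y. y \<in> A \<Longrightarrow> Re y \<le> Re p"
    using continuous_attains_sup by metis
  have "p \<in> V"
    using p(1) bd[of p] \<open>v m > B\<close> \<open>open V\<close> by (auto simp: A_def frontier_def interior_open)
  then obtain e H where H: "e > 0" "H holomorphic_on ball p e" "\<And>w. w \<in> ball p e \<Longrightarrow> v w = Re (H w)"
    using loc by metis
  obtain e' where e': "e' > 0" "ball p e' \<subseteq> V" using \<open>p \<in> V\<close> \<open>open V\<close> openE by blast
  define d where "d = min e e'"
  have d: "d > 0" "ball p d \<subseteq> V" "ball p d \<subseteq> ball p e" using H e' by (auto simp: d_def)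
  have "(\<lambda>w. exp (H w)) constant_on ball p d"
  proof (rule maximum_modulus_principle)
    show "(\<lambda>w. exp (H w)) holomorphic_on ball p d"
      by (intro holomorphic_on_compose[OF _ holomorphic_on_exp, unfolded o_def] holomorphic_on_subset[OF H(2) d(3)])
    fix w assume w: "w \<in> ball p d"
    have "w \<in> closure V" using w d(2) closure_subset by fast
    then have "v w \<le> v p" using m(2)[of w] p(1) by (simp add: A_def)
    then show "norm (exp (H w)) \<le> norm (exp (H p))"
      using H(3)[of w] H(3)[of p] w d \<open>e > 0\<close> by (simp add: subset_iff)
  qed (use d in auto)
  then obtain c where c: "\<And>w. w \<in> ball p d \<Longrightarrow> exp (H w) = c" by (auto simp: constant_on_def)
  let ?q = "p + of_real (d/2)"
  have q: "?q \<in> ball p d" using d by (simp add: dist_norm)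
  have "norm (exp (H ?q)) = norm (exp (H p))" using c q d by simp
  then have "v ?q = v p" using H(3)[of ?q] H(3)[of p] q d \<open>e > 0\<close> by (simp add: subset_iff)
  moreover have "?q \<in> closure V" using q d(2) closure_subset by fast
  ultimately have "?q \<in> A" using p(1) by (simp add: A_def)
  from p(2)[OF this] d show False by simp
qed

section \<open>Harnack and gradient estimates from the Schwarz lemma\<close>

text \<open>The Cayley transform \<open>(F - a) / (F + a)\<close> maps the right half-plane into the
  unit disc and sends the centre value \<open>a\<close> to 0. The two halves of the Schwarz lemma
  then become Harnack's lower bound and the gradient bound.\<close>

lemma positive_real_part_estimates:
  assumes holF: "F holomorphic_on ball z d" and "d > 0"
    and pos: "\<And>w. w \<in> ball z d \<Longrightarrow> Re (F w) > 0" and Fz: "F z = of_real a"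
  shows "w \<in> ball z d \<Longrightarrow> a * (d - dist z w) \<le> Re (F w) * (d + dist z w)"
    and "norm (deriv F z) \<le> 2 * a / d"
proof -
  have "a > 0" using pos[of z] \<open>d > 0\<close> Fz by simp
  define \<phi> where "\<phi> \<xi> = (F (z + of_real d * \<xi>) - of_real a) / (F (z + of_real d * \<xi>) + of_real a)" for \<xi>
  have in_ball: "z + of_real d * \<xi> \<in> ball z d" if "norm \<xi> < 1" for \<xi>
    using that \<open>d > 0\<close> by (simp add: dist_norm norm_mult)
  have ne: "F (z + of_real d * \<xi>) + of_real a \<noteq> 0" if "norm \<xi> < 1" for \<xi>
  proof
    assume "F (z + of_real d * \<xi>) + of_real a = 0"
    then have "Re (F (z + of_real d * \<xi>)) + a = 0" by (simp add: complex_eq_iff)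
    then show False using pos[OF in_ball[OF that]] \<open>a > 0\<close> by simp
  qed
  have holFc: "(\<lambda>\<xi>. F (z + of_real d * \<xi>)) holomorphic_on ball 0 1"
    by (rule holomorphic_on_compose_gen[OF _ holF, unfolded o_def])
       (use in_ball in \<open>auto intro!: holomorphic_intros\<close>)
  have "\<phi> holomorphic_on ball 0 1"
    unfolding \<phi>_def using ne by (intro holomorphic_intros holFc) auto
  moreover have "\<phi> 0 = 0" by (simp add: \<phi>_def Fz)
  moreover have "norm (\<phi> \<xi>) < 1" if "norm \<xi> < 1" for \<xi>
  proof -
    let ?G = "F (z + of_real d * \<xi>)"
    have "Re ?G > 0" using pos in_ball that by blast
    then have "(norm (?G - of_real a))\<^sup>2 < (norm (?G + of_real a))\<^sup>2"
      using \<open>a > 0\<close> unfolding cmod_power2 by (simp add: power2_eq_square algebra_simps)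
    then have "norm (?G - of_real a) < norm (?G + of_real a)"
      by (rule power_less_imp_less_base) simp
    then show ?thesis by (simp add: \<phi>_def norm_divide divide_less_eq)
  qed
  ultimately have S: "\<And>\<xi>. norm \<xi> < 1 \<Longrightarrow> norm (\<phi> \<xi>) \<le> norm \<xi>" "norm (deriv \<phi> 0) \<le> 1"
    using Schwarz_Lemma'[of \<phi>] by auto
  show "a * (d - dist z w) \<le> Re (F w) * (d + dist z w)" if w: "w \<in> ball z d"
  proof -
    define \<xi> where "\<xi> = (w - z) / of_real d"
    have w_eq: "w = z + of_real d * \<xi>" using \<open>d > 0\<close> by (simp add: \<xi>_def)
    have n\<xi>: "norm \<xi> = dist z w / d" using \<open>d > 0\<close> by (simp add: \<xi>_def norm_divide dist_norm norm_minus_commute)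
    then have lt: "norm \<xi> < 1" using w \<open>d > 0\<close> by simp
    have "norm (F w - of_real a) \<le> norm \<xi> * norm (F w + of_real a)"
      using S(1)[OF lt] ne[OF lt] by (simp add: \<phi>_def w_eq norm_divide divide_le_eq)
    then have "(norm (F w - of_real a))\<^sup>2 \<le> (norm \<xi>)\<^sup>2 * (norm (F w + of_real a))\<^sup>2"
      using power_mono[of _ _ 2] by (fastforce simp: power_mult_distrib)
    then have "(Re (F w) - a)\<^sup>2 + (Im (F w))\<^sup>2 \<le> (norm \<xi>)\<^sup>2 * ((Re (F w) + a)\<^sup>2 + (Im (F w))\<^sup>2)"
      by (simp add: cmod_power2)
    \<comment> \<open>Since the modulus of \<xi> is below 1, the imaginary part counts for more on
      the left than on the right and may be dropped from both sides.\<close>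
    moreover have "(norm \<xi>)\<^sup>2 * (Im (F w))\<^sup>2 \<le> 1 * (Im (F w))\<^sup>2"
      using lt by (intro mult_right_mono) (auto simp: power_le_one_iff)
    ultimately have "(a - Re (F w))\<^sup>2 \<le> (norm \<xi>)\<^sup>2 * (Re (F w) + a)\<^sup>2"
      unfolding power2_commute[of a] by (simp only: distrib_left)
    then have "(a - Re (F w))\<^sup>2 \<le> (norm \<xi> * (Re (F w) + a))\<^sup>2"
      by (simp only: power_mult_distrib)
    moreover have "norm \<xi> * (Re (F w) + a) \<ge> 0" using pos[OF w] \<open>a > 0\<close> by auto
    ultimately have "a - Re (F w) \<le> norm \<xi> * (Re (F w) + a)"
      using power2_le_imp_le by blast
    then show ?thesis unfolding n\<xi> using \<open>d > 0\<close> by (simp add: field_simps)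
  qed
  show "norm (deriv F z) \<le> 2 * a / d"
  proof -
    have "(F has_field_derivative deriv F z) (at z)"
      using holF \<open>d > 0\<close> by (simp add: holomorphic_derivI[of F "ball z d"])
    then have D: "(F has_field_derivative deriv F z) (at (z + of_real d * 0))" by simp
    have "((\<lambda>\<xi>. F (z + of_real d * \<xi>)) has_field_derivative deriv F z * of_real d) (at 0)"
      by (rule DERIV_chain2[of F _ "\<lambda>\<xi>. z + of_real d * \<xi>", OF D]) (auto intro!: derivative_eq_intros)
    then have "(\<phi> has_field_derivative
        ((deriv F z * of_real d) * (F (z + of_real d * 0) + of_real a) -
         (F (z + of_real d * 0) - of_real a) * (deriv F z * of_real d)) / 
         ((F (z + of_real d * 0) + of_real a) * (F (z + of_real d * 0) + of_real a))) (at 0)"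
      unfolding \<phi>_def using ne[of 0] by (auto intro!: derivative_eq_intros)
    then have "deriv \<phi> 0 = (deriv F z * of_real d) * (2 * of_real a) / ((2 * of_real a) * (2 * of_real a))"
      by (auto simp: Fz dest!: DERIV_imp_deriv)
    then have "deriv \<phi> 0 = deriv F z * of_real d / (2 * of_real a)"
      using \<open>a > 0\<close> by simp
    then have "norm (deriv \<phi> 0) = norm (deriv F z) * d / (2 * a)"
      using \<open>a > 0\<close> \<open>d > 0\<close> by (simp add: norm_mult norm_divide)
    with S(2) show ?thesis using \<open>a > 0\<close> \<open>d > 0\<close> by (simp add: field_simps)
  qed
qed

text \<open>Phragmen-Lindelof: the logarithm with pole in an exterior disc is a positive harmonic
  barrier at infinity.\<close>

lemma bounded_local_real_part_nonpos:
  fixes v :: "complex \<Rightarrow> real"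
  assumes "open \<Omega>" and ext: "r > 0" "ball w r \<inter> \<Omega> = {}"
    and cont: "continuous_on (closure \<Omega>) v"
    and loc: "\<And>z. z \<in> \<Omega> \<Longrightarrow> \<exists>e>0. \<exists>H. H holomorphic_on ball z e \<and> (\<forall>x\<in>ball z e. v x = Re (H x))"
    and bd: "\<And>z. z \<in> \<Omega> \<Longrightarrow> v z \<le> B" and fr: "\<And>z. z \<in> frontier \<Omega> \<Longrightarrow> v z \<le> 0"
    and z: "z \<in> \<Omega>"
  shows "v z \<le> 0"
proof (rule field_le_epsilon)
  fix e :: real assume "e > 0"
  define L where "L x = ln (norm (x - w) / r)" for x
  have far: "norm (x - w) \<ge> r" if "x \<in> closure \<Omega>" for x
  proof -
    have "ball w r \<inter> closure \<Omega> = {}" using ext open_Int_closure_eq_empty by blast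
    then show ?thesis using that by (force simp: dist_norm norm_minus_commute)
  qed
  have L0: "L x \<ge> 0" if "x \<in> closure \<Omega>" for x
    using far[OF that] \<open>r > 0\<close> by (simp add: L_def)
  \<comment> \<open>Makes the barrier cost at most \<open>e\<close> at the given point
    \<open>z\<close>.\<close>
  define \<delta> where "\<delta> = e / (L z + 1)"
  have zc: "z \<in> closure \<Omega>" using z closure_subset by blast
  have "\<delta> > 0" using \<open>e > 0\<close> L0[OF zc] by (simp add: \<delta>_def)
  \<comment> \<open>The first entry puts \<open>z\<close> inside the disc; the second makes the
    barrier \<open>\<delta> * L\<close> at least \<open>B\<close> on its circle, so that it absorbs
    the bound on \<open>v\<close>.\<close>
  define \<rho> where "\<rho> = max (norm (z - w) + 1) (r * exp (B / \<delta>))"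
  define S where "S = \<Omega> \<inter> ball w \<rho>"
  have clS: "closure S \<subseteq> closure \<Omega>" unfolding S_def by (intro closure_mono) auto
  have "v z - \<delta> * L z \<le> 0"
  proof (rule local_real_part_maximum_principle)
    show "open S" "bounded S" using \<open>open \<Omega>\<close> by (auto simp: S_def intro: bounded_subset)
    have "norm (x - w) / r \<noteq> 0" if "x \<in> closure S" for x using far[of x] that clS \<open>r > 0\<close> by auto
    then show "continuous_on (closure S) (\<lambda>x. v x - \<delta> * L x)"
      unfolding L_def using \<open>r > 0\<close> by (intro continuous_intros continuous_on_subset[OF cont clS]) auto
    show "z \<in> S" using z by (auto simp: S_def \<rho>_def dist_norm norm_minus_commute)
    fix x
    { assume x: "x \<in> frontier S"
      then have "x \<in> frontier \<Omega> \<or> x \<in> frontier (ball w \<rho>)"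
        using frontier_Int_subset[of \<Omega> "ball w \<rho>"] by (auto simp: S_def)
      then have "x \<in> frontier \<Omega> \<or> x \<in> \<Omega> \<and> norm (x - w) = \<rho>"
      proof
        assume "x \<in> frontier (ball w \<rho>)"
        moreover have "\<rho> > 0" unfolding \<rho>_def by (smt (verit) norm_ge_zero)
        ultimately have "norm (x - w) = \<rho>" by (simp add: frontier_ball dist_norm norm_minus_commute)
        moreover have "x \<in> closure \<Omega>" using x clS by (auto simp: frontier_def)
        ultimately show ?thesis using \<open>open \<Omega>\<close> by (auto simp: frontier_def interior_open)
      qed auto
      then show "v x - \<delta> * L x \<le> 0"
      proof
        assume "x \<in> frontier \<Omega>"
        moreover from this have "\<delta> * L x \<ge> 0" using L0[of x] \<open>\<delta> > 0\<close> by (auto simp: frontier_def)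
        ultimately show ?thesis using fr[of x] by simp
      next
        assume x: "x \<in> \<Omega> \<and> norm (x - w) = \<rho>"
        have "exp (B / \<delta>) \<le> \<rho> / r" using \<open>r > 0\<close> by (simp add: \<rho>_def field_simps)
        then have "B / \<delta> \<le> ln (\<rho> / r)" by (smt (verit) exp_gt_zero ln_exp ln_mono)
        then have "B \<le> \<delta> * L x" using \<open>\<delta> > 0\<close> x by (simp add: L_def field_simps)
        with bd[of x] x show ?thesis by simp
      qed
    next
      assume x: "x \<in> S"
      then have x\<Omega>: "x \<in> \<Omega>" by (simp add: S_def)
      from loc[OF this] obtain d H where H: "d > 0" "H holomorphic_on ball x d" "\<And>y. y \<in> ball x d \<Longrightarrow> v y = Re (H y)"
        by metis
      have xw: "norm (x - w) > 0" using far[of x] x\<Omega> closure_subset \<open>r > 0\<close> by force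
      define d' where "d' = min d (norm (x - w))"
      have half: "Re ((y - w) / (x - w)) > 0" if "y \<in> ball x d'" for y
      proof -
        have "norm ((y - w) / (x - w) - 1) = norm (y - x) / norm (x - w)"
          using xw by (simp add: divide_simps norm_divide[symmetric])
        also have "\<dots> < 1" using that xw by (simp add: d'_def dist_norm norm_minus_commute)
        finally show ?thesis using abs_Re_le_cmod[of "(y - w) / (x - w) - 1"] by simp
      qed
      \<comment> \<open>The branch of the logarithm is normalised at \<open>x\<close>: near
        \<open>x\<close> the quotient stays in the right half-plane, away from the cut of
        \<open>Ln\<close>.\<close>
      let ?H = "\<lambda>y. H y - of_real \<delta> * (Ln ((y - w) / (x - w)) + of_real (ln (norm (x - w) / r)))"
      have "?H holomorphic_on ball x d'"
        by (intro holomorphic_intros holomorphic_on_subset[OF H(2)])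
           (use half xw in \<open>auto simp: d'_def complex_nonpos_Reals_iff not_le\<close>)
      moreover have "v y - \<delta> * L y = Re (?H y)" if y: "y \<in> ball x d'" for y
      proof -
        have "(y - w) / (x - w) \<noteq> 0" using half[OF y] by (metis less_irrefl zero_complex.sel(1))
        then have ne: "norm (y - w) > 0" using xw by auto
        have "Re (Ln ((y - w) / (x - w))) = ln (norm (y - w) / norm (x - w))"
          using \<open>(y - w) / (x - w) \<noteq> 0\<close> by (simp add: norm_divide)
        then have "Re (Ln ((y - w) / (x - w))) + ln (norm (x - w) / r) = L y"
          using ne xw \<open>r > 0\<close> by (simp add: L_def ln_div)
        moreover have "v y = Re (H y)" using H(3) y by (simp add: d'_def)
        ultimately show ?thesis by simp
      qed
      moreover have "d' > 0" using H(1) xw by (simp add: d'_def)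
      ultimately show "\<exists>e>0. \<exists>H. H holomorphic_on ball x e \<and> (\<forall>y\<in>ball x e. v y - \<delta> * L y = Re (H y))"
        by blast
    }
  qed
  then have "v z \<le> \<delta> * L z" by simp
  also have "\<dots> \<le> e" using \<open>e > 0\<close> L0[OF zc] by (simp add: \<delta>_def field_simps)
  finally show "v z \<le> 0 + e" by simp
qed

section \<open>Gradient bound and periodicity\<close>

lemma closure_translation_invariant:
  fixes \<tau> :: "'a::real_normed_vector"
  assumes inv: "\<And>z. z + \<tau> \<in> S \<longleftrightarrow> z \<in> S"
  shows "z + \<tau> \<in> closure S \<longleftrightarrow> z \<in> closure S"
proof -
  have "(\<lambda>z. \<tau> + z) ` S = S"
  proof
    show "(\<lambda>z. \<tau> + z) ` S \<subseteq> S" using inv by (auto simp: add.commute)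
    show "S \<subseteq> (\<lambda>z. \<tau> + z) ` S"
    proof
      fix x assume "x \<in> S"
      then have "x - \<tau> \<in> S" using inv[of "x - \<tau>"] by simp
      then show "x \<in> (\<lambda>z. \<tau> + z) ` S" by (intro image_eqI[of _ _ "x - \<tau>"]) auto
    qed
  qed
  then have "(\<lambda>z. \<tau> + z) ` closure S = closure S" by (metis closure_translation)
  then have "\<tau> + z \<in> closure S \<longleftrightarrow> z \<in> closure S"
    by (metis add_left_cancel image_iff)
  then show ?thesis by (simp add: add.commute)
qed

section \<open>The overdetermined boundary value problem\<close>

text \<open>\<open>f\<close> stands for \<open>u_x - i u_y\<close> and is a datum of its own because
  on the frontier it is the continuous extension of the gradient. Harmonicity of \<open>u\<close> is
  encoded by \<open>hol\<close> together with \<open>deriv_u\<close>. The exterior disc holds the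
  pole of the barriers at infinity.\<close>

locale overdetermined =
  fixes \<Omega> :: "complex set" and u :: "complex \<Rightarrow> real" and f :: "complex \<Rightarrow> complex"
  assumes open_dom: "open \<Omega>" and connected_dom: "connected \<Omega>"
    and frontier_nonempty: "frontier \<Omega> \<noteq> {}"
    and hol: "f holomorphic_on \<Omega>" and cont_f: "continuous_on (closure \<Omega>) f"
    and norm_f_frontier: "\<And>z. z \<in> frontier \<Omega> \<Longrightarrow> norm (f z) = 1"
    and deriv_u: "\<And>z. z \<in> \<Omega> \<Longrightarrow> (u has_derivative (\<lambda>h. Re (f z * h))) (at z)"
    and cont_u: "continuous_on (closure \<Omega>) u"
    and u_pos: "\<And>z. z \<in> \<Omega> \<Longrightarrow> u z > 0"
    and u_frontier: "\<And>z. z \<in> frontier \<Omega> \<Longrightarrow> u z = 0"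
    and exterior_disc: "\<exists>w r. r > 0 \<and> ball w r \<inter> \<Omega> = {}"
begin

lemma closure_cases: "z \<in> closure \<Omega> \<Longrightarrow> z \<in> \<Omega> \<or> z \<in> frontier \<Omega>"
  using open_dom by (auto simp: frontier_def interior_open)

lemma frontier_disjoint: "z \<in> frontier \<Omega> \<Longrightarrow> z \<notin> \<Omega>"
  using open_dom by (auto simp: frontier_def interior_open)

lemma local_primitive:
  assumes sub: "ball z d \<subseteq> \<Omega>"
  obtains F where "\<And>w. w \<in> ball z d \<Longrightarrow> (F has_field_derivative f w) (at w)"
    "\<And>w. w \<in> ball z d \<Longrightarrow> Re (F w) = u w" "F z = of_real (u z)"
proof (cases "d > 0")
  case True
  obtain g where "\<And>w. w \<in> ball z d \<Longrightarrow> (g has_field_derivative f w) (at w within ball z d)"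
    using holomorphic_convex_primitive'[OF convex_ball open_ball holomorphic_on_subset[OF hol sub]] by blast
  then have g: "(g has_field_derivative f w) (at w)" if "w \<in> ball z d" for w
    using that by (metis at_within_open open_ball)
  define F where "F w = g w - g z + of_real (u z)" for w
  have F: "(F has_field_derivative f w) (at w)" if "w \<in> ball z d" for w
    unfolding F_def using g[OF that] by (auto intro!: derivative_eq_intros)
  have "((\<lambda>w. Re (F w) - u w) has_derivative (\<lambda>h. 0)) (at w within ball z d)" if "w \<in> ball z d" for w
  proof -
    have "(F has_derivative (\<lambda>h. f w * h)) (at w)"
      using F[OF that] by (simp add: has_field_derivative_def)
    from has_derivative_diff[OF has_derivative_Re[OF this] deriv_u]
    have "((\<lambda>w. Re (F w) - u w) has_derivative (\<lambda>h. 0)) (at w)" using that sub by auto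
    then show ?thesis by (rule has_derivative_at_withinI)
  qed
  then have const: "Re (F w) - u w = Re (F z) - u z" if "w \<in> ball z d" for w
    using has_derivative_zero_unique[OF convex_ball _ that, of "\<lambda>w. Re (F w) - u w" z] \<open>d > 0\<close> by auto
  have "F z = of_real (u z)" by (simp add: F_def)
  with F const show ?thesis by (intro that[of F]) auto
next
  case False
  then have "w \<notin> ball z d" for w by (metis ball_empty empty_iff not_less)
  then show ?thesis by (intro that[of "\<lambda>_. of_real (u z)"]) blast+
qed

lemma touching_point:
  assumes z: "z \<in> \<Omega>"
  obtains p d where "d > 0" "ball z d \<subseteq> \<Omega>" "p \<in> frontier \<Omega>" "dist z p = d"
proof -
  have "\<Omega> \<noteq> UNIV" using frontier_nonempty by auto
  then have "closed (- \<Omega>)" "- \<Omega> \<noteq> {}" using open_dom by auto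
  then obtain p where p: "p \<in> - \<Omega>" "\<And>y. y \<in> - \<Omega> \<Longrightarrow> dist z p \<le> dist z y"
    using distance_attains_inf by metis
  define d where "d = dist z p"
  have d: "d > 0" using p z by (auto simp: d_def)
  have sub: "ball z d \<subseteq> \<Omega>" using p(2) by (force simp: d_def)
  have "p \<in> closure (ball z d)" using d by (simp add: d_def)
  then have "p \<in> closure \<Omega>" using closure_mono[OF sub] by blast
  then have "p \<in> frontier \<Omega>" using p(1) closure_cases by blast
  with d sub show ?thesis by (intro that[of d p]) (auto simp: d_def)
qed

lemma dist_touching_point_le:
  assumes "ball z d \<subseteq> \<Omega>" "y \<notin> \<Omega>"
  shows "d \<le> dist z y"
  using assms by (force simp: not_less[symmetric])

lemma u_ray_derivative:
  assumes "z + of_real s * h \<in> \<Omega>"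
  shows "((\<lambda>s. u (z + of_real s * h)) has_real_derivative Re (f (z + of_real s * h) * h)) (at s)"
proof -
  have "((\<lambda>s. z + of_real s * h) has_vector_derivative h) (at s)"
    by (auto intro!: derivative_eq_intros)
  moreover have "(u has_derivative (\<lambda>k. Re (f (z + of_real s * h) * k))) 
       (at (z + of_real s * h) within range (\<lambda>s. z + of_real s * h))"
    using deriv_u[OF assms] by (rule has_derivative_at_withinI)
  ultimately show ?thesis
    using vector_derivative_diff_chain_within[of "\<lambda>s. z + of_real s * h" h s UNIV u]
    by (simp add: has_real_derivative_iff_has_vector_derivative o_def)
qed

text \<open>Harnack's inequality in the largest disc around \<open>z\<close> bounds from below the normal derivative,
  which is 1, at a point where that disc touches the frontier.\<close>

lemma u_touching_le:
  assumes d: "d > 0" "ball z d \<subseteq> \<Omega>" and p: "p \<in> frontier \<Omega>" "dist z p = d"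
  shows "u z \<le> 2 * d"
proof -
  have z: "z \<in> \<Omega>" using d by auto
  obtain F where F: "\<And>w. w \<in> ball z d \<Longrightarrow> (F has_field_derivative f w) (at w)"
    "\<And>w. w \<in> ball z d \<Longrightarrow> Re (F w) = u w" "F z = of_real (u z)"
    using local_primitive[OF d(2)] by metis
  have holF: "F holomorphic_on ball z d" unfolding holomorphic_on_open[OF open_ball] using F(1) by blast
  have posF: "Re (F w) > 0" if "w \<in> ball z d" for w using F(2)[OF that] that d u_pos by auto
  define c where "c s = p + of_real s * (z - p)" for s :: real
  have dist_c: "dist z (c s) = (1 - s) * d" if "s < 1" for s
  proof -
    have "z - c s = of_real (1 - s) * (z - p)" by (simp add: c_def algebra_simps)
    then have "dist z (c s) = norm (of_real (1 - s) * (z - p))" by (simp add: dist_norm)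
    also have "\<dots> = \<bar>1 - s\<bar> * d" using p(2) by (simp only: norm_mult norm_of_real dist_norm)
    finally show ?thesis using that by simp
  qed
  have c_in: "c s \<in> ball z d" if "0 < s" "s < 1" for s
    using dist_c[OF that(2)] that d by simp
  have c_cl: "c s \<in> closure \<Omega>" if "0 \<le> s" "s < 1" for s
  proof (cases "s = 0")
    case True
    then show ?thesis using p(1) by (simp add: c_def frontier_def)
  next
    case False
    then have "c s \<in> \<Omega>" using c_in[of s] that d(2) by auto
    then show ?thesis using closure_subset by blast
  qed
  \<comment> \<open>The point \<open>c s\<close> has distance \<open>s * d\<close> from
    \<open>p\<close>, so Harnack gives u(c s) \<ge> u(z) s/(2 - s). From the other side, the mean
    value theorem and |f| \<le> 1 + e near \<open>p\<close> give u(c s) \<le> s(1 + e)d. The factor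
    \<open>s\<close> cancels and \<open>2 - s\<close> is bounded by 2.\<close>
  have "u z \<le> 2 * d * (1 + e)" if "e > 0" for e
  proof -
    have "p \<in> closure \<Omega>" using p by (simp add: frontier_def)
    then obtain \<eta> where \<eta>: "\<eta> > 0" "\<And>w. w \<in> closure \<Omega> \<Longrightarrow> dist w p < \<eta> \<Longrightarrow> dist (f w) (f p) < e"
      using cont_f \<open>e > 0\<close> unfolding continuous_on_iff by metis
    define s where "s = min (1/2) (\<eta> / (2 * d))"
    have s: "0 < s" "s < 1" "s * d < \<eta>" using \<open>d > 0\<close> \<eta>(1) by (auto simp: s_def field_simps min_def)
    have "u z * (d - dist z (c s)) \<le> u (c s) * (d + dist z (c s))"
      using positive_real_part_estimates(1)[OF holF d(1) posF F(3) c_in] F(2)[OF c_in] s by simp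
    then have "u z * (s * d) \<le> u (c s) * ((2 - s) * d)"
      using s by (simp add: dist_c algebra_simps)
    then have 1: "u z * s \<le> u (c s) * (2 - s)" using \<open>d > 0\<close> by (simp flip: mult.assoc)
    have "continuous_on {0..s} (\<lambda>s. u (c s))"
      by (rule continuous_on_compose2[OF cont_u]) (use c_cl s in \<open>auto simp: c_def[abs_def] intro!: continuous_intros\<close>)
    moreover have der: "((\<lambda>s. u (c s)) has_real_derivative Re (f (c t) * (z - p))) (at t)" if "0 < t" "t < s" for t
      using u_ray_derivative[of p t "z - p"] c_in[of t] that s d(2) by (auto simp: c_def)
    ultimately obtain t where t: "0 < t" "t < s" "u (c s) - u (c 0) = (s - 0) * Re (f (c t) * (z - p))"
      using MVT[of 0 s "\<lambda>s. u (c s)"] s by (metis DERIV_unique real_differentiable_def)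
    have "dist (c t) p = t * d" using t p(2) by (simp add: c_def dist_norm norm_mult)
    also have "\<dots> < \<eta>" using t s \<open>d > 0\<close> by (smt (verit) mult_less_cancel_right)
    finally have "dist (f (c t)) (f p) < e" using \<eta>(2)[of "c t"] c_cl[of t] t s by simp
    then have "norm (f (c t)) \<le> 1 + e"
      using norm_f_frontier[OF p(1)] norm_triangle_ineq2[of "f (c t)" "f p"] by (simp add: dist_norm)
    have "u (c s) = s * Re (f (c t) * (z - p))" using t(3) u_frontier[OF p(1)] by (simp add: c_def)
    also have "\<dots> \<le> s * norm (f (c t) * (z - p))" using s by (intro mult_left_mono complex_Re_le_cmod) auto
    also have "\<dots> = s * (norm (f (c t)) * d)" using p(2) by (simp add: norm_mult dist_norm)
    also have "\<dots> \<le> s * ((1 + e) * d)"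
      using s \<open>d > 0\<close> \<open>norm (f (c t)) \<le> 1 + e\<close> by (intro mult_left_mono mult_right_mono) auto
    finally have "u (c s) * (2 - s) \<le> s * ((1 + e) * d) * (2 - s)" using s by (intro mult_right_mono) auto
    also have "\<dots> \<le> s * ((1 + e) * d) * 2" using s \<open>d > 0\<close> \<open>e > 0\<close> by (intro mult_left_mono) auto
    finally have "u z * s \<le> (2 * d * (1 + e)) * s" using 1 by (simp add: algebra_simps)
    then show ?thesis using s by (simp only: mult_le_cancel_right)
  qed
  then have "u z / (2 * d) \<le> 1 + e" if "e > 0" for e
    using that \<open>d > 0\<close> by (simp add: divide_le_eq mult.commute)
  then have "u z / (2 * d) \<le> 1" by (rule field_le_epsilon)
  then show ?thesis using \<open>d > 0\<close> by (simp add: field_simps)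
qed

text \<open>The largest disc around \<open>z\<close> is no larger than the distance to any point of
  the complement. This is what bounds \<open>u\<close> on lines that leave \<Omega>, and on all of
  \<Omega> if it lies in a strip.\<close>

lemma u_le_dist:
  assumes "z \<in> \<Omega>" "y \<notin> \<Omega>"
  shows "u z \<le> 2 * dist z y"
  using touching_point[OF assms(1)] u_touching_le dist_touching_point_le[OF _ assms(2)] by (smt (verit))

text \<open>In the largest disc, of radius \<open>d\<close>, the gradient of a positive harmonic
  function is at most 2u/d, and u \<le> 2d. The 4 matters only as some bound that lets
  Phragmen-Lindelof start.\<close>

lemma norm_f_le_4:
  assumes z: "z \<in> closure \<Omega>"
  shows "norm (f z) \<le> 4"
proof (cases "z \<in> \<Omega>")
  case True
  obtain p d where d: "d > 0" "ball z d \<subseteq> \<Omega>" "p \<in> frontier \<Omega>" "dist z p = d"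
    using touching_point[OF True] by metis
  obtain F where F: "\<And>w. w \<in> ball z d \<Longrightarrow> (F has_field_derivative f w) (at w)"
    "\<And>w. w \<in> ball z d \<Longrightarrow> Re (F w) = u w" "F z = of_real (u z)"
    using local_primitive[OF d(2)] by metis
  have "F holomorphic_on ball z d" unfolding holomorphic_on_open[OF open_ball] using F(1) by blast
  moreover have "Re (F w) > 0" if "w \<in> ball z d" for w using F(2)[OF that] that d u_pos by auto
  ultimately have "norm (deriv F z) \<le> 2 * u z / d"
    using positive_real_part_estimates(2)[OF _ d(1)] F(3) by blast
  also have "deriv F z = f z" using F(1) d(1) by (auto intro: DERIV_imp_deriv)
  also have "2 * u z / d \<le> 4" using u_touching_le[OF d] d(1) by (simp add: field_simps)
  finally show ?thesis .
next
  case False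
  then show ?thesis using closure_cases[OF z] norm_f_frontier by auto
qed

text \<open>The maximum principle is applied to \<open>f ^ N * (r / (x - w))\<close>, whose
  logarithmic modulus is N times log|f| - (1/N) log(|x - w|/r): the power turns a small multiple of
  the logarithmic barrier into a single-valued holomorphic factor. If |f(z)| > 1, then |f(z)|^N
  outgrows the fixed number |z - w|/r.\<close>

lemma norm_f_le_1:
  assumes z: "z \<in> \<Omega>"
  shows "norm (f z) \<le> 1"
proof (rule ccontr)
  assume gt: "\<not> norm (f z) \<le> 1"
  obtain w r where r: "r > 0" "ball w r \<inter> \<Omega> = {}" using exterior_disc by blast
  have far: "norm (x - w) \<ge> r" if "x \<in> closure \<Omega>" for x
  proof -
    have "ball w r \<inter> closure \<Omega> = {}" using r open_Int_closure_eq_empty by blast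
    then show ?thesis using that by (force simp: dist_norm norm_minus_commute)
  qed
  obtain N where N: "norm (z - w) / r < norm (f z) ^ N" using real_arch_pow gt by (metis not_le)
  \<comment> \<open>With radius at least \<open>4 ^ N * r\<close>, the factor
    \<open>r / \<rho>\<close> compensates the crude bound 4 for |f| on the outer circle.\<close>
  define \<rho> where "\<rho> = max (norm (z - w) + 1) (4 ^ N * r)"
  define S where "S = \<Omega> \<inter> ball w \<rho>"
  have clS: "closure S \<subseteq> closure \<Omega>" unfolding S_def by (intro closure_mono) auto
  have opS: "open S" using open_dom by (auto simp: S_def)
  have ne: "x - w \<noteq> 0" if "x \<in> closure \<Omega>" for x using far[OF that] r by auto
  define h where "h x = f x ^ N * (of_real r / (x - w))" for x
  have "norm (h z) \<le> 1"
  proof (rule maximum_modulus_frontier[where S = S and f = h and \<xi> = z])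
    show "h holomorphic_on interior S"
      unfolding h_def using ne[OF subsetD[OF closure_subset]]
      by (auto simp: S_def interior_open open_dom open_Int intro!: holomorphic_intros holomorphic_on_subset[OF hol])
    show "continuous_on (closure S) h"
      unfolding h_def using ne clS by (intro continuous_intros continuous_on_subset[OF cont_f clS]) auto
    show "bounded S" by (auto simp: S_def intro: bounded_subset)
    show "z \<in> S" using z by (auto simp: S_def \<rho>_def dist_norm norm_minus_commute)
    fix x assume x: "x \<in> frontier S"
    then have xc: "x \<in> closure \<Omega>" using clS by (auto simp: frontier_def)
    have nh: "norm (h x) = norm (f x) ^ N * (r / norm (x - w))"
      using r by (simp add: h_def norm_mult norm_divide norm_power)
    have "x \<in> frontier \<Omega> \<or> x \<in> frontier (ball w \<rho>)"
      using x frontier_Int_subset[of \<Omega> "ball w \<rho>"] by (auto simp: S_def)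
    then show "norm (h x) \<le> 1"
    proof
      assume "x \<in> frontier \<Omega>"
      then show ?thesis using nh norm_f_frontier far[OF xc] ne[OF xc] by simp
    next
      assume "x \<in> frontier (ball w \<rho>)"
      moreover have "\<rho> > 0" unfolding \<rho>_def by (smt (verit) norm_ge_zero)
      ultimately have x\<rho>: "norm (x - w) = \<rho>" by (simp add: frontier_ball dist_norm norm_minus_commute)
      have "norm (f x) ^ N * (r / \<rho>) \<le> 4 ^ N * (r / \<rho>)"
        using norm_f_le_4[OF xc] r \<open>\<rho> > 0\<close> by (intro mult_right_mono power_mono) auto
      also have "\<dots> \<le> 1" using \<open>\<rho> > 0\<close> by (simp add: \<rho>_def field_simps)
      finally show ?thesis by (simp add: nh x\<rho>)
    qed
  qed
  moreover have "norm (h z) = norm (f z) ^ N * (r / norm (z - w))"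
    using r by (simp add: h_def norm_mult norm_divide norm_power)
  moreover have "norm (z - w) > 0" using ne z closure_subset by fastforce
  ultimately have "norm (f z) ^ N \<le> norm (z - w) / r" using r by (simp add: field_simps)
  with N show False by simp
qed

text \<open>Interior equality makes \<open>f\<close> a constant \<open>c\<close>, so
  \<open>u\<close> is the affine function \<open>L\<close>. Positivity of \<open>u\<close> puts
  \<Omega> inside the half-plane \<open>L > 0\<close>; this connected half-plane cannot leave
  \<Omega>, since \<open>L = u = 0\<close> on the frontier.\<close>

lemma half_plane_if_norm_f_eq_1:
  assumes z: "z \<in> \<Omega>" "norm (f z) = 1"
  shows "is_half_plane \<Omega>"
proof -
  have "f constant_on \<Omega>"
    by (rule maximum_modulus_principle[OF hol open_dom connected_dom open_dom order_refl z(1)])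
       (use norm_f_le_1 z(2) in auto)
  then obtain c where c: "\<And>w. w \<in> \<Omega> \<Longrightarrow> f w = c" by (auto simp: constant_on_def)
  have nc: "norm c = 1" using c z by auto
  obtain p where p: "p \<in> frontier \<Omega>" using frontier_nonempty by blast
  define L where "L w = Re (c * (w - p))" for w
  have "((\<lambda>w. u w - L w) has_derivative (\<lambda>h. 0)) (at w)" if "w \<in> \<Omega>" for w
  proof -
    have "(L has_derivative (\<lambda>h. Re (c * h))) (at w)"
      unfolding L_def by (auto intro!: derivative_eq_intros)
    from has_derivative_diff[OF deriv_u[OF that] this] show ?thesis using c[OF that] by simp
  qed
  then have "(\<lambda>w. u w - L w) constant_on \<Omega>"
    using has_derivative_zero_unique_connected[OF open_dom connected_dom, of "\<lambda>w. u w - L w"]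
    by (metis (mono_tags, lifting) constant_on_def)
  then obtain k where k: "\<And>w. w \<in> \<Omega> \<Longrightarrow> u w - L w = k" by (auto simp: constant_on_def)
  have "continuous_on (closure \<Omega>) (\<lambda>w. u w - L w)"
    unfolding L_def by (intro continuous_intros cont_u)
  then have k': "u w - L w = k" if "w \<in> closure \<Omega>" for w
    using continuous_constant_on_closure[of \<Omega> "\<lambda>w. u w - L w" k] k that by blast
  have "p \<in> closure \<Omega>" using p by (simp add: frontier_def)
  from k'[OF this] have "k = 0" using u_frontier[OF p] by (simp add: L_def)
  define H where "H = {w. L w > 0}"
  have sub: "\<Omega> \<subseteq> H" using k u_pos \<open>k = 0\<close> by (force simp: H_def)
  have "H \<subseteq> \<Omega>"
  proof (rule ccontr)
    assume "\<not> H \<subseteq> \<Omega>"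
    moreover have "connected H"
    proof -
      have "H = {w. cnj c \<bullet> w > cnj c \<bullet> p}"
        by (auto simp: H_def L_def inner_complex_def algebra_simps)
      then show ?thesis using convex_halfspace_gt convex_connected by metis
    qed
    ultimately obtain q where q: "q \<in> H" "q \<in> frontier \<Omega>"
      using connected_Int_frontier[of H \<Omega>] sub z(1) by blast
    then have "q \<in> closure \<Omega>" by (simp add: frontier_def)
    from k'[OF this] q u_frontier[OF q(2)] \<open>k = 0\<close> show False by (simp add: H_def)
  qed
  with sub have "\<Omega> = H" by blast
  \<comment> \<open>Multiplication by \<open>\<i>\<close> turns the real part into the imaginary
    part that \<open>is_half_plane\<close> asks for.\<close>
  moreover have "Im ((w - p) / (1 / (\<i> * c))) = L w" for w by (simp add: L_def algebra_simps)
  ultimately have "\<Omega> = {w. Im ((w - p) / (1 / (\<i> * c))) > 0}" by (simp add: H_def)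
  moreover have "1 / (\<i> * c) \<noteq> 0" using nc by auto
  ultimately show ?thesis unfolding is_half_plane_def by blast
qed

lemma norm_f_less_1:
  assumes "\<not> is_half_plane \<Omega>" "z \<in> \<Omega>"
  shows "norm (f z) < 1"
  using norm_f_le_1 half_plane_if_norm_f_eq_1 assms by (metis less_eq_real_def)

section \<open>Boundedness of the translation difference and periodicity\<close>

text \<open>If the segment from \<open>z\<close> to \<open>z + h\<close> stays in \<Omega>,
  integrate |f| \<le> 1 along it. If it leaves, then already \<open>u (z + h)\<close> is at most
  twice the distance to a point of the segment outside \<Omega>. Without the second case, detours
  inside \<Omega> would have to be controlled.\<close>

lemma u_diff_le:
  assumes z: "z \<in> \<Omega>" "z + h \<in> \<Omega>"
  shows "u (z + h) - u z \<le> 2 * norm h"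
proof (cases "\<forall>s\<in>{0..1}. z + of_real s * h \<in> \<Omega>")
  case True
  obtain t where t: "0 < t" "t < 1" "u (z + of_real 1 * h) - u (z + of_real 0 * h) = (1 - 0) * Re (f (z + of_real t * h) * h)"
    using MVT2[of 0 1 "\<lambda>s. u (z + of_real s * h)" "\<lambda>s. Re (f (z + of_real s * h) * h)"]
      u_ray_derivative True by auto
  then have "u (z + h) - u z \<le> norm (f (z + of_real t * h) * h)"
    using complex_Re_le_cmod[of "f (z + of_real t * h) * h"] by simp
  also have "\<dots> \<le> 1 * norm h"
    unfolding norm_mult using t True norm_f_le_1 by (intro mult_right_mono) auto
  finally show ?thesis by (smt (verit) norm_ge_zero)
next
  case False
  then obtain s where s: "0 \<le> s" "s \<le> 1" "z + of_real s * h \<notin> \<Omega>" by auto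
  have "u (z + h) \<le> 2 * dist (z + h) (z + of_real s * h)" by (rule u_le_dist[OF z(2) s(3)])
  also have "dist (z + h) (z + of_real s * h) = (1 - s) * norm h"
  proof -
    have "z + h - (z + of_real s * h) = of_real (1 - s) * h" by (simp add: algebra_simps)
    then show ?thesis using s unfolding dist_norm by (simp only: norm_mult norm_of_real)
  qed
  also have "\<dots> \<le> norm h" using s by (simp add: mult_left_le_one_le)
  finally show ?thesis using u_pos[OF z(1)] by simp
qed

lemma u_translate:
  assumes inv: "\<And>z. z + \<tau> \<in> \<Omega> \<longleftrightarrow> z \<in> \<Omega>" and z: "z \<in> \<Omega>"
  shows "u (z + \<tau>) \<le> u z"
proof -
  obtain w r where r: "r > 0" "ball w r \<inter> \<Omega> = {}" using exterior_disc by blast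
  have inv_cl: "x + \<tau> \<in> closure \<Omega>" if "x \<in> closure \<Omega>" for x
    using closure_translation_invariant[of \<tau> \<Omega>] inv that by blast
  have inv_fr: "x + \<tau> \<in> frontier \<Omega>" if "x \<in> frontier \<Omega>" for x
    using inv_cl[of x] inv[of x] that frontier_disjoint[of x] closure_cases[of "x + \<tau>"] by (auto simp: frontier_def)
  have "u (z + \<tau>) - u z \<le> 0"
  proof (rule bounded_local_real_part_nonpos[OF open_dom r, where B = "2 * norm \<tau>"])
    show "continuous_on (closure \<Omega>) (\<lambda>z. u (z + \<tau>) - u z)"
      using inv_cl by (intro continuous_intros cont_u continuous_on_compose2[OF cont_u]) auto
    fix x
    { assume x: "x \<in> \<Omega>"
      then obtain e where e: "e > 0" "ball x e \<subseteq> \<Omega>" using open_dom openE by blast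
      have sh: "y + \<tau> \<in> ball (x + \<tau>) e \<longleftrightarrow> y \<in> ball x e" for y by (simp add: dist_norm)
      have e': "ball (x + \<tau>) e \<subseteq> \<Omega>"
      proof
        fix y assume "y \<in> ball (x + \<tau>) e"
        then have "y - \<tau> \<in> ball x e" using sh[of "y - \<tau>"] by simp
        then show "y \<in> \<Omega>" using e inv[of "y - \<tau>"] by auto
      qed
      obtain F where F: "\<And>w. w \<in> ball x e \<Longrightarrow> (F has_field_derivative f w) (at w)"
          "\<And>w. w \<in> ball x e \<Longrightarrow> Re (F w) = u w" using local_primitive[OF e(2)] by metis
      obtain F' where F': "\<And>w. w \<in> ball (x + \<tau>) e \<Longrightarrow> (F' has_field_derivative f w) (at w)"
          "\<And>w. w \<in> ball (x + \<tau>) e \<Longrightarrow> Re (F' w) = u w" using local_primitive[OF e'] by metis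
      have "F holomorphic_on ball x e" "F' holomorphic_on ball (x + \<tau>) e"
        unfolding holomorphic_on_open[OF open_ball] using F(1) F'(1) by blast+
      then have "(\<lambda>y. F' (y + \<tau>) - F y) holomorphic_on ball x e"
        by (intro holomorphic_intros holomorphic_on_compose_gen[of "\<lambda>y. y + \<tau>" _ F' "ball (x + \<tau>) e", unfolded o_def])
           (use sh in auto)
      moreover have "u (y + \<tau>) - u y = Re (F' (y + \<tau>) - F y)" if "y \<in> ball x e" for y
        using F(2)[OF that] F'(2)[of "y + \<tau>"] sh[of y] that by simp
      ultimately show "\<exists>e>0. \<exists>H. H holomorphic_on ball x e \<and> (\<forall>y\<in>ball x e. u (y + \<tau>) - u y = Re (H y))"
        using e(1) by blast
      show "u (x + \<tau>) - u x \<le> 2 * norm \<tau>" using u_diff_le x inv by blast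
    next
      assume "x \<in> frontier \<Omega>"
      then show "u (x + \<tau>) - u x \<le> 0" using inv_fr u_frontier by simp
    }
  qed (use z in auto)
  then show ?thesis by simp
qed

lemma u_periodic:
  assumes inv: "\<And>z. z + \<tau> \<in> \<Omega> \<longleftrightarrow> z \<in> \<Omega>" and z: "z \<in> \<Omega>"
  shows "u (z + \<tau>) = u z"
proof (rule antisym)
  have inv': "z + - \<tau> \<in> \<Omega> \<longleftrightarrow> z \<in> \<Omega>" for z using inv[of "z - \<tau>"] by simp
  show "u (z + \<tau>) \<le> u z" by (rule u_translate[OF inv z])
  show "u z \<le> u (z + \<tau>)" using u_translate[OF inv', of "z + \<tau>"] inv z by simp
qed

lemma f_periodic:
  assumes inv: "\<And>z. z + \<tau> \<in> \<Omega> \<longleftrightarrow> z \<in> \<Omega>" and z: "z \<in> \<Omega>"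
  shows "f (z + \<tau>) = f z"
proof -
  have "(u has_derivative (\<lambda>h. Re (f (z + \<tau>) * h))) (at (z + \<tau>))" using deriv_u inv z by blast
  then have "((\<lambda>w. u (w + \<tau>)) has_derivative (\<lambda>h. Re (f (z + \<tau>) * h))) (at z)"
    by (intro has_derivative_compose[of "\<lambda>w. w + \<tau>" "\<lambda>h. h" z UNIV u]) (auto intro!: derivative_eq_intros)
  then have "(u has_derivative (\<lambda>h. Re (f (z + \<tau>) * h))) (at z)"
    by (rule has_derivative_transform_within_open[OF _ open_dom z]) (use u_periodic[OF inv] in auto)
  then have eq: "(\<lambda>h. Re (f (z + \<tau>) * h)) = (\<lambda>h. Re (f z * h))"
    using deriv_u[OF z] has_derivative_unique by blast
  have "Re (f (z + \<tau>)) = Re (f z)" using fun_cong[OF eq, of 1] by simp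
  moreover have "Im (f (z + \<tau>)) = Im (f z)" using fun_cong[OF eq, of \<i>] by simp
  ultimately show ?thesis by (simp add: complex_eq_iff)
qed

end

section \<open>No frontier component escapes to an end\<close>

text \<open>A C^2 convex truncation of the identity: \<open>b\<close> is a bump of mass 1 on
  [\<epsilon>, 2\<epsilon>], and \<beta>1, \<beta> are its successive primitives. Vanishing up to
  \<epsilon> allows extension by zero across the frontier; the unit rise of \<beta>1 is what the
  later lower bound measures. Only positive arguments occur, as \<open>u > 0\<close> in
  \<Omega>.\<close>

lemma convex_ramp_exists:
  fixes \<epsilon> :: real
  assumes "\<epsilon> > 0"
  obtains \<beta> \<beta>1 b :: "real \<Rightarrow> real" where
    "\<And>s. s > 0 \<Longrightarrow> (\<beta> has_real_derivative \<beta>1 s) (at s)"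
    "\<And>s. s > 0 \<Longrightarrow> (\<beta>1 has_real_derivative b s) (at s)"
    "continuous_on UNIV b" "\<And>s. b s \<ge> 0"
    "\<And>s. s > 0 \<Longrightarrow> s \<le> \<epsilon> \<Longrightarrow> \<beta> s = 0 \<and> \<beta>1 s = 0 \<and> b s = 0"
    "\<And>s. s \<ge> 2 * \<epsilon> \<Longrightarrow> \<beta>1 s = 1 \<and> b s = 0"
    "\<And>s. s > 0 \<Longrightarrow> 0 \<le> \<beta> s \<and> \<beta> s \<le> s"
proof -
  \<comment> \<open>The positive part of a parabola with zeros \<epsilon> and 2\<epsilon>:
    continuity suffices, because \<open>b\<close> is differentiated nowhere.\<close>
  define b0 where "b0 s = max 0 ((s - \<epsilon>) * (2 * \<epsilon> - s))" for s :: real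
  have b0: "continuous_on S b0" for S unfolding b0_def by (intro continuous_intros)
  have b0_ge: "b0 s \<ge> 0" for s by (simp add: b0_def)
  have b0_0: "b0 s = 0" if "s \<le> \<epsilon> \<or> s \<ge> 2 * \<epsilon>" for s
  proof -
    have "(s - \<epsilon>) * (2 * \<epsilon> - s) \<le> 0"
      using that \<open>\<epsilon> > 0\<close> by (auto intro: mult_nonpos_nonneg mult_nonneg_nonpos)
    then show ?thesis by (simp add: b0_def)
  qed
  define B where "B s = integral {0..s} b0" for s
  have B': "(B has_real_derivative b0 s) (at s)" if "s > 0" for s
  proof -
    have "(B has_real_derivative b0 s) (at s within {0..s+1})"
      unfolding B_def using that by (intro integral_has_real_derivative b0) auto
    then show ?thesis using that by (simp add: at_within_Icc_at)
  qed
  have B_0: "B s = 0" if "s \<le> \<epsilon>" for s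
  proof -
    have "B s = integral {0..s} (\<lambda>_. 0 :: real)"
      unfolding B_def using that by (intro integral_cong b0_0) auto
    then show ?thesis by simp
  qed
  have B_mono: "B s \<le> B t" if "0 < s" "s \<le> t" for s t
    using that by (intro DERIV_nonneg_imp_nondecreasing[OF that(2)]) (meson B' b0_ge less_le_trans)
  define \<kappa> where "\<kappa> = B (2 * \<epsilon>)"
  have "B \<epsilon> < B (2 * \<epsilon>)"
  proof (rule DERIV_pos_imp_increasing_open[of \<epsilon> "2 * \<epsilon>" B])
    show "continuous_on {\<epsilon>..2 * \<epsilon>} B"
      using B' \<open>\<epsilon> > 0\<close> by (intro DERIV_continuous_on[of _ B b0]) (auto intro: has_field_derivative_at_within)
    fix x assume "\<epsilon> < x" "x < 2 * \<epsilon>"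
    then show "\<exists>y. (B has_real_derivative y) (at x) \<and> 0 < y"
      using B'[of x] \<open>\<epsilon> > 0\<close> by (intro exI[of _ "b0 x"]) (auto simp: b0_def max_def not_le zero_less_mult_iff)
  qed (use \<open>\<epsilon> > 0\<close> in auto)
  then have "\<kappa> > 0" by (simp add: B_0 \<kappa>_def)
  have B_1: "B s = \<kappa>" if "s \<ge> 2 * \<epsilon>" for s
  proof (cases "s = 2 * \<epsilon>")
    case False
    have "B s = B (2 * \<epsilon>)"
    proof (rule DERIV_isconst_end[of "2 * \<epsilon>" s B])
      show "continuous_on {2 * \<epsilon>..s} B"
        using B' \<open>\<epsilon> > 0\<close> by (intro DERIV_continuous_on[of _ B b0]) (auto intro: has_field_derivative_at_within)
      fix x assume "2 * \<epsilon> < x" "x < s"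
      then show "(B has_real_derivative 0) (at x)" using B'[of x] b0_0[of x] \<open>\<epsilon> > 0\<close> by simp
    qed (use that False in auto)
    then show ?thesis by (simp add: \<kappa>_def)
  qed (simp add: \<kappa>_def)
  have B_range: "0 \<le> B s \<and> B s \<le> \<kappa>" if "s > 0" for s
    using B_mono[of "min s \<epsilon>" s] B_mono[of s "max s (2 * \<epsilon>)"] B_0[of "min s \<epsilon>"] B_1[of "max s (2 * \<epsilon>)"] that \<open>\<epsilon> > 0\<close> by auto
  define \<beta>1 where "\<beta>1 s = B s / \<kappa>" for s
  define b where "b s = b0 s / \<kappa>" for s
  define \<beta> where "\<beta> s = integral {0..s} \<beta>1" for s
  have cont_\<beta>1: "continuous_on {0..s} \<beta>1" for s
    unfolding \<beta>1_def B_def using \<open>\<kappa> > 0\<close>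
    by (intro continuous_intros indefinite_integral_continuous_1 integrable_continuous_real b0) auto
  have \<beta>': "(\<beta> has_real_derivative \<beta>1 s) (at s)" if "s > 0" for s
  proof -
    have "(\<beta> has_real_derivative \<beta>1 s) (at s within {0..s+1})"
      unfolding \<beta>_def using that by (intro integral_has_real_derivative cont_\<beta>1) auto
    then show ?thesis using that by (simp add: at_within_Icc_at)
  qed
  have \<beta>_range: "0 \<le> \<beta> s \<and> \<beta> s \<le> s" if "s > 0" for s
  proof -
    have rng: "0 \<le> \<beta>1 x \<and> \<beta>1 x \<le> 1" if "x \<ge> 0" for x
      using B_range[of x] that \<open>\<kappa> > 0\<close> by (cases "x = 0") (auto simp: \<beta>1_def B_def)
    have int: "\<beta>1 integrable_on {0..s}" by (intro integrable_continuous_real cont_\<beta>1)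
    have "integral {0..s} (\<lambda>_. 0) \<le> \<beta> s"
      unfolding \<beta>_def by (rule integral_le) (use int rng in auto)
    moreover have "\<beta> s \<le> integral {0..s} (\<lambda>_. 1 :: real)"
      unfolding \<beta>_def by (rule integral_le) (use int rng in auto)
    ultimately show ?thesis using that by simp
  qed
  have \<beta>_0: "\<beta> s = 0" if "s \<le> \<epsilon>" for s
  proof -
    have "\<beta> s = integral {0..s} (\<lambda>_. 0 :: real)"
      unfolding \<beta>_def using that by (intro integral_cong) (auto simp: \<beta>1_def B_0)
    then show ?thesis by simp
  qed
  show ?thesis
  proof (rule that[of \<beta> \<beta>1 b])
    show "(\<beta>1 has_real_derivative b s) (at s)" if "s > 0" for s
      unfolding \<beta>1_def b_def using B'[OF that] by (rule DERIV_cdivide)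
    show "continuous_on UNIV b" unfolding b_def using \<open>\<kappa> > 0\<close> by (intro continuous_intros b0) auto
  qed (use \<beta>' \<beta>_range \<beta>_0 B_0 B_1 b0_0 b0_ge \<open>\<kappa> > 0\<close> in \<open>auto simp: \<beta>1_def b_def\<close>)
qed

text \<open>The symmetric sum V(m + t) + V(m - t) - ct^2 is nondecreasing in \<open>t\<close>: its
  derivative is V'(m + t) - V'(m - t) - 2ct, and the mean value theorem for \<open>V'\<close> bounds
  it from below by 0.\<close>

lemma second_difference_ge:
  fixes V :: "real \<Rightarrow> real"
  assumes V': "\<And>y. \<bar>y - m\<bar> \<le> h \<Longrightarrow> (V has_real_derivative V' y) (at y)"
    and V'': "\<And>y. \<bar>y - m\<bar> \<le> h \<Longrightarrow> (V' has_real_derivative V'' y) (at y)"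
    and ge: "\<And>y. \<bar>y - m\<bar> \<le> h \<Longrightarrow> V'' y \<ge> c" and "h \<ge> 0"
  shows "V (m + h) + V (m - h) - 2 * V m \<ge> c * h\<^sup>2"
proof -
  define G where "G t = V (m + t) + V (m - t) - c * t\<^sup>2" for t
  have "G 0 \<le> G h"
  proof (rule DERIV_nonneg_imp_nondecreasing[OF \<open>h \<ge> 0\<close>])
    fix t assume t: "0 \<le> t" "t \<le> h"
    have 1: "((\<lambda>t. V (m + t)) has_real_derivative V' (m + t) * 1) (at t)"
      by (rule DERIV_chain2[of V]) (use t in \<open>auto intro!: derivative_eq_intros V'\<close>)
    have 2: "((\<lambda>t. V (m - t)) has_real_derivative V' (m - t) * (-1)) (at t)"
      by (rule DERIV_chain2[of V]) (use t in \<open>auto intro!: derivative_eq_intros V'\<close>)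
    have "(G has_real_derivative V' (m + t) - V' (m - t) - 2 * c * t) (at t)"
      unfolding G_def by (rule derivative_eq_intros 1 2 refl | simp)+
    moreover have "V' (m + t) - V' (m - t) \<ge> 2 * c * t"
    proof (cases "t = 0")
      case False
      then obtain x where x: "m - t < x" "x < m + t"
          "V' (m + t) - V' (m - t) = (m + t - (m - t)) * V'' x"
        using MVT2[of "m - t" "m + t" V' V''] V'' t by (auto simp: abs_le_iff)
      have "2 * t * c \<le> 2 * t * V'' x" using x t by (intro mult_left_mono ge) (auto simp: abs_le_iff)
      then show ?thesis using x by (simp add: algebra_simps)
    qed simp
    ultimately show "\<exists>y. (G has_real_derivative y) (at t) \<and> 0 \<le> y" by fastforce
  qed
  then show ?thesis by (simp add: G_def)
qed

lemma cyl_nonzero [simp]: "cyl \<tau> z \<noteq> 0"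
  by (simp add: cyl_def)

text \<open>Lines of constant height Im(z/\<tau>) become circles about 0; the upper end of the
  cylinder is the puncture at 0, the lower end is infinity.\<close>

lemma norm_cyl:
  "norm (cyl \<tau> z) = exp (- (2 * pi) * Im (z / \<tau>))"
proof -
  have "2 * of_real pi * \<i> * z / \<tau> = of_real (2 * pi) * (\<i> * (z / \<tau>))" by simp
  then have "Re (2 * of_real pi * \<i> * z / \<tau>) = - (2 * pi) * Im (z / \<tau>)"
    by (simp only: Re_complex_of_real Im_complex_of_real times_complex.sel) simp
  then show ?thesis by (simp add: cyl_def)
qed

section \<open>Truncations extended by zero\<close>

context overdetermined
begin

text \<open>Functions of the form \<open>\<phi>(u) k\<close> with \<open>\<phi>\<close> vanishing near 0 extend by zero to the whole plane with the
  regularity they have in \<open>\<Omega>\<close>; this replaces every integration by parts along the frontier.\<close>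

definition cut :: "(real \<Rightarrow> real) \<Rightarrow> (complex \<Rightarrow> real) \<Rightarrow> complex \<Rightarrow> real" where
  "cut \<phi> k z = (if z \<in> \<Omega> then \<phi> (u z) * k z else 0)"

text \<open>Continuous on the whole plane because \<open>u\<close> vanishes on the frontier. Hence
  the sets \<open>u0 < \<epsilon>\<close> are open neighbourhoods of the complement, and together
  with \<Omega> they cover the plane: the pieces on which a \<open>cut\<close> is continuous or
  differentiable are glued along this cover.\<close>

definition u0 :: "complex \<Rightarrow> real" where
  "u0 z = (if z \<in> \<Omega> then u z else 0)"

lemma continuous_u0: "continuous_on UNIV u0"
proof -
  have 1: "continuous_on (closure \<Omega>) u0"
    using cont_u by (rule continuous_on_eq) (use closure_cases u_frontier in \<open>auto simp: u0_def\<close>)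
  have 2: "continuous_on (- \<Omega>) u0"
    using continuous_on_const[of "- \<Omega>" "0 :: real"] by (rule continuous_on_eq) (auto simp: u0_def)
  have "continuous_on (closure \<Omega> \<union> - \<Omega>) u0"
    using 1 2 open_dom by (intro continuous_on_closed_Un) auto
  moreover have "closure \<Omega> \<union> - \<Omega> = UNIV" using closure_subset by auto
  ultimately show ?thesis by simp
qed

lemma open_small: "open {z. u0 z < \<epsilon>}"
  using continuous_u0 by (intro open_Collect_less) auto

lemma cut_eq_0:
  assumes "\<And>s. 0 < s \<Longrightarrow> s \<le> \<epsilon> \<Longrightarrow> \<phi> s = 0" "u0 z < \<epsilon>"
  shows "cut \<phi> k z = 0"
  using assms u_pos[of z] by (auto simp: cut_def u0_def)

lemma cut_zero_right [simp]: "cut \<phi> (\<lambda>_. 0) z = 0"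
  by (simp add: cut_def)

lemma continuous_cut:
  assumes "\<epsilon> > 0" and z0: "\<And>s. 0 < s \<Longrightarrow> s \<le> \<epsilon> \<Longrightarrow> \<phi> s = 0"
    and "continuous_on {0<..} \<phi>" "continuous_on \<Omega> k"
  shows "continuous_on UNIV (cut \<phi> k)"
proof -
  have "continuous_on \<Omega> u" using cont_u closure_subset continuous_on_subset by blast
  then have "continuous_on \<Omega> (\<lambda>z. \<phi> (u z) * k z)"
    using u_pos by (intro continuous_intros assms continuous_on_compose2[OF assms(3)]) auto
  then have 1: "continuous_on \<Omega> (cut \<phi> k)" by (rule continuous_on_eq) (auto simp: cut_def)
  have 2: "continuous_on {z. u0 z < \<epsilon>} (cut \<phi> k)"
    using continuous_on_const[of _ "0 :: real"] by (rule continuous_on_eq) (use cut_eq_0[OF z0] in auto)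
  have "continuous_on (\<Omega> \<union> {z. u0 z < \<epsilon>}) (cut \<phi> k)"
    by (rule continuous_on_open_Un[OF open_dom open_small 1 2])
  moreover have "\<Omega> \<union> {z. u0 z < \<epsilon>} = UNIV" using \<open>\<epsilon> > 0\<close> by (auto simp: u0_def)
  ultimately show ?thesis by simp
qed

text \<open>Inside \<Omega> this is the product rule. Off \<Omega> the point lies in the open set
  \<open>u0 < \<epsilon>\<close>, where the truncated function is identically zero, so the frontier
  is never seen.\<close>

lemma cut_ray_derivative:
  assumes "\<epsilon> > 0" and z0: "\<And>s. 0 < s \<Longrightarrow> s \<le> \<epsilon> \<Longrightarrow> \<phi> s = 0 \<and> \<phi>' s = 0"
    and \<phi>': "\<And>s. s > 0 \<Longrightarrow> (\<phi> has_real_derivative \<phi>' s) (at s)"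
    and k': "\<And>s. z + of_real s * h \<in> \<Omega> \<Longrightarrow> 
       ((\<lambda>s. k (z + of_real s * h)) has_real_derivative k' (z + of_real s * h)) (at s)"
  shows "((\<lambda>s. cut \<phi> k (z + of_real s * h)) has_real_derivative
     cut \<phi>' (\<lambda>w. k w * Re (f w * h)) (z + of_real s * h) + cut \<phi> k' (z + of_real s * h)) (at s)"
proof (cases "z + of_real s * h \<in> \<Omega>")
  case True
  have cont: "continuous_on UNIV (\<lambda>s. z + of_real s * h)" by (intro continuous_intros)
  have "((\<lambda>s. \<phi> (u (z + of_real s * h)) * k (z + of_real s * h)) has_real_derivative
      (\<phi>' (u (z + of_real s * h)) * Re (f (z + of_real s * h) * h)) * k (z + of_real s * h) +
        k' (z + of_real s * h) * \<phi> (u (z + of_real s * h))) (at s)"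
    by (intro DERIV_mult DERIV_chain2[of \<phi>] \<phi>' u_pos True u_ray_derivative k')
  then have "((\<lambda>s. cut \<phi> k (z + of_real s * h)) has_real_derivative
      (\<phi>' (u (z + of_real s * h)) * Re (f (z + of_real s * h) * h)) * k (z + of_real s * h) +
        k' (z + of_real s * h) * \<phi> (u (z + of_real s * h))) (at s)"
    by (rule has_field_derivative_transform_within_open[OF _ open_vimage[OF open_dom cont]]) (use True in \<open>auto simp: cut_def\<close>)
  then show ?thesis using True by (simp add: cut_def algebra_simps)
next
  case False
  have cont: "continuous_on UNIV (\<lambda>s. z + of_real s * h)" by (intro continuous_intros)
  have "((\<lambda>s. 0) has_real_derivative 0) (at s)" by simp
  then have "((\<lambda>s. cut \<phi> k (z + of_real s * h)) has_real_derivative 0) (at s)"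
    by (rule has_field_derivative_transform_within_open[OF _ open_vimage[OF open_small[of \<epsilon>] cont]])
       (use False \<open>\<epsilon> > 0\<close> cut_eq_0[of \<epsilon> \<phi>] z0 in \<open>auto simp: u0_def\<close>)
  then show ?thesis using False by (simp add: cut_def)
qed

lemma f_ray_derivative:
  assumes "z + of_real s * h \<in> \<Omega>"
  shows "((\<lambda>s. Re (f (z + of_real s * h) * h)) has_real_derivative Re (deriv f (z + of_real s * h) * h\<^sup>2)) (at s)"
proof -
  have "(f has_field_derivative deriv f (z + of_real s * h)) (at (z + of_real s * h))"
    using hol open_dom assms by (rule holomorphic_derivI)
  then have 1: "((\<lambda>w. f w * h) has_field_derivative deriv f (z + of_real s * h) * h) (at (z + of_real s * h))"
    by (rule DERIV_cmult_right)
  have "((\<lambda>s. z + of_real s * h) has_vector_derivative h) (at s)"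
    by (auto intro!: derivative_eq_intros)
  from field_vector_diff_chain_at[OF this 1]
  have "((\<lambda>s. f (z + of_real s * h) * h) has_vector_derivative deriv f (z + of_real s * h) * h\<^sup>2) (at s)"
    by (simp add: o_def power2_eq_square algebra_simps)
  then show ?thesis
    unfolding has_real_derivative_iff_has_vector_derivative
    by (rule bounded_linear.has_vector_derivative[OF bounded_linear_Re])
qed

end

section \<open>Averages over one period of a line\<close>

locale periodic_overdetermined = overdetermined +
  fixes \<tau> :: complex
  assumes \<tau>_nonzero: "\<tau> \<noteq> 0" and inv: "\<And>z. z + \<tau> \<in> \<Omega> \<longleftrightarrow> z \<in> \<Omega>"
begin

lemma inv_nat: "z + of_nat n * \<tau> \<in> \<Omega> \<longleftrightarrow> z \<in> \<Omega>"
proof (induction n)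
  case (Suc n)
  have "z + of_nat (Suc n) * \<tau> = (z + of_nat n * \<tau>) + \<tau>" by (simp add: algebra_simps)
  then show ?case using inv Suc by metis
qed simp

lemma inv_int: "z + of_int k * \<tau> \<in> \<Omega> \<longleftrightarrow> z \<in> \<Omega>"
proof (cases k)
  case (nonneg n)
  then show ?thesis using inv_nat[of z n] by simp
next
  case (neg n)
  have "(z + of_int k * \<tau>) + of_nat (Suc n) * \<tau> = z" unfolding neg by (simp add: algebra_simps)
  then show ?thesis using inv_nat by metis
qed

text \<open>The integrand is the x-derivative of the periodic function
  \<open>cut \<phi> (\<lambda>w. Re (f w * \<tau>))\<close>. In the coordinates
  \<open>\<tau> * Complex x y\<close>, \<open>x\<close> counts periods and \<open>y\<close> is the
  height Im(z/\<tau>).\<close>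

lemma integral_cut_Re_deriv_eq_0:
  assumes "\<epsilon> > 0" and z0: "\<And>s. s > 0 \<Longrightarrow> s \<le> \<epsilon> \<Longrightarrow> \<phi> s = 0 \<and> \<phi>' s = 0"
    and \<phi>': "\<And>s. s > 0 \<Longrightarrow> (\<phi> has_real_derivative \<phi>' s) (at s)"
  shows "((\<lambda>x. cut \<phi>' (\<lambda>w. (Re (f w * \<tau>))\<^sup>2) (\<tau> * Complex x y) + 
      cut \<phi> (\<lambda>w. Re (deriv f w * \<tau>\<^sup>2)) (\<tau> * Complex x y)) has_integral 0) {0..1}"
proof -
  define J where "J x = cut \<phi> (\<lambda>w. Re (f w * \<tau>)) (\<tau> * Complex x y)" for x
  have P: "\<tau> * Complex x y = \<tau> * (\<i> * of_real y) + of_real x * \<tau>" for x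
    by (simp add: Complex_eq algebra_simps)
  have "(J has_real_derivative cut \<phi>' (\<lambda>w. (Re (f w * \<tau>))\<^sup>2) (\<tau> * Complex x y) + 
      cut \<phi> (\<lambda>w. Re (deriv f w * \<tau>\<^sup>2)) (\<tau> * Complex x y)) (at x)" for x
    unfolding J_def P power2_eq_square[of "Re _"]
    using z0 by (intro cut_ray_derivative[OF \<open>\<epsilon> > 0\<close> _ \<phi>'] f_ray_derivative) auto
  then have "((\<lambda>x. cut \<phi>' (\<lambda>w. (Re (f w * \<tau>))\<^sup>2) (\<tau> * Complex x y) + 
      cut \<phi> (\<lambda>w. Re (deriv f w * \<tau>\<^sup>2)) (\<tau> * Complex x y)) has_integral J 1 - J 0) {0..1}"
    by (intro fundamental_theorem_of_calculus)
       (auto simp flip: has_real_derivative_iff_has_vector_derivative intro: has_field_derivative_at_within)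
  moreover have "J 1 = J 0"
  proof -
    have "\<tau> * Complex 1 y = \<tau> * Complex 0 y + \<tau>" by (simp add: Complex_eq algebra_simps)
    then show ?thesis
      unfolding J_def cut_def using inv u_periodic[OF inv] f_periodic[OF inv] by simp
  qed
  ultimately show ?thesis by simp
qed

text \<open>Two differentiations in \<open>y\<close> under the integral give \<beta>''(u) u_y^2 +
  \<beta>'(u) u_yy. Adding the vanishing integral of \<beta>''(u) u_x^2 + \<beta>'(u) u_xx completes
  the square of the gradient and cancels the \<beta>' terms by harmonicity. The coordinates are
  scaled by \<tau>, whence the factor \<tau> beside \<open>f\<close>.\<close>

lemma line_integral_second_derivative:
  assumes "\<epsilon> > 0"
    and \<beta>': "\<And>s. s > 0 \<Longrightarrow> (\<beta> has_real_derivative \<beta>1 s) (at s)"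
    and \<beta>1': "\<And>s. s > 0 \<Longrightarrow> (\<beta>1 has_real_derivative b s) (at s)"
    and b: "continuous_on UNIV b"
    and z0: "\<And>s. s > 0 \<Longrightarrow> s \<le> \<epsilon> \<Longrightarrow> \<beta> s = 0 \<and> \<beta>1 s = 0 \<and> b s = 0"
  obtains V' where
    "\<And>y. ((\<lambda>y. integral {0..1} (\<lambda>x. cut \<beta> (\<lambda>_. 1) (\<tau> * Complex x y))) has_real_derivative V' y) (at y)"
    "\<And>y. (V' has_real_derivative integral {0..1} (\<lambda>x. cut b (\<lambda>w. (norm (f w * \<tau>))\<^sup>2) (\<tau> * Complex x y))) (at y)"
proof -
  let ?P = "\<lambda>x y. \<tau> * Complex x y"
  define h where "h = \<tau> * \<i>"
  have P: "?P x y = \<tau> * of_real x + of_real y * h" for x y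
    by (simp add: Complex_eq h_def algebra_simps)
  have Pcont: "continuous_on S (\<lambda>(y, x). ?P x y)" for S
    unfolding P case_prod_beta by (intro continuous_intros)
  have Pcont1: "continuous_on S (\<lambda>x. ?P x y)" for S y
    unfolding P by (intro continuous_intros)
  have c\<beta>: "continuous_on {0<..} \<beta>" using \<beta>' by (auto intro!: DERIV_continuous_on[of _ \<beta> \<beta>1] intro: has_field_derivative_at_within)
  have c\<beta>1: "continuous_on {0<..} \<beta>1" using \<beta>1' by (auto intro!: DERIV_continuous_on[of _ \<beta>1 b] intro: has_field_derivative_at_within)
  have cb: "continuous_on {0<..} b" using b continuous_on_subset by blast
  have cf: "continuous_on \<Omega> f" using hol holomorphic_on_imp_continuous_on by blast
  have cdf: "continuous_on \<Omega> (deriv f)"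
    using holomorphic_deriv[OF hol open_dom] holomorphic_on_imp_continuous_on by blast
  define W1 where "W1 = cut \<beta>1 (\<lambda>w. Re (f w * h))"
  define W2 where "W2 z = cut b (\<lambda>w. (Re (f w * h))\<^sup>2) z + cut \<beta>1 (\<lambda>w. Re (deriv f w * h\<^sup>2)) z" for z
  have contW: "continuous_on UNIV (cut \<beta> (\<lambda>_. 1))"
    using z0 by (intro continuous_cut[OF \<open>\<epsilon> > 0\<close> _ c\<beta>] continuous_intros) auto
  have contW1: "continuous_on UNIV W1"
    unfolding W1_def using z0 by (intro continuous_cut[OF \<open>\<epsilon> > 0\<close> _ c\<beta>1] continuous_intros cf) auto
  have contW2: "continuous_on UNIV W2"
    unfolding W2_def using z0
    by (intro continuous_on_add continuous_cut[OF \<open>\<epsilon> > 0\<close> _ c\<beta>1] continuous_cut[OF \<open>\<epsilon> > 0\<close> _ cb] continuous_intros cf cdf) auto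
  have dW: "((\<lambda>y. cut \<beta> (\<lambda>_. 1) (?P x y)) has_real_derivative W1 (?P x y)) (at y)" for x y
  proof -
    have "((\<lambda>y. cut \<beta> (\<lambda>_. 1) (\<tau> * of_real x + of_real y * h)) has_real_derivative
       cut \<beta>1 (\<lambda>w. 1 * Re (f w * h)) (\<tau> * of_real x + of_real y * h) + cut \<beta> (\<lambda>_. 0) (\<tau> * of_real x + of_real y * h)) (at y)"
      using z0 by (intro cut_ray_derivative[OF \<open>\<epsilon> > 0\<close> _ \<beta>']) auto
    then show ?thesis unfolding P W1_def by simp
  qed
  have dW1: "((\<lambda>y. W1 (?P x y)) has_real_derivative W2 (?P x y)) (at y)" for x y
    unfolding P W1_def W2_def power2_eq_square[of "Re _"]
    using z0 by (intro cut_ray_derivative[OF \<open>\<epsilon> > 0\<close> _ \<beta>1'] f_ray_derivative) auto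
  define V' where "V' y = integral {0..1} (\<lambda>x. W1 (?P x y))" for y
  have "((\<lambda>y. integral (cbox 0 1) (\<lambda>x. cut \<beta> (\<lambda>_. 1) (?P x y))) has_real_derivative integral (cbox 0 1) (\<lambda>x. W1 (?P x y))) (at y within UNIV)" for y
    by (rule leibniz_rule_field_derivative)
       (use dW in \<open>auto intro!: integrable_continuous_real continuous_on_compose2[OF contW Pcont1]
          continuous_on_compose2[OF contW1 Pcont, unfolded case_prod_beta] simp: case_prod_beta\<close>)
  then have 1: "((\<lambda>y. integral {0..1} (\<lambda>x. cut \<beta> (\<lambda>_. 1) (?P x y))) has_real_derivative V' y) (at y)" for y
    by (simp add: V'_def)
  have "((\<lambda>y. integral (cbox 0 1) (\<lambda>x. W1 (?P x y))) has_real_derivative integral (cbox 0 1) (\<lambda>x. W2 (?P x y))) (at y within UNIV)" for y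
    by (rule leibniz_rule_field_derivative)
       (use dW1 in \<open>auto intro!: integrable_continuous_real continuous_on_compose2[OF contW1 Pcont1]
          continuous_on_compose2[OF contW2 Pcont, unfolded case_prod_beta] simp: case_prod_beta\<close>)
  then have 2: "(V' has_real_derivative integral {0..1} (\<lambda>x. W2 (?P x y))) (at y)" for y
    by (simp add: V'_def[abs_def])
  have "integral {0..1} (\<lambda>x. W2 (?P x y)) = integral {0..1} (\<lambda>x. cut b (\<lambda>w. (norm (f w * \<tau>))\<^sup>2) (?P x y))" for y
  proof -
    have "((\<lambda>x. cut b (\<lambda>w. (Re (f w * \<tau>))\<^sup>2) (?P x y) + cut \<beta>1 (\<lambda>w. Re (deriv f w * \<tau>\<^sup>2)) (?P x y)) has_integral 0) {0..1}"
      using z0 by (intro integral_cut_Re_deriv_eq_0[OF \<open>\<epsilon> > 0\<close> _ \<beta>1']) auto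
    moreover have "((\<lambda>x. W2 (?P x y)) has_integral integral {0..1} (\<lambda>x. W2 (?P x y))) {0..1}"
      by (intro integrable_integral integrable_continuous_real continuous_on_compose2[OF contW2 Pcont1]) auto
    ultimately have "((\<lambda>x. W2 (?P x y) + (cut b (\<lambda>w. (Re (f w * \<tau>))\<^sup>2) (?P x y) + cut \<beta>1 (\<lambda>w. Re (deriv f w * \<tau>\<^sup>2)) (?P x y)))
       has_integral integral {0..1} (\<lambda>x. W2 (?P x y)) + 0) {0..1}"
      by (intro has_integral_add)
    \<comment> \<open>The vertical direction is \<open>h = \<tau> * \<i>\<close>. From h^2 =
      -\<tau>^2 the second derivatives in the two directions are opposite, and Re(fh), Re(f\<tau>)
      are up to sign the two components of f\<tau>.\<close>
    moreover have "W2 z + (cut b (\<lambda>w. (Re (f w * \<tau>))\<^sup>2) z + cut \<beta>1 (\<lambda>w. Re (deriv f w * \<tau>\<^sup>2)) z)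
        = cut b (\<lambda>w. (norm (f w * \<tau>))\<^sup>2) z" for z
    proof -
      have "h\<^sup>2 = - \<tau>\<^sup>2" by (simp add: h_def power_mult_distrib)
      moreover have "Re (f z * h) = - Im (f z * \<tau>)" by (simp add: h_def algebra_simps)
      ultimately have eq: "(Re (f z * h))\<^sup>2 + (Re (f z * \<tau>))\<^sup>2 = (norm (f z * \<tau>))\<^sup>2"
          "Re (deriv f z * h\<^sup>2) + Re (deriv f z * \<tau>\<^sup>2) = 0"
        by (simp_all only: cmod_power2 power2_minus mult_minus_right uminus_complex.sel)
      show ?thesis
      proof (cases "z \<in> \<Omega>")
        case True
        have "W2 z + (cut b (\<lambda>w. (Re (f w * \<tau>))\<^sup>2) z + cut \<beta>1 (\<lambda>w. Re (deriv f w * \<tau>\<^sup>2)) z) =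
            b (u z) * ((Re (f z * h))\<^sup>2 + (Re (f z * \<tau>))\<^sup>2) +
            \<beta>1 (u z) * (Re (deriv f z * h\<^sup>2) + Re (deriv f z * \<tau>\<^sup>2))"
          using True unfolding W2_def cut_def by (simp only: if_True distrib_left add_ac)
        then show ?thesis unfolding eq using True by (simp add: cut_def)
      qed (simp add: W2_def cut_def)
    qed
    ultimately show ?thesis by (simp add: integral_unique)
  qed
  with 2 have "(V' has_real_derivative integral {0..1} (\<lambda>x. cut b (\<lambda>w. (norm (f w * \<tau>))\<^sup>2) (?P x y))) (at y)" for y
    by simp
  with 1 show ?thesis by (rule that)
qed

lemma Im_eqD: "Im (z / \<tau>) = y \<Longrightarrow> z = \<tau> * Complex (Re (z / \<tau>)) y"
  using \<tau>_nonzero by (metis complex_surj nonzero_mult_div_cancel_left times_divide_eq_right)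

lemma reduce_to_period:
  assumes "Im (z / \<tau>) = y"
  obtains x where "0 \<le> x" "x \<le> 1" "\<tau> * Complex x y \<in> \<Omega> \<longleftrightarrow> z \<in> \<Omega>"
proof -
  let ?k = "\<lfloor>Re (z / \<tau>)\<rfloor>"
  have "z = \<tau> * Complex (frac (Re (z / \<tau>))) y + of_int ?k * \<tau>"
    by (subst Im_eqD[OF assms]) (simp add: Complex_eq frac_def algebra_simps)
  then have "\<tau> * Complex (frac (Re (z / \<tau>))) y \<in> \<Omega> \<longleftrightarrow> z \<in> \<Omega>" using inv_int by metis
  then show ?thesis by (intro that[of "frac (Re (z / \<tau>))"]) (auto simp: frac_lt_1 less_imp_le)
qed

text \<open>On the compact part of the closure where |f| \<le> 1/2, \<open>u\<close> attains its
  minimum. This minimum is positive because |f| = 1 on the frontier keeps the minimiser inside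
  \<Omega>; below that level the gradient must exceed 1/2.\<close>

lemma bounded_gradient_near_zero:
  assumes "compact R"
  obtains \<delta> where "\<delta> > 0" "\<And>z. z \<in> R \<Longrightarrow> z \<in> \<Omega> \<Longrightarrow> u z < \<delta> \<Longrightarrow> norm (f z) \<ge> 1/2"
proof -
  define Q where "Q = {z \<in> closure \<Omega>. norm (f z) \<le> 1/2} \<inter> R"
  have "closed {z \<in> closure \<Omega>. norm (f z) \<le> 1/2}"
    by (intro continuous_on_closed_Collect_le continuous_intros cont_f) auto
  then have "compact Q" unfolding Q_def using assms by (simp add: closed_Int_compact)
  have key: "z \<in> Q" if "z \<in> R" "z \<in> \<Omega>" "\<not> norm (f z) \<ge> 1/2" for z
    using that subsetD[OF closure_subset that(2)] by (simp add: Q_def)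
  show ?thesis
  proof (cases "Q = {}")
    case True
    then show ?thesis using key by (intro that[of 1]) auto
  next
    case False
    have "continuous_on Q u" by (rule continuous_on_subset[OF cont_u]) (auto simp: Q_def)
    then obtain q where q: "q \<in> Q" "\<And>z. z \<in> Q \<Longrightarrow> u q \<le> u z"
      using continuous_attains_inf[OF \<open>compact Q\<close> False] by metis
    have "q \<in> \<Omega>" using q(1) closure_cases norm_f_frontier by (force simp: Q_def)
    show ?thesis
    proof (rule that[of "u q"])
      show "u q > 0" using u_pos[OF \<open>q \<in> \<Omega>\<close>] .
      show "norm (f z) \<ge> 1/2" if "z \<in> R" "z \<in> \<Omega>" "u z < u q" for z
        using key[OF that(1,2)] q(2)[of z] that(3) by linarith
    qed
  qed
qed

text \<open>Otherwise there are heights whose lines carry \<open>u0\<close> below 1/(n + 1); they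
  accumulate at some \<open>l\<close>. The line at height \<open>l\<close> has a point in \<Omega>,
  and continuity of \<open>u0\<close> at that point contradicts \<open>u > 0\<close>.\<close>

lemma line_maximum_bounded_below:
  assumes "\<And>y. a \<le> y \<Longrightarrow> y \<le> c \<Longrightarrow> \<exists>x. 0 \<le> x \<and> x \<le> 1 \<and> \<tau> * Complex x y \<in> \<Omega>"
  obtains \<delta> where "\<delta> > 0" "\<And>y. a \<le> y \<Longrightarrow> y \<le> c \<Longrightarrow> \<exists>x. 0 \<le> x \<and> x \<le> 1 \<and> u0 (\<tau> * Complex x y) \<ge> \<delta>"
proof -
  have "\<exists>\<delta>>0. \<forall>y. a \<le> y \<longrightarrow> y \<le> c \<longrightarrow> (\<exists>x. 0 \<le> x \<and> x \<le> 1 \<and> u0 (\<tau> * Complex x y) \<ge> \<delta>)"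
  proof (rule ccontr)
    assume "\<not> ?thesis"
    then have "\<forall>n. \<exists>y. a \<le> y \<and> y \<le> c \<and> (\<forall>x. 0 \<le> x \<longrightarrow> x \<le> 1 \<longrightarrow> u0 (\<tau> * Complex x y) < 1 / real (Suc n))"
      by (metis (no_types) not_le of_nat_0_less_iff zero_less_Suc zero_less_divide_1_iff)
    then obtain y where y: "\<And>n. a \<le> y n" "\<And>n. y n \<le> c"
      "\<And>n x. 0 \<le> x \<Longrightarrow> x \<le> 1 \<Longrightarrow> u0 (\<tau> * Complex x (y n)) < 1 / real (Suc n)" by metis
    have "seq_compact {a..c}" using compact_Icc compact_imp_seq_compact by blast
    then obtain l r where l: "l \<in> {a..c}" "strict_mono r" "(y \<circ> r) \<longlonglongrightarrow> l"
      unfolding seq_compact_def using y by (metis atLeastAtMost_iff)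
    obtain x where x: "0 \<le> x" "x \<le> 1" "\<tau> * Complex x l \<in> \<Omega>" using assms l(1) by auto
    have "(\<lambda>n. \<tau> * Complex x ((y \<circ> r) n)) \<longlonglongrightarrow> \<tau> * Complex x l"
      by (intro tendsto_intros l(3))
    then have "(\<lambda>n. u0 (\<tau> * Complex x ((y \<circ> r) n))) \<longlonglongrightarrow> u0 (\<tau> * Complex x l)"
      using continuous_u0 by (intro isCont_tendsto_compose[of _ u0]) (auto simp: continuous_on_eq_continuous_at)
    moreover have "(\<lambda>n. 1 / real (Suc (r n))) \<longlonglongrightarrow> 0"
      using LIMSEQ_subseq_LIMSEQ[OF LIMSEQ_Suc[OF lim_1_over_n] l(2)] by (simp add: o_def)
    ultimately have "u0 (\<tau> * Complex x l) \<le> 0"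
      by (rule LIMSEQ_le) (use y(3)[OF x(1,2)] less_imp_le in \<open>auto simp: o_def\<close>)
    then show False using u_pos[OF x(3)] x(3) by (simp add: u0_def)
  qed
  then show ?thesis by (elim exE conjE) (rule that, assumption, blast)
qed

text \<open>The average \<open>V\<close> of \<open>\<beta>(u)\<close> over a line is bounded by \<open>2|\<tau>|\<close> if the line leaves \<open>\<Omega>\<close>, and
  \<open>V''\<close> is the integral of \<open>\<beta>''(u)|\<tau>\<nabla>u|^2\<close>, which is at least \<open>|\<tau>|/2\<close> if \<open>u\<close> climbs along the
  line from 0 to the level where \<open>\<beta>' = 1\<close>, as \<open>|\<nabla>u| \<ge> 1/2\<close> below that level.\<close>

lemma not_all_lines_meet_both:
  assumes meets: "\<And>y. y0 \<le> y \<Longrightarrow> y \<le> y0 + 6 \<Longrightarrow> 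
     (\<exists>z\<in>\<Omega>. Im (z / \<tau>) = y) \<and> (\<exists>z. z \<notin> \<Omega> \<and> Im (z / \<tau>) = y)"
  shows False
proof -
  let ?P = "\<lambda>x y. \<tau> * Complex x y"
  have pin: "\<exists>x. 0 \<le> x \<and> x \<le> 1 \<and> ?P x y \<in> \<Omega>" if "y0 \<le> y" "y \<le> y0 + 6" for y
    using meets[OF that] reduce_to_period by metis
  have pout: "\<exists>x. 0 \<le> x \<and> x \<le> 1 \<and> ?P x y \<notin> \<Omega>" if "y0 \<le> y" "y \<le> y0 + 6" for y
    using meets[OF that] reduce_to_period by metis
  define R where "R = (\<lambda>(x, y). ?P x y) ` ({0..1} \<times> {y0..y0+6})"
  have "continuous_on S (\<lambda>(x, y). ?P x y)" for S
    unfolding Complex_eq case_prod_beta by (intro continuous_intros)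
  then have "compact R" unfolding R_def by (intro compact_continuous_image compact_Times) auto
  then obtain \<delta>1 where \<delta>1: "\<delta>1 > 0" "\<And>z. z \<in> R \<Longrightarrow> z \<in> \<Omega> \<Longrightarrow> u z < \<delta>1 \<Longrightarrow> norm (f z) \<ge> 1/2"
    using bounded_gradient_near_zero by metis
  obtain \<delta>2 where \<delta>2: "\<delta>2 > 0" "\<And>y. y0 \<le> y \<Longrightarrow> y \<le> y0 + 6 \<Longrightarrow> \<exists>x. 0 \<le> x \<and> x \<le> 1 \<and> u0 (?P x y) \<ge> \<delta>2"
    using line_maximum_bounded_below[of y0 "y0 + 6"] pin by metis
  \<comment> \<open>2\<epsilon> \<le> \<delta>1 makes the gradient at least 1/2 throughout the layer
    where \<open>b\<close> may be nonzero; 2\<epsilon> \<le> \<delta>2 makes every line in the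
    window reach the level where \<beta>1 = 1.\<close>
  define \<epsilon> where "\<epsilon> = min \<delta>1 \<delta>2 / 2"
  have \<epsilon>: "\<epsilon> > 0" "2 * \<epsilon> \<le> \<delta>1" "2 * \<epsilon> \<le> \<delta>2" using \<delta>1 \<delta>2 by (auto simp: \<epsilon>_def)
  obtain \<beta> \<beta>1 b :: "real \<Rightarrow> real" where \<beta>: "\<And>s. s > 0 \<Longrightarrow> (\<beta> has_real_derivative \<beta>1 s) (at s)"
    and \<beta>1: "\<And>s. s > 0 \<Longrightarrow> (\<beta>1 has_real_derivative b s) (at s)"
    and b: "continuous_on UNIV b" "\<And>s. b s \<ge> 0"
    and z0: "\<And>s. s > 0 \<Longrightarrow> s \<le> \<epsilon> \<Longrightarrow> \<beta> s = 0 \<and> \<beta>1 s = 0 \<and> b s = 0"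
    and big: "\<And>s. s \<ge> 2 * \<epsilon> \<Longrightarrow> \<beta>1 s = 1 \<and> b s = 0"
    and \<beta>_range: "\<And>s. s > 0 \<Longrightarrow> 0 \<le> \<beta> s \<and> \<beta> s \<le> s"
    using convex_ramp_exists[OF \<epsilon>(1)] by blast
  define V where "V y = integral {0..1} (\<lambda>x. cut \<beta> (\<lambda>_. 1) (?P x y))" for y
  define I where "I y = integral {0..1} (\<lambda>x. cut b (\<lambda>w. (norm (f w * \<tau>))\<^sup>2) (?P x y))" for y
  obtain V' where V': "\<And>y. (V has_real_derivative V' y) (at y)" "\<And>y. (V' has_real_derivative I y) (at y)"
    using line_integral_second_derivative[OF \<epsilon>(1) \<beta> \<beta>1 b(1) z0] unfolding V_def[abs_def] I_def by blast
  have Pcont: "continuous_on S (\<lambda>x. ?P x y)" for S y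
    unfolding Complex_eq by (intro continuous_intros)
  have cf: "continuous_on \<Omega> f" using hol holomorphic_on_imp_continuous_on by blast
  have V_range: "0 \<le> V y \<and> V y \<le> 2 * norm \<tau>" if y: "y0 \<le> y" "y \<le> y0 + 6" for y
  proof -
    obtain x0 where x0: "0 \<le> x0" "x0 \<le> 1" "?P x0 y \<notin> \<Omega>" using pout[OF y] by blast
    have bd: "0 \<le> cut \<beta> (\<lambda>_. 1) (?P x y) \<and> cut \<beta> (\<lambda>_. 1) (?P x y) \<le> 2 * norm \<tau>" if x: "x \<in> {0..1}" for x
    proof (cases "?P x y \<in> \<Omega>")
      case True
      have "?P x y - ?P x0 y = \<tau> * of_real (x - x0)" by (simp add: Complex_eq algebra_simps)
      then have "dist (?P x y) (?P x0 y) = norm \<tau> * \<bar>x - x0\<bar>" by (simp only: dist_norm norm_mult norm_of_real)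
      also have "\<dots> \<le> norm \<tau> * 1" using x x0 by (intro mult_left_mono) auto
      finally have "u (?P x y) \<le> 2 * norm \<tau>" using u_le_dist[OF True x0(3)] by simp
      then show ?thesis using \<beta>_range[OF u_pos[OF True]] True by (simp add: cut_def)
    qed (simp add: cut_def)
    have "continuous_on UNIV (cut \<beta> (\<lambda>_. 1))"
      using z0 \<beta> by (intro continuous_cut[OF \<epsilon>(1)] continuous_intros DERIV_continuous_on[of _ \<beta> \<beta>1])
        (auto intro: has_field_derivative_at_within)
    then have "(\<lambda>x. cut \<beta> (\<lambda>_. 1) (?P x y)) integrable_on {0..1}"
      by (intro integrable_continuous_real continuous_on_compose2[OF _ Pcont]) auto
    note int = this
    have "integral {0..1} (\<lambda>x::real. 0) \<le> V y"
      unfolding V_def by (rule integral_le) (use int bd in auto)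
    moreover have "V y \<le> integral {0..1} (\<lambda>x::real. 2 * norm \<tau>)"
      unfolding V_def by (rule integral_le) (use int bd in auto)
    ultimately show ?thesis by simp
  qed
  have I_ge: "I y \<ge> norm \<tau> / 2" if y: "y0 \<le> y" "y \<le> y0 + 6" for y
  proof -
    obtain x0 where x0: "0 \<le> x0" "x0 \<le> 1" "?P x0 y \<notin> \<Omega>" using pout[OF y] by blast
    obtain x1 where x1: "0 \<le> x1" "x1 \<le> 1" "u0 (?P x1 y) \<ge> 2 * \<epsilon>" using \<delta>2(2)[OF y] \<epsilon>(3) by (meson order_trans)
    define J where "J x = cut \<beta>1 (\<lambda>_. 1) (?P x y)" for x
    define J' where "J' x = cut b (\<lambda>w. Re (f w * \<tau>)) (?P x y)" for x
    define m where "m x = cut b (\<lambda>w. (norm (f w * \<tau>))\<^sup>2) (?P x y)" for x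
    have P: "?P x y = \<tau> * (\<i> * of_real y) + of_real x * \<tau>" for x
      by (simp add: Complex_eq algebra_simps)
    have DJ: "(J has_real_derivative J' x) (at x)" for x
    proof -
      have "((\<lambda>x. cut \<beta>1 (\<lambda>_. 1) (\<tau> * (\<i> * of_real y) + of_real x * \<tau>)) has_real_derivative
         cut b (\<lambda>w. 1 * Re (f w * \<tau>)) (\<tau> * (\<i> * of_real y) + of_real x * \<tau>) + 
         cut \<beta>1 (\<lambda>_. 0) (\<tau> * (\<i> * of_real y) + of_real x * \<tau>)) (at x)"
        using z0 by (intro cut_ray_derivative[OF \<epsilon>(1) _ \<beta>1]) auto
      then show ?thesis unfolding J_def J'_def P by simp
    qed
    have "continuous_on UNIV (cut b (\<lambda>w. (norm (f w * \<tau>))\<^sup>2))"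
      using z0 b(1) by (intro continuous_cut[OF \<epsilon>(1)] continuous_intros cf) (auto intro: continuous_on_subset)
    then have m_int: "m integrable_on {s..t}" for s t
      unfolding m_def by (intro integrable_continuous_real continuous_on_compose2[OF _ Pcont]) auto
    have m0: "m x \<ge> 0" for x using b(2) by (simp add: m_def cut_def)
    \<comment> \<open>Where \<open>b\<close> is nonzero, one factor of |f\<tau>|^2 is at least
      |\<tau>|/2 and the other dominates |Re(f\<tau>)|. Thus the integral of \<open>m\<close>
      controls |\<tau>|/2 times the variation of \<open>J\<close>, which takes the value 0 at
      \<open>x0\<close> and 1 at \<open>x1\<close>.\<close>
    have J'_le: "norm \<tau> / 2 * \<bar>J' x\<bar> \<le> m x" if x: "0 \<le> x" "x \<le> 1" for x
    proof (cases "?P x y \<in> \<Omega> \<and> u (?P x y) < 2 * \<epsilon>")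
      case True
      have "?P x y \<in> R" using x y by (auto simp: R_def)
      then have "norm (f (?P x y)) \<ge> 1/2" using \<delta>1(2) True \<epsilon>(2) by auto
      then have "norm \<tau> / 2 \<le> norm (f (?P x y) * \<tau>)"
        by (simp add: norm_mult mult_right_mono[of "1/2" _ "norm \<tau>", simplified])
      moreover have "\<bar>Re (f (?P x y) * \<tau>)\<bar> \<le> norm (f (?P x y) * \<tau>)" by (rule abs_Re_le_cmod)
      ultimately have "norm \<tau> / 2 * \<bar>Re (f (?P x y) * \<tau>)\<bar> \<le> norm (f (?P x y) * \<tau>) * norm (f (?P x y) * \<tau>)"
        by (intro mult_mono) auto
      then have "b (u (?P x y)) * (norm \<tau> / 2 * \<bar>Re (f (?P x y) * \<tau>)\<bar>) \<le> b (u (?P x y)) * (norm (f (?P x y) * \<tau>))\<^sup>2"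
        using b(2) by (intro mult_left_mono) (auto simp: power2_eq_square)
      then show ?thesis using True b(2) by (simp add: J'_def m_def cut_def abs_mult mult_ac)
    next
      case False
      then have "J' x = 0" using big[of "u (?P x y)"] by (auto simp: J'_def cut_def)
      then show ?thesis using m0 by simp
    qed
    have J01: "J x0 = 0" "J x1 = 1"
      using x0 x1 \<epsilon>(1) big by (auto simp: J_def cut_def u0_def split: if_splits)
    have FTC: "(J' has_integral J t - J s) {s..t}" if "s \<le> t" for s t
      using DJ that by (intro fundamental_theorem_of_calculus)
       (auto simp flip: has_real_derivative_iff_has_vector_derivative intro: has_field_derivative_at_within)
    have mon: "integral {s..t} m \<le> I y" if "0 \<le> s" "t \<le> 1" for s t
      unfolding I_def m_def[symmetric] using that m0 by (intro integral_subset_le m_int) auto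
    show ?thesis
    proof (cases "x0 \<le> x1")
      case True
      have "((\<lambda>x. norm \<tau> / 2 * J' x) has_integral norm \<tau> / 2 * (J x1 - J x0)) {x0..x1}"
        by (rule has_integral_mult_right[OF FTC[OF True]])
      then have "norm \<tau> / 2 * (J x1 - J x0) \<le> integral {x0..x1} m"
      proof (rule has_integral_le[OF _ integrable_integral[OF m_int]])
        fix x assume "x \<in> {x0..x1}"
        then have "norm \<tau> / 2 * \<bar>J' x\<bar> \<le> m x" using J'_le x0 x1 by auto
        moreover have "norm \<tau> / 2 * J' x \<le> norm \<tau> / 2 * \<bar>J' x\<bar>" by (intro mult_left_mono) auto
        ultimately show "norm \<tau> / 2 * J' x \<le> m x" by simp
      qed
      then show ?thesis using mon[of x0 x1] J01 x0 x1 by simp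
    next
      case False
      have "((\<lambda>x. - (norm \<tau> / 2) * J' x) has_integral - (norm \<tau> / 2) * (J x0 - J x1)) {x1..x0}"
        using False by (intro has_integral_mult_right FTC) auto
      then have "- (norm \<tau> / 2) * (J x0 - J x1) \<le> integral {x1..x0} m"
      proof (rule has_integral_le[OF _ integrable_integral[OF m_int]])
        fix x assume "x \<in> {x1..x0}"
        then have "norm \<tau> / 2 * \<bar>J' x\<bar> \<le> m x" using J'_le x0 x1 by auto
        moreover have "norm \<tau> / 2 * (- J' x) \<le> norm \<tau> / 2 * \<bar>J' x\<bar>" by (intro mult_left_mono) auto
        ultimately show "- (norm \<tau> / 2) * J' x \<le> m x" by simp
      qed
      then show ?thesis using mon[of x1 x0] J01 x0 x1 by simp
    qed
  qed
  \<comment> \<open>Values in [0, 2|\<tau>|] allow second differences of at most 4|\<tau>|, while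
    step \<open>h\<close> forces at least |\<tau>|h^2/2. A contradiction needs h^2 > 8; step 3
    achieves it and fixes the window height 6.\<close>
  have "V ((y0 + 3) + 3) + V ((y0 + 3) - 3) - 2 * V (y0 + 3) \<ge> norm \<tau> / 2 * 3\<^sup>2"
    by (rule second_difference_ge[of _ _ V V' I]) (use V' I_ge in \<open>auto simp: abs_le_iff\<close>)
  moreover have "norm \<tau> / 2 * 3\<^sup>2 = norm \<tau> / 2 * 9" by simp
  moreover have "V ((y0 + 3) + 3) \<le> 2 * norm \<tau>" "V ((y0 + 3) - 3) \<le> 2 * norm \<tau>" "V (y0 + 3) \<ge> 0"
    using V_range by auto
  ultimately have "norm \<tau> / 2 * 9 \<le> 4 * norm \<tau>" by linarith
  then show False using \<tau>_nonzero by simp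
qed

text \<open>If heights on the frontier are unbounded above, then they are so on one of the finitely
  many connected pieces; its heights form an interval, so every high line carries a frontier point,
  and connectedness of \<Omega> supplies a point of \<Omega> on it. The pieces form an arbitrary
  family so that the statement also applies to the inverted components belonging to -\<tau>.\<close>

lemma frontier_bounded_above:
  assumes fin: "finite \<C>" and conn: "\<And>C. C \<in> \<C> \<Longrightarrow> connected C"
    and cover: "\<Union>\<C> = cyl \<tau> ` frontier \<Omega>"
  obtains R where "\<And>z. z \<in> frontier \<Omega> \<Longrightarrow> Im (z / \<tau>) < R"
proof (rule ccontr)
  assume no_bound: "\<not> thesis"
  define ht where "ht w = - ln (norm w) / (2 * pi)" for w :: complex
  have ht: "ht (cyl \<tau> z) = Im (z / \<tau>)" for z by (simp add: ht_def norm_cyl)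
  have "\<exists>C\<in>\<C>. \<forall>R. \<exists>w\<in>C. ht w \<ge> R"
  proof (rule ccontr)
    assume "\<not> ?thesis"
    then obtain B where B: "\<And>C w. C \<in> \<C> \<Longrightarrow> w \<in> C \<Longrightarrow> ht w < B C" by (metis not_le)
    define R where "R = Max (insert 0 (B ` \<C>))"
    have "Im (z / \<tau>) < R" if "z \<in> frontier \<Omega>" for z
    proof -
      have "cyl \<tau> z \<in> \<Union>\<C>" using that cover by blast
      then obtain C where C: "C \<in> \<C>" "cyl \<tau> z \<in> C" by blast
      then have "ht (cyl \<tau> z) < B C" using B by blast
      also have "B C \<le> R" unfolding R_def using fin C(1) by (intro Max_ge) auto
      finally show ?thesis by (simp add: ht)
    qed
    then have thesis by (rule that)
    with no_bound show False by (rule notE)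
  qed
  then obtain C where C: "C \<in> \<C>" "\<forall>R. \<exists>w\<in>C. ht w \<ge> R" by (rule bexE)
  have "connected C" using conn[OF C(1)] .
  moreover have "continuous_on C ht"
  proof -
    have "C \<subseteq> cyl \<tau> ` frontier \<Omega>" using C(1) cover by blast
    then have "w \<noteq> 0" if "w \<in> C" for w using that by auto
    then show ?thesis unfolding ht_def by (intro continuous_intros) auto
  qed
  ultimately have conn_ht: "connected (ht ` C)" by (rule connected_continuous_image[rotated])
  obtain w0 where w0: "w0 \<in> C" using C(2)[rule_format, of 0] by blast
  have frontier_line: "\<exists>z\<in>frontier \<Omega>. Im (z / \<tau>) = y" if "y \<ge> ht w0" for y
  proof -
    obtain w where "w \<in> C" "ht w \<ge> y" using C(2)[rule_format, of y] by blast
    then have "{ht w0..ht w} \<subseteq> ht ` C"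
      using w0 by (intro connected_contains_Icc[OF conn_ht]) auto
    then have "y \<in> ht ` C" using that \<open>ht w \<ge> y\<close> by auto
    then obtain w' where "w' \<in> C" "ht w' = y" by blast
    moreover obtain z where "z \<in> frontier \<Omega>" "w' = cyl \<tau> z"
      using \<open>w' \<in> C\<close> C(1) cover by blast
    ultimately show ?thesis using ht[of z] by auto
  qed
  obtain z1 where z1: "z1 \<in> \<Omega>" using frontier_nonempty by fastforce
  have inner_line: "\<exists>z\<in>\<Omega>. Im (z / \<tau>) = y" if y: "y \<ge> Im (z1 / \<tau>)" "y \<ge> ht w0" for y
  proof -
    \<comment> \<open>Near a frontier point one unit higher there are points of \<Omega> above
      height \<open>y\<close>; the connected set \<Omega> also contains \<open>z1\<close>, no higher
      than \<open>y\<close>, and so crosses that height.\<close>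
    obtain p where p: "p \<in> frontier \<Omega>" "Im (p / \<tau>) = y + 1" using frontier_line[of "y + 1"] y by auto
    have cont: "continuous_on UNIV (\<lambda>z. Im (z / \<tau>))" using \<tau>_nonzero by (intro continuous_intros) auto
    have "open {z. Im (z / \<tau>) > y}" by (intro open_Collect_less continuous_on_const cont)
    moreover have "p \<in> {z. Im (z / \<tau>) > y}" "p \<in> closure \<Omega>" using p by (auto simp: frontier_def)
    ultimately obtain q where q: "q \<in> \<Omega>" "Im (q / \<tau>) > y"
      using open_Int_closure_eq_empty by (metis (no_types, lifting) IntI disjoint_iff mem_Collect_eq)
    have "connected ((\<lambda>z. Im (z / \<tau>)) ` \<Omega>)"
      using connected_dom continuous_on_subset[OF cont] by (intro connected_continuous_image) auto
    then have "{Im (z1 / \<tau>)..Im (q / \<tau>)} \<subseteq> (\<lambda>z. Im (z / \<tau>)) ` \<Omega>"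
      by (rule connected_contains_Icc) (use z1 q in auto)
    moreover have "y \<in> {Im (z1 / \<tau>)..Im (q / \<tau>)}" using y q by auto
    ultimately show ?thesis by fast
  qed
  show False
  proof (rule not_all_lines_meet_both[of "max (ht w0) (Im (z1 / \<tau>))"])
    fix y assume "max (ht w0) (Im (z1 / \<tau>)) \<le> y"
    then show "(\<exists>z\<in>\<Omega>. Im (z / \<tau>) = y) \<and> (\<exists>z. z \<notin> \<Omega> \<and> Im (z / \<tau>) = y)"
      using inner_line[of y] frontier_line[of y] frontier_disjoint by auto
  qed
qed

end

section \<open>The ends\<close>

lemma cyl_eqD:
  assumes "\<tau> \<noteq> 0" "cyl \<tau> z = cyl \<tau> w"
  obtains k :: int where "z = w + of_int k * \<tau>"
proof -
  from assms(2) obtain n :: int where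
    n: "2 * of_real pi * \<i> * z / \<tau> = 2 * of_real pi * \<i> * w / \<tau> + of_real (of_int (2 * n) * pi) * \<i>"
    unfolding cyl_def exp_eq by auto
  have "(2 * of_real pi * \<i>) * z = (2 * of_real pi * \<i>) * (w + of_int n * \<tau>)"
    using n assms(1) by (simp add: field_simps)
  then have "z = w + of_int n * \<tau>" by (subst (asm) mult_cancel_left) auto
  then show ?thesis by (rule that)
qed

lemma cyl_Ln:
  assumes "\<tau> \<noteq> 0" "q \<noteq> 0"
  shows "cyl \<tau> (\<tau> / (2 * of_real pi * \<i>) * Ln q) = q"
  using assms by (simp add: cyl_def)

lemma connected_Im_halfplane:
  assumes "\<tau> \<noteq> 0"
  shows "connected {z. Im (z / \<tau>) \<ge> R}"
proof -
  have eq: "{z. Im (z / \<tau>) \<ge> R} = (*) \<tau> ` {w. Im w \<ge> R}"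
  proof (intro equalityI subsetI)
    fix z assume "z \<in> {z. Im (z / \<tau>) \<ge> R}"
    then show "z \<in> (*) \<tau> ` {w. Im w \<ge> R}" using assms by (intro image_eqI[of _ _ "z / \<tau>"]) auto
  qed (use assms in auto)
  show ?thesis
    unfolding eq
    by (intro connected_continuous_image continuous_intros convex_connected convex_halfspace_Im_ge)
qed

context periodic_overdetermined
begin

lemma f_periodic_int: "z \<in> \<Omega> \<Longrightarrow> f (z + of_int k * \<tau>) = f z"
proof -
  have nat: "f (z + of_nat n * \<tau>) = f z" if "z \<in> \<Omega>" for z n
  proof (induction n)
    case (Suc n)
    have eq: "z + of_nat (Suc n) * \<tau> = (z + of_nat n * \<tau>) + \<tau>" by (simp add: algebra_simps)
    show ?case
      unfolding eq using f_periodic[OF inv, of "z + of_nat n * \<tau>"] inv_nat[of z n] that Suc by simp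
  qed simp
  show "f (z + of_int k * \<tau>) = f z" if z: "z \<in> \<Omega>"
  proof (cases k)
    case (nonneg n)
    then show ?thesis using nat[OF z, of n] by simp
  next
    case (neg n)
    have eq: "(z + of_int k * \<tau>) + of_nat (Suc n) * \<tau> = z" unfolding neg by (simp add: algebra_simps)
    show ?thesis using nat[of "z + of_int k * \<tau>" "Suc n", unfolded eq] inv_int[of z k] z by simp
  qed
qed

lemma f_eq_if_cyl_eq:
  assumes "cyl \<tau> z = cyl \<tau> w" "w \<in> \<Omega>"
  shows "f z = f w"
proof -
  obtain k :: int where "z = w + of_int k * \<tau>" using cyl_eqD[OF \<tau>_nonzero assms(1)] .
  then show ?thesis using f_periodic_int[OF assms(2)] by simp
qed

text \<open>Inside a strip, a vertical shift by its full width leaves \<Omega>, so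
  \<open>u_le_dist\<close> bounds \<open>u\<close>. A bounded \<open>u\<close> with zero boundary
  values is nonpositive by Phragmen-Lindelof. This is why at least one end belongs to
  \<Omega>.\<close>

lemma not_contained_in_strip:
  assumes strip: "\<And>z. z \<in> \<Omega> \<Longrightarrow> \<bar>Im (z / \<tau>)\<bar> < R"
  shows False
proof -
  obtain z where z: "z \<in> \<Omega>" using frontier_nonempty by fastforce
  obtain w r where r: "r > 0" "ball w r \<inter> \<Omega> = {}" using exterior_disc by blast
  have "u z \<le> 0"
  proof (rule bounded_local_real_part_nonpos[OF open_dom r cont_u, where B = "2 * norm (of_real (2 * R) * \<i> * \<tau>)"])
    fix x assume x: "x \<in> \<Omega>"
    have "Im ((x + of_real (2 * R) * \<i> * \<tau>) / \<tau>) = Im (x / \<tau>) + 2 * R"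
      using \<tau>_nonzero by (simp add: add_divide_distrib)
    then have "x + of_real (2 * R) * \<i> * \<tau> \<notin> \<Omega>"
      using strip[OF x] strip[of "x + of_real (2 * R) * \<i> * \<tau>"] by auto
    from u_le_dist[OF x this] show "u x \<le> 2 * norm (of_real (2 * R) * \<i> * \<tau>)"
      by (simp add: dist_norm)
    obtain e where e: "e > 0" "ball x e \<subseteq> \<Omega>" using open_dom x openE by blast
    obtain F where F: "\<And>w. w \<in> ball x e \<Longrightarrow> (F has_field_derivative f w) (at w)"
          "\<And>w. w \<in> ball x e \<Longrightarrow> Re (F w) = u w" using local_primitive[OF e(2)] by metis
    have "F holomorphic_on ball x e" unfolding holomorphic_on_open[OF open_ball] using F(1) by blast
    moreover have "\<forall>y\<in>ball x e. u y = Re (F y)" using F(2) by simp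
    ultimately show "\<exists>e>0. \<exists>H. H holomorphic_on ball x e \<and> (\<forall>y\<in>ball x e. u y = Re (H y))"
      using e(1) by blast
  qed (use u_frontier z in auto)
  with u_pos[OF z] show False by simp
qed

lemma halfplane_dichotomy:
  assumes "\<And>z. z \<in> frontier \<Omega> \<Longrightarrow> Im (z / \<tau>) < R"
  shows "{z. Im (z / \<tau>) \<ge> R} \<subseteq> \<Omega> \<or> {z. Im (z / \<tau>) \<ge> R} \<inter> \<Omega> = {}"
proof (rule ccontr)
  let ?H = "{z. Im (z / \<tau>) \<ge> R}"
  assume "\<not> ?thesis"
  then have "?H \<inter> \<Omega> \<noteq> {}" "?H - \<Omega> \<noteq> {}" by blast+
  then obtain z where "z \<in> ?H" "z \<in> frontier \<Omega>"
    using connected_Int_frontier[OF connected_Im_halfplane[OF \<tau>_nonzero]] by blast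
  then show False using assms[of z] by simp
qed

lemma f_limit:
  assumes sub: "{z. Im (z / \<tau>) \<ge> R} \<subseteq> \<Omega>"
  obtains L where "\<And>e. e > 0 \<Longrightarrow> \<exists>M. \<forall>z. Im (z / \<tau>) \<ge> R \<and> Im (z / \<tau>) > M \<longrightarrow> norm (f z - L) < e"
proof -
  define \<rho> where "\<rho> = exp (- (2 * pi) * R)"
  define c where "c = \<tau> / (2 * of_real pi * \<i>)"
  \<comment> \<open>Crossing the cut of \<open>Ln\<close> shifts the argument of \<open>f\<close> by
    a period, so \<open>g\<close> does not see the cut.\<close>
  define g where "g q = f (c * Ln q)" for q
  have "\<rho> > 0" by (simp add: \<rho>_def)
  have dom: "z \<in> \<Omega>" if "norm (cyl \<tau> z) < \<rho>" for z
  proof -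
    have "(2 * pi) * R < (2 * pi) * Im (z / \<tau>)" using that by (simp add: norm_cyl \<rho>_def)
    then have "Im (z / \<tau>) > R" by (simp add: mult_less_cancel_left)
    then show ?thesis using sub by auto
  qed
  have g_eq: "g (cyl \<tau> z) = f z" if "norm (cyl \<tau> z) < \<rho>" for z
    unfolding g_def c_def by (rule f_eq_if_cyl_eq[OF cyl_Ln[OF \<tau>_nonzero cyl_nonzero] dom[OF that]])
  have hol_g: "g holomorphic_on ball (0 :: complex) \<rho> - {0}"
  proof (rule holomorphic_onI)
    fix p :: complex assume p: "p \<in> ball 0 \<rho> - {0}"
    define A where "A = ball p (norm p) \<inter> ball 0 \<rho>"
    have A: "open A" "p \<in> A" using p by (auto simp: A_def)
    have half: "Re (q / p) > 0" if "q \<in> A" for q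
    proof -
      have "q / p - 1 = (q - p) / p" using p by (simp add: diff_divide_distrib)
      then have "norm (q / p - 1) = norm (q - p) / norm p" by (simp add: norm_divide)
      also have "\<dots> < 1" using that p by (simp add: A_def dist_norm norm_minus_commute)
      finally show ?thesis using abs_Re_le_cmod[of "q / p - 1"] by simp
    qed
    \<comment> \<open>A branch of the logarithm that is holomorphic near \<open>p\<close> even if
      \<open>p\<close> lies on the cut; periodicity of \<open>f\<close> identifies the result with
      \<open>g\<close>.\<close>
    define z where "z q = c * (Ln (q / p) + Ln p)" for q
    have cyl_z: "cyl \<tau> (z q) = q" if "q \<in> A" for q
    proof -
      have "q / p \<noteq> 0" using half[OF that] by (metis less_irrefl zero_complex.sel(1))
      moreover have "cyl \<tau> (z q) = exp (Ln (q / p) + Ln p)"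
        using \<tau>_nonzero by (simp add: cyl_def z_def c_def)
      ultimately show ?thesis using p by (simp add: exp_add)
    qed
    have hol_fz: "(\<lambda>q. f (z q)) holomorphic_on A"
    proof (rule holomorphic_on_compose_gen[of z A f \<Omega>, unfolded o_def, OF _ hol])
      show "z holomorphic_on A"
        unfolding z_def using p half by (intro holomorphic_intros) (force simp: complex_nonpos_Reals_iff)+
      show "z ` A \<subseteq> \<Omega>" using cyl_z by (auto intro!: dom simp: A_def)
    qed
    have fz: "f (z q) = g q" if "q \<in> A" for q
      using g_eq[of "z q"] cyl_z[OF that] that by (simp add: A_def)
    have "g holomorphic_on A"
      by (rule holomorphic_transform[of "\<lambda>q. f (z q)" A g, OF hol_fz fz])
    from holomorphic_on_imp_differentiable_at[OF this A]
    show "g field_differentiable at p within ball 0 \<rho> - {0}" by (rule field_differentiable_at_within)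
  qed
  have "norm (g q) \<le> 1" if "q \<noteq> 0" "norm q < \<rho>" for q
  proof -
    have "cyl \<tau> (c * Ln q) = q" unfolding c_def by (rule cyl_Ln[OF \<tau>_nonzero that(1)])
    then show ?thesis using norm_f_le_1[OF dom, of "c * Ln q"] that(2) by (simp add: g_def)
  qed
  then have ev: "eventually (\<lambda>q. norm (g q) \<le> 1) (at 0)"
    unfolding eventually_at using \<open>\<rho> > 0\<close> by (intro exI[of _ \<rho>]) simp
  have "(0 :: complex) \<in> interior (ball 0 \<rho>)" using \<open>\<rho> > 0\<close> by simp
  \<comment> \<open>Riemann's removable singularity theorem at the puncture that represents the end;
    the value of the extension there is the limit.\<close>
  from iffD2[OF holomorphic_on_extend_bounded[OF hol_g this], OF exI[of _ 1], OF ev]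
  obtain h where h: "h holomorphic_on ball 0 \<rho>" "\<forall>q\<in>ball 0 \<rho> - {0}. h q = g q"
    by (elim exE conjE)
  have "isCont h 0"
    using continuous_on_interior[OF holomorphic_on_imp_continuous_on[OF h(1)], of 0] \<open>\<rho> > 0\<close> by simp
  show ?thesis
  proof (rule that[of "h 0"])
    fix e :: real assume "e > 0"
    with \<open>isCont h 0\<close> obtain d where d: "d > 0" "\<forall>q. dist q 0 < d \<longrightarrow> dist (h q) (h 0) < e"
      unfolding continuous_at_eps_delta by blast
    define m where "m = min d \<rho>"
    have "m > 0" using d \<open>\<rho> > 0\<close> by (simp add: m_def)
    show "\<exists>M. \<forall>z. Im (z / \<tau>) \<ge> R \<and> Im (z / \<tau>) > M \<longrightarrow> norm (f z - h 0) < e"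
    proof (intro exI allI impI)
      fix z assume z: "Im (z / \<tau>) \<ge> R \<and> Im (z / \<tau>) > - ln m / (2 * pi)"
      then have "- (2 * pi) * Im (z / \<tau>) < ln m" by (simp add: field_simps)
      then have "exp (- (2 * pi) * Im (z / \<tau>)) < exp (ln m)" by (simp only: exp_less_cancel_iff)
      then have "norm (cyl \<tau> z) < m" using \<open>m > 0\<close> by (simp only: norm_cyl exp_ln)
      then have *: "norm (cyl \<tau> z) < d" "norm (cyl \<tau> z) < \<rho>" by (auto simp: m_def)
      then have "h (cyl \<tau> z) = f z" using h(2)[rule_format, of "cyl \<tau> z"] g_eq by simp
      then show "norm (f z - h 0) < e" using d(2)[rule_format, of "cyl \<tau> z"] * by (simp add: dist_norm)
    qed
  qed
qed

end

section \<open>Arclength charts of the frontier\<close>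

text \<open>In the chart, \<open>u\<close> vanishes on the real axis, so its tangential derivative
  should vanish; but the chain rule holds only above the axis. Hence horizontal segments at small
  height \<open>y\<close> are used: by continuity their end values of \<open>u\<close> are tiny,
  while a nonzero normal component would force a definite increment.\<close>

lemma (in overdetermined) chart_tangent:
  assumes "open D" and diff: "\<And>\<zeta>. \<zeta> \<in> D \<Longrightarrow> \<phi> differentiable (at \<zeta>)"
    and cont: "continuous_on D (dirderivs [1] \<phi>)"
    and upper: "\<And>\<zeta>. \<zeta> \<in> D \<Longrightarrow> Im \<zeta> > 0 \<Longrightarrow> \<phi> \<zeta> \<in> \<Omega>"
    and real: "\<And>\<zeta>. \<zeta> \<in> D \<Longrightarrow> Im \<zeta> = 0 \<Longrightarrow> \<phi> \<zeta> \<in> frontier \<Omega>"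
    and x0: "Complex x0 0 \<in> D"
  shows "Re (f (\<phi> (Complex x0 0)) * dirderivs [1] \<phi> (Complex x0 0)) = 0"
proof (rule ccontr)
  define N where "N \<zeta> = Re (f (\<phi> \<zeta>) * dirderivs [1] \<phi> \<zeta>)" for \<zeta>
  define A where "A = D \<inter> {\<zeta>. Im \<zeta> \<ge> 0}"
  define \<eta> where "\<eta> = \<bar>N (Complex x0 0)\<bar> / 2"
  assume "Re (f (\<phi> (Complex x0 0)) * dirderivs [1] \<phi> (Complex x0 0)) \<noteq> 0"
  then have "\<eta> > 0" by (simp add: \<eta>_def N_def)
  have A\<Omega>: "\<phi> \<zeta> \<in> closure \<Omega>" if "\<zeta> \<in> A" for \<zeta>
  proof (cases "Im \<zeta> = 0")
    case True
    then show ?thesis using real[of \<zeta>] that by (simp add: A_def frontier_def)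
  next
    case False
    then have "\<phi> \<zeta> \<in> \<Omega>" using upper[of \<zeta>] that by (simp add: A_def)
    then show ?thesis using closure_subset by blast
  qed
  have cont_\<phi>: "continuous_on A \<phi>"
    using diff by (intro differentiable_imp_continuous_on) (auto simp: differentiable_on_def A_def intro: differentiable_at_withinI)
  have "continuous_on A N"
    unfolding N_def using A\<Omega> cont
    by (intro continuous_intros continuous_on_compose2[OF cont_f cont_\<phi>])
       (auto simp: A_def simp del: dirderivs.simps intro: continuous_on_subset)
  moreover have "Complex x0 0 \<in> A" using x0 by (simp add: A_def)
  ultimately obtain \<delta>1 where \<delta>1: "\<delta>1 > 0"
    "\<forall>\<zeta>\<in>A. dist \<zeta> (Complex x0 0) < \<delta>1 \<longrightarrow> dist (N \<zeta>) (N (Complex x0 0)) < \<eta>"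
    using \<open>\<eta> > 0\<close> unfolding continuous_on_iff by blast
  obtain \<delta>2 where \<delta>2: "\<delta>2 > 0" "ball (Complex x0 0) \<delta>2 \<subseteq> D" using \<open>open D\<close> x0 openE by blast
  define r where "r = min \<delta>1 \<delta>2 / 2"
  have r: "r > 0" "2 * r \<le> \<delta>1" "2 * r \<le> \<delta>2" using \<delta>1 \<delta>2 by (auto simp: r_def)
  have near: "dist (Complex x y) (Complex x0 0) < 2 * r" if "\<bar>x - x0\<bar> \<le> r" "0 \<le> y" "y < r" for x y
    using cmod_le[of "Complex x y - Complex x0 0"] that by (simp add: dist_norm)
  have inA: "Complex x y \<in> A" if "\<bar>x - x0\<bar> \<le> r" "0 \<le> y" "y < r" for x y
  proof -
    have "dist (Complex x0 0) (Complex x y) < \<delta>2" using near[OF that] r(3) by (simp add: dist_commute)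
    then show ?thesis using \<delta>2(2) that by (auto simp: A_def)
  qed
  have "continuous_on A (\<lambda>\<zeta>. u (\<phi> \<zeta>))"
    using A\<Omega> by (intro continuous_on_compose2[OF cont_u cont_\<phi>]) auto
  have small: "\<exists>d>0. \<forall>y. 0 \<le> y \<longrightarrow> y < r \<longrightarrow> y < d \<longrightarrow> \<bar>u (\<phi> (Complex x y))\<bar> < r * \<eta>" if x: "\<bar>x - x0\<bar> \<le> r" for x
  proof -
    have x0A: "Complex x 0 \<in> A" using inA[OF x, of 0] r by simp
    have "r * \<eta> > 0" using r(1) \<open>\<eta> > 0\<close> by simp
    then obtain d where d: "d > 0" "\<forall>\<zeta>\<in>A. dist \<zeta> (Complex x 0) < d \<longrightarrow> dist (u (\<phi> \<zeta>)) (u (\<phi> (Complex x 0))) < r * \<eta>"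
      using \<open>continuous_on A (\<lambda>\<zeta>. u (\<phi> \<zeta>))\<close> x0A unfolding continuous_on_iff by blast
    have 0: "u (\<phi> (Complex x 0)) = 0" using real[of "Complex x 0"] x0A u_frontier by (simp add: A_def)
    show ?thesis
    proof (intro exI[of _ d] conjI allI impI d(1))
      fix y :: real assume y: "0 \<le> y" "y < r" "y < d"
      have "dist (Complex x y) (Complex x 0) = y" using y(1) by (simp add: dist_complex_def cmod_def)
      then show "\<bar>u (\<phi> (Complex x y))\<bar> < r * \<eta>"
        using d(2) inA[OF x y(1,2)] y(3) 0 by (simp add: dist_real_def)
    qed
  qed
  obtain d1 where d1: "d1 > 0" "\<forall>y. 0 \<le> y \<longrightarrow> y < r \<longrightarrow> y < d1 \<longrightarrow> \<bar>u (\<phi> (Complex (x0 + r) y))\<bar> < r * \<eta>"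
    using small[of "x0 + r"] r(1) by auto
  obtain d2 where d2: "d2 > 0" "\<forall>y. 0 \<le> y \<longrightarrow> y < r \<longrightarrow> y < d2 \<longrightarrow> \<bar>u (\<phi> (Complex (x0 - r) y))\<bar> < r * \<eta>"
    using small[of "x0 - r"] r(1) by auto
  define y where "y = min r (min d1 d2) / 2"
  have y: "0 < y" "y < r" "y < d1" "y < d2" using r(1) d1(1) d2(1) by (auto simp: y_def)
  have der: "((\<lambda>x. u (\<phi> (Complex x y))) has_real_derivative N (Complex x y)) (at x)" if "\<bar>x - x0\<bar> \<le> r" for x
  proof -
    have "Complex x y \<in> D" using inA[OF that, of y] y by (simp add: A_def)
    then have 1: "((\<lambda>x. \<phi> (Complex x y)) has_vector_derivative dirderivs [1] \<phi> (Complex x y)) (at x)"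
      using has_vector_derivative_along_Re[OF diff] by simp
    have "\<phi> (Complex x y) \<in> \<Omega>" using upper[of "Complex x y"] \<open>Complex x y \<in> D\<close> y(1) by simp
    from has_derivative_at_withinI[OF deriv_u[OF this]]
    have "(u has_derivative (\<lambda>h. Re (f (\<phi> (Complex x y)) * h))) (at (\<phi> (Complex x y)) within range (\<lambda>x. \<phi> (Complex x y)))" .
    from vector_derivative_diff_chain_within[OF 1 this]
    show ?thesis by (simp add: has_real_derivative_iff_has_vector_derivative o_def N_def del: times_complex.sel)
  qed
  \<comment> \<open>The increment equals \<open>2 * r\<close> times a value of \<open>N\<close>
    exceeding \<eta> in modulus, yet each end value of \<open>u\<close> is below
    \<open>r * \<eta>\<close>.\<close>
  obtain x where x: "x0 - r < x" "x < x0 + r"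
    "u (\<phi> (Complex (x0 + r) y)) - u (\<phi> (Complex (x0 - r) y)) = (x0 + r - (x0 - r)) * N (Complex x y)"
    using MVT2[of "x0 - r" "x0 + r" "\<lambda>x. u (\<phi> (Complex x y))" "\<lambda>x. N (Complex x y)"] der r(1)
    by (auto simp: abs_le_iff)
  have xr: "\<bar>x - x0\<bar> \<le> r" using x by auto
  have "dist (N (Complex x y)) (N (Complex x0 0)) < \<eta>"
    using \<delta>1(2) inA[OF xr, of y] near[OF xr, of y] y r by auto
  then have "\<bar>N (Complex x y)\<bar> > \<eta>" unfolding \<eta>_def dist_real_def by linarith
  then have "r * \<bar>N (Complex x y)\<bar> > r * \<eta>" using r(1) by simp
  moreover have "\<bar>2 * (r * N (Complex x y))\<bar> < 2 * (r * \<eta>)"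
  proof -
    have "2 * (r * N (Complex x y)) = u (\<phi> (Complex (x0 + r) y)) - u (\<phi> (Complex (x0 - r) y))"
      using x(3) by (simp add: algebra_simps)
    then show ?thesis using d1(2)[rule_format, of y] d2(2)[rule_format, of y] y by linarith
  qed
  ultimately show False using r(1) by (simp add: abs_mult)
qed

text \<open>In a boundary chart the frontier is a regular curve, and its tangent is a multiple of
  \<open>i\<nabla>u\<close>; reparametrising it by arclength makes its velocity exactly \<open>i\<nabla>u\<close>.\<close>

lemma (in overdetermined) arclength_chart:
  assumes "smooth_domain \<Omega>" and p: "p \<in> frontier \<Omega>"
  obtains U a c \<sigma> where "open U" "p \<in> U" "a > (0 :: real)" "c 0 = p" "\<sigma> p = (0 :: real)"
    "\<And>t. \<bar>t\<bar> < a \<Longrightarrow> c t \<in> frontier \<Omega> \<and> (c has_vector_derivative \<i> * cnj (f (c t))) (at t)"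
    "\<And>z. z \<in> U \<inter> frontier \<Omega> \<Longrightarrow> \<bar>\<sigma> z\<bar> < a \<and> c (\<sigma> z) = z \<and>
        (\<exists>D. (\<sigma> has_derivative D) (at z) \<and> D (\<i> * cnj (f z)) = 1)"
proof -
  obtain \<epsilon> \<psi> D where "\<epsilon> > 0" and sd: "smooth_diffeo \<psi> (ball p \<epsilon>) D"
    and up: "\<psi> ` (ball p \<epsilon> \<inter> \<Omega>) = D \<inter> {x. Im x > 0}"
    and re: "\<psi> ` (ball p \<epsilon> \<inter> frontier \<Omega>) = D \<inter> {x. Im x = 0}"
    using assms unfolding smooth_domain_def by blast
  obtain \<phi> where "open D" and s\<psi>: "smooth_on (ball p \<epsilon>) \<psi>" and im: "\<psi> ` ball p \<epsilon> = D"
    and s\<phi>: "smooth_on D \<phi>" and \<phi>\<psi>: "\<And>x. x \<in> ball p \<epsilon> \<Longrightarrow> \<phi> (\<psi> x) = x"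
    using sd unfolding smooth_diffeo_def by blast
  have d\<psi>: "\<psi> differentiable (at z)" if "z \<in> ball p \<epsilon>" for z
    using s\<psi> that unfolding smooth_on_def Ck_on_def by (metis dirderivs.simps(1) length_0_conv less_one)
  have d\<phi>: "\<phi> differentiable (at \<zeta>)" if "\<zeta> \<in> D" for \<zeta>
    using s\<phi> that unfolding smooth_on_def Ck_on_def by (metis dirderivs.simps(1) length_0_conv less_one)
  have cd\<phi>: "continuous_on D (dirderivs [1] \<phi>)"
    using s\<phi> unfolding smooth_on_def Ck_on_def by (metis length_Cons list.size(3))
  have \<psi>\<phi>: "\<psi> (\<phi> \<zeta>) = \<zeta> \<and> \<phi> \<zeta> \<in> ball p \<epsilon>" if "\<zeta> \<in> D" for \<zeta>
    using that im \<phi>\<psi> by (metis imageE)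
  have upper: "\<phi> \<zeta> \<in> \<Omega>" if "\<zeta> \<in> D" "Im \<zeta> > 0" for \<zeta>
  proof -
    have "\<zeta> \<in> \<psi> ` (ball p \<epsilon> \<inter> \<Omega>)" using that up by blast
    then show ?thesis using \<phi>\<psi> by auto
  qed
  have real: "\<phi> \<zeta> \<in> frontier \<Omega>" if "\<zeta> \<in> D" "Im \<zeta> = 0" for \<zeta>
  proof -
    have "\<zeta> \<in> \<psi> ` (ball p \<epsilon> \<inter> frontier \<Omega>)" using that re by blast
    then show ?thesis using \<phi>\<psi> by auto
  qed
  define x0 where "x0 = Re (\<psi> p)"
  have "\<psi> p \<in> D \<inter> {x. Im x = 0}" using re p \<open>\<epsilon> > 0\<close> by force
  then have \<psi>p: "\<psi> p = Complex x0 0" "Complex x0 0 \<in> D" by (auto simp: x0_def complex_eq_iff) (metis complex_surj)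
  obtain b where b: "b > 0" "cball (Complex x0 0) b \<subseteq> D"
    using \<open>open D\<close> \<psi>p(2) open_contains_cball by blast
  have inD: "Complex x 0 \<in> D" if "x \<in> {x0 - b..x0 + b}" for x
  proof -
    have "dist (Complex x0 0) (Complex x 0) = \<bar>x0 - x\<bar>" by (simp add: dist_complex_def cmod_def)
    then show ?thesis using b(2) that by (auto simp: subset_iff abs_le_iff)
  qed
  define \<gamma> where "\<gamma> x = \<phi> (Complex x 0)" for x
  define \<gamma>' where "\<gamma>' x = dirderivs [1] \<phi> (Complex x 0)" for x
  \<comment> \<open>Signed speed: \<open>f * \<gamma>'\<close> is purely imaginary by
    \<open>chart_tangent\<close> and |f| = 1, so \<gamma>' is \<open>l\<close> times the unit
    tangent \<open>\<i> * cnj f\<close>.\<close>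
  define l where "l x = Im (f (\<gamma> x) * \<gamma>' x)" for x
  have \<gamma>_fr: "\<gamma> x \<in> frontier \<Omega>" if "x \<in> {x0 - b..x0 + b}" for x
    unfolding \<gamma>_def using real[OF inD[OF that]] by simp
  have D\<gamma>: "(\<gamma> has_vector_derivative \<gamma>' x) (at x)" if "x \<in> {x0 - b..x0 + b}" for x
    unfolding \<gamma>_def \<gamma>'_def using has_vector_derivative_along_Re[OF d\<phi>[OF inD[OF that]]] by simp
  have \<gamma>'_eq: "\<gamma>' x = of_real (l x) * (\<i> * cnj (f (\<gamma> x)))" if x: "x \<in> {x0 - b..x0 + b}" for x
  proof -
    have "Re (f (\<gamma> x) * \<gamma>' x) = 0"
      unfolding \<gamma>_def \<gamma>'_def by (rule chart_tangent[OF \<open>open D\<close> d\<phi> cd\<phi> upper real inD[OF x]])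
    then have 1: "f (\<gamma> x) * \<gamma>' x = \<i> * of_real (l x)" by (simp add: complex_eq_iff l_def)
    have "cnj (f (\<gamma> x)) * f (\<gamma> x) = 1"
      using complex_norm_square[of "f (\<gamma> x)"] norm_f_frontier[OF \<gamma>_fr[OF x]] by (simp add: mult.commute)
    then have "\<gamma>' x = cnj (f (\<gamma> x)) * (f (\<gamma> x) * \<gamma>' x)" by (simp add: mult.assoc[symmetric])
    then show ?thesis unfolding 1 by (simp add: algebra_simps)
  qed
  \<comment> \<open>Differentiating \<psi>(\<gamma>(x)) = x shows that the speed never vanishes; the
    same identity later gives \<sigma> unit growth along the tangent.\<close>
  have d\<psi>\<gamma>: "frechet_derivative \<psi> (at (\<gamma> x)) (\<gamma>' x) = 1" if x: "x \<in> {x0 - b<..<x0 + b}" for x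
  proof -
    have xI: "x \<in> {x0 - b..x0 + b}" using x by auto
    have "(\<psi> has_derivative frechet_derivative \<psi> (at (\<gamma> x))) (at (\<gamma> x) within range \<gamma>)"
      using d\<psi>[of "\<gamma> x"] \<psi>\<phi>[OF inD[OF xI]] 
      by (auto simp: \<gamma>_def frechet_derivative_works intro: has_derivative_at_withinI)
    from vector_derivative_diff_chain_within[OF D\<gamma>[OF xI] this]
    have 1: "((\<lambda>x. \<psi> (\<gamma> x)) has_vector_derivative frechet_derivative \<psi> (at (\<gamma> x)) (\<gamma>' x)) (at x)"
      by (simp add: o_def)
    have "((\<lambda>x. Complex x 0) has_vector_derivative 1) (at x)"
      unfolding Complex_eq by (auto intro!: derivative_eq_intros)
    then have "((\<lambda>x. \<psi> (\<gamma> x)) has_vector_derivative 1) (at x)"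
      by (rule has_vector_derivative_transform_within_open[OF _ open_greaterThanLessThan x])
         (use \<psi>\<phi>[OF inD] in \<open>auto simp: \<gamma>_def\<close>)
    with 1 show ?thesis by (rule vector_derivative_unique_at)
  qed
  have linD: "linear (frechet_derivative \<psi> (at z))" if "z \<in> ball p \<epsilon>" for z
    using d\<psi>[OF that] unfolding frechet_derivative_works by (rule has_derivative_linear)
  have \<gamma>_ball: "\<gamma> x \<in> ball p \<epsilon>" if "x \<in> {x0 - b..x0 + b}" for x
    using \<psi>\<phi>[OF inD[OF that]] by (simp add: \<gamma>_def)
  have l\<psi>: "l x *\<^sub>R frechet_derivative \<psi> (at (\<gamma> x)) (\<i> * cnj (f (\<gamma> x))) = 1" if x: "x \<in> {x0 - b<..<x0 + b}" for x
  proof -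
    have xI: "x \<in> {x0 - b..x0 + b}" using x by auto
    have "l x *\<^sub>R frechet_derivative \<psi> (at (\<gamma> x)) (\<i> * cnj (f (\<gamma> x))) =
        frechet_derivative \<psi> (at (\<gamma> x)) (l x *\<^sub>R (\<i> * cnj (f (\<gamma> x))))"
      by (rule linear_scale[OF linD[OF \<gamma>_ball[OF xI]], symmetric])
    also have "l x *\<^sub>R (\<i> * cnj (f (\<gamma> x))) = \<gamma>' x" unfolding \<gamma>'_eq[OF xI] by (simp add: scaleR_conv_of_real)
    finally show ?thesis using d\<psi>\<gamma>[OF x] by simp
  qed
  then have l_nz: "l x \<noteq> 0" if "x \<in> {x0 - b<..<x0 + b}" for x using that by force
  have "continuous_on {x0 - b..x0 + b} (\<lambda>x. Complex x 0)" unfolding Complex_eq by (intro continuous_intros)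
  then have c\<gamma>': "continuous_on {x0 - b..x0 + b} \<gamma>'"
    unfolding \<gamma>'_def using inD by (intro continuous_on_compose2[OF cd\<phi>]) auto
  have c\<gamma>: "continuous_on {x0 - b..x0 + b} \<gamma>"
    using D\<gamma> by (intro continuous_on_vector_derivative[of _ \<gamma> \<gamma>']) (auto intro: has_vector_derivative_at_within)
  have "continuous_on {x0 - b..x0 + b} l"
    unfolding l_def using \<gamma>_fr
    by (intro continuous_intros c\<gamma>' continuous_on_compose2[OF cont_f c\<gamma>]) (auto simp: frontier_def)
  note cl = this
  define J where "J = {x0 - b<..<x0 + b}"
  \<comment> \<open>Arclength up to orientation, counted from \<open>x0\<close>. Its injectivity
    follows from \<open>l \<noteq> 0\<close> and the mean value theorem without deciding the sign of
    \<open>l\<close>.\<close>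
  define s where "s x = integral {x0 - b..x} l - integral {x0 - b..x0} l" for x
  have Ds: "(s has_real_derivative l x) (at x)" if "x \<in> J" for x
  proof -
    have "((\<lambda>x. integral {x0 - b..x} l) has_real_derivative l x) (at x within {x0 - b..x0 + b})"
      using that by (intro integral_has_real_derivative[OF cl]) (auto simp: J_def)
    then have "((\<lambda>x. integral {x0 - b..x} l) has_real_derivative l x) (at x)"
      using that by (simp add: at_within_Icc_at J_def)
    then show ?thesis unfolding s_def[abs_def] by (auto intro!: derivative_eq_intros)
  qed
  have x0J: "x0 \<in> J" using b by (simp add: J_def)
  have contJ: "continuous_on J s"
    using Ds by (intro DERIV_continuous_on[of _ s l]) (auto intro: has_field_derivative_at_within)
  have injs: "inj_on s J"
  proof (rule linorder_inj_onI)
    fix x y assume xy: "x < y" "x \<in> J" "y \<in> J"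
    then obtain z where "x < z" "z < y" "s y - s x = (y - x) * l z"
      using MVT2[of x y s l] Ds by (auto simp: J_def)
    then show "s x \<noteq> s y" using l_nz[of z] xy by (auto simp: J_def)
  qed auto
  have opJ: "open J" by (simp add: J_def)
  have "open (s ` J)" by (rule invariance_of_domain[OF contJ opJ injs])
  moreover have "0 \<in> s ` J" using x0J by (auto simp: s_def intro!: image_eqI[of _ _ x0])
  ultimately obtain a where a: "a > 0" "ball 0 a \<subseteq> s ` J" using openE by blast
  define g where "g = inv_into J s"
  have gs: "g (s x) = x" if "x \<in> J" for x unfolding g_def by (rule inv_into_f_f[OF injs that])
  have sg: "g t \<in> J \<and> s (g t) = t" if "\<bar>t\<bar> < a" for t
  proof -
    have "t \<in> s ` J" using a(2) that by (auto simp: subset_iff)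
    then show ?thesis unfolding g_def by (auto intro: inv_into_into f_inv_into_f)
  qed
  have Dg: "(g has_real_derivative 1 / l (g t)) (at t)" if t: "\<bar>t\<bar> < a" for t
  proof -
    have gt: "g t \<in> J" "s (g t) = t" using sg[OF t] by auto
    have "(g has_derivative (\<lambda>h. 1 / l (g t) * h)) (at (s (g t)))"
    proof (rule has_derivative_inverse_strong[OF opJ gt(1) contJ gs])
      show "(s has_derivative (\<lambda>h. l (g t) * h)) (at (g t))"
        using Ds[OF gt(1)] by (simp add: has_field_derivative_def)
      show "(\<lambda>h. l (g t) * h) \<circ> (\<lambda>h. 1 / l (g t) * h) = id"
        using l_nz[of "g t"] gt(1) by (auto simp: J_def fun_eq_iff)
    qed auto
    then show ?thesis unfolding gt(2) has_field_derivative_def .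
  qed
  define c where "c t = \<gamma> (g t)" for t
  \<comment> \<open>The arclength parameter, continued off the frontier through the real part of the
    chart, so that it is differentiable in the plane and can be composed with arbitrary
    curves.\<close>
  define \<sigma> where "\<sigma> z = s (Re (\<psi> z))" for z
  define U where "U = {z \<in> ball p \<epsilon>. Re (\<psi> z) \<in> {x \<in> J. s x \<in> {-a<..<a}}}"
  have JI: "x \<in> {x0 - b..x0 + b}" if "x \<in> J" for x using that by (auto simp: J_def)
  show ?thesis
  proof (rule that[of U a c \<sigma>])
    have "open (J \<inter> s -` {-a<..<a})" by (rule continuous_open_preimage[OF contJ opJ open_greaterThanLessThan])
    moreover have "continuous_on (ball p \<epsilon>) (\<lambda>z. Re (\<psi> z))"
      using d\<psi> by (intro continuous_intros differentiable_imp_continuous_on)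
        (auto simp: differentiable_on_def simp del: mem_ball intro: differentiable_at_withinI)
    ultimately have "open (ball p \<epsilon> \<inter> (\<lambda>z. Re (\<psi> z)) -` (J \<inter> s -` {-a<..<a}))"
      using continuous_open_preimage open_ball by blast
    also have "ball p \<epsilon> \<inter> (\<lambda>z. Re (\<psi> z)) -` (J \<inter> s -` {-a<..<a}) = U" by (auto simp: U_def)
    finally show "open U" .
    show "a > 0" by (rule a(1))
    have "s x0 = 0" by (simp add: s_def)
    then show "\<sigma> p = 0" by (simp add: \<sigma>_def x0_def)
    show "p \<in> U" using \<open>\<epsilon> > 0\<close> x0J \<open>s x0 = 0\<close> a(1) by (simp add: U_def x0_def)
    have "g 0 = x0" using gs[OF x0J] \<open>s x0 = 0\<close> by simp
    then show "c 0 = p" using \<phi>\<psi>[of p] \<open>\<epsilon> > 0\<close> by (simp add: c_def \<gamma>_def \<psi>p(1))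
    show "c t \<in> frontier \<Omega> \<and> (c has_vector_derivative \<i> * cnj (f (c t))) (at t)" if t: "\<bar>t\<bar> < a" for t
    proof
      have gt: "g t \<in> J" using sg[OF t] by simp
      show "c t \<in> frontier \<Omega>" unfolding c_def by (rule \<gamma>_fr[OF JI[OF gt]])
      have "(g has_vector_derivative 1 / l (g t)) (at t)"
        using Dg[OF t] by (simp add: has_real_derivative_iff_has_vector_derivative)
      from vector_diff_chain_at[OF this D\<gamma>[OF JI[OF gt]]]
      have "(c has_vector_derivative (1 / l (g t)) *\<^sub>R \<gamma>' (g t)) (at t)" by (simp add: o_def c_def[abs_def])
      moreover have "(1 / l (g t)) *\<^sub>R \<gamma>' (g t) = \<i> * cnj (f (c t))"
        unfolding \<gamma>'_eq[OF JI[OF gt]] using l_nz[of "g t"] gt by (simp add: c_def J_def scaleR_conv_of_real)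
      ultimately show "(c has_vector_derivative \<i> * cnj (f (c t))) (at t)" by simp
    qed
    show "\<bar>\<sigma> z\<bar> < a \<and> c (\<sigma> z) = z \<and> (\<exists>D. (\<sigma> has_derivative D) (at z) \<and> D (\<i> * cnj (f z)) = 1)"
      if z: "z \<in> U \<inter> frontier \<Omega>" for z
    proof -
      have zb: "z \<in> ball p \<epsilon>" and xJ: "Re (\<psi> z) \<in> J" and sa: "\<bar>s (Re (\<psi> z))\<bar> < a"
        using z by (auto simp: U_def)
      have "\<psi> z \<in> D \<inter> {x. Im x = 0}" using re zb z by blast
      then have "\<psi> z = Complex (Re (\<psi> z)) 0" by (simp add: complex_eq_iff)
      then have \<gamma>z: "\<gamma> (Re (\<psi> z)) = z" using \<phi>\<psi>[OF zb] by (simp add: \<gamma>_def)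
      have "(\<psi> has_derivative frechet_derivative \<psi> (at z)) (at z)"
        using d\<psi>[OF zb] by (simp add: frechet_derivative_works)
      from has_derivative_Re[OF this] have 1: "((\<lambda>z. Re (\<psi> z)) has_derivative (\<lambda>h. Re (frechet_derivative \<psi> (at z) h))) (at z)" .
      have "(s has_derivative (\<lambda>h. l (Re (\<psi> z)) * h)) (at (Re (\<psi> z)))"
        using Ds[OF xJ] by (simp add: has_field_derivative_def)
      from has_derivative_compose[OF 1 this]
      have "(\<sigma> has_derivative (\<lambda>h. l (Re (\<psi> z)) * Re (frechet_derivative \<psi> (at z) h))) (at z)"
        by (simp add: \<sigma>_def[abs_def])
      moreover have "l (Re (\<psi> z)) * Re (frechet_derivative \<psi> (at z) (\<i> * cnj (f z))) = 1"
        using arg_cong[OF l\<psi>[of "Re (\<psi> z)"], of Re] xJ unfolding \<gamma>z J_def by simp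
      ultimately show ?thesis using sa gs[OF xJ] \<gamma>z by (auto simp: \<sigma>_def c_def)
    qed
  qed
qed

section \<open>Integral curves on compact one-dimensional sets\<close>

text \<open>A compact set foliated by the integral curves of a field: the charts say that every integral
  curve through a point is, near that point, the given one up to a time shift.\<close>

locale compact_flow =
  fixes K :: "complex set" and Y :: "complex \<Rightarrow> complex"
  assumes compact_K: "compact K"
    and charts: "\<And>p. p \<in> K \<Longrightarrow> \<exists>U a c \<sigma>. open U \<and> p \<in> U \<and> a > 0 \<and> c 0 = p \<and> \<sigma> p = (0 :: real) \<and>
       (\<forall>t. \<bar>t\<bar> < a \<longrightarrow> c t \<in> K \<and> (c has_vector_derivative Y (c t)) (at t)) \<and>
       (\<forall>z\<in>U \<inter> K. \<bar>\<sigma> z\<bar> < a \<and> c (\<sigma> z) = z \<and> (\<exists>D. (\<sigma> has_derivative D) (at z) \<and> D (Y z) = 1))"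
begin

definition integral_curve :: "(real \<Rightarrow> complex) \<Rightarrow> real set \<Rightarrow> bool" where
  "integral_curve g I \<longleftrightarrow> (\<forall>t\<in>I. g t \<in> K \<and> (g has_vector_derivative Y (g t)) (at t))"

lemma integral_curve_continuous: "integral_curve g I \<Longrightarrow> continuous_on I g"
  unfolding integral_curve_def
  by (intro continuous_on_vector_derivative[of I g "\<lambda>t. Y (g t)"]) (auto intro: has_vector_derivative_at_within)

lemma integral_curve_subset: "integral_curve g I \<Longrightarrow> J \<subseteq> I \<Longrightarrow> integral_curve g J"
  by (auto simp: integral_curve_def)

lemma integral_curve_shift:
  assumes "integral_curve g I" "\<And>t. t \<in> J \<Longrightarrow> t + s \<in> I"
  shows "integral_curve (\<lambda>t. g (t + s)) J"
  unfolding integral_curve_def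
proof (intro ballI conjI)
  fix t assume t: "t \<in> J"
  show "g (t + s) \<in> K" using assms t by (auto simp: integral_curve_def)
  have 1: "((\<lambda>t. t + s) has_vector_derivative 1) (at t)" by (auto intro!: derivative_eq_intros)
  have 2: "(g has_vector_derivative Y (g (t + s))) (at (t + s))"
    using assms t by (auto simp: integral_curve_def)
  show "((\<lambda>t. g (t + s)) has_vector_derivative Y (g (t + s))) (at t)"
    using vector_diff_chain_at[OF 1 2] by (simp add: o_def)
qed

lemma integral_curve_cong:
  assumes "integral_curve g I" "open I" "\<And>t. t \<in> I \<Longrightarrow> h t = g t"
  shows "integral_curve h I"
  unfolding integral_curve_def
proof (intro ballI conjI)
  fix t assume t: "t \<in> I"
  show "h t \<in> K" using assms t by (simp add: integral_curve_def)
  have "(g has_vector_derivative Y (g t)) (at t)" using assms(1) t by (simp add: integral_curve_def)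
  then have "(h has_vector_derivative Y (g t)) (at t)"
    by (rule has_vector_derivative_transform_within_open[OF _ \<open>open I\<close> t]) (simp add: assms(3))
  then show "(h has_vector_derivative Y (h t)) (at t)" using assms(3)[OF t] by simp
qed

lemma chart_coordinate_along_integral_curve:
  assumes "open U" and \<sigma>: "\<And>z. z \<in> U \<inter> K \<Longrightarrow> \<exists>D. (\<sigma> has_derivative D) (at z) \<and> D (Y z) = (1 :: real)"
    and g: "integral_curve g I" "open I" "s \<in> I" "g s \<in> U"
  obtains e where "e > 0" "\<And>t. \<bar>t - s\<bar> < e \<Longrightarrow> t \<in> I \<and> g t \<in> U \<and> \<sigma> (g t) = \<sigma> (g s) + (t - s)"
proof -
  have "open (I \<inter> g -` U)"
    by (rule continuous_open_preimage[OF integral_curve_continuous[OF g(1)] g(2) \<open>open U\<close>])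
  then obtain e where e: "e > 0" "ball s e \<subseteq> I \<inter> g -` U" using g openE by blast
  have D: "((\<lambda>t. \<sigma> (g t) - t) has_real_derivative 0) (at t)" if t: "t \<in> ball s e" for t
  proof -
    have gt: "g t \<in> U \<inter> K" "(g has_vector_derivative Y (g t)) (at t)"
      using e(2) t g(1) by (auto simp: integral_curve_def)
    obtain D where D: "(\<sigma> has_derivative D) (at (g t))" "D (Y (g t)) = 1" using \<sigma>[OF gt(1)] by blast
    have "((\<sigma> \<circ> g) has_vector_derivative D (Y (g t))) (at t)"
      by (rule vector_derivative_diff_chain_within[OF gt(2) has_derivative_at_withinI[OF D(1)]])
    then have "((\<lambda>t. \<sigma> (g t)) has_real_derivative 1) (at t)"
      by (simp add: D(2) has_real_derivative_iff_has_vector_derivative o_def)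
    then show ?thesis by (auto intro!: derivative_eq_intros)
  qed
  then obtain k where k: "\<And>t. t \<in> ball s e \<Longrightarrow> \<sigma> (g t) - t = k"
    using has_field_derivative_zero_constant[OF convex_ball, of s e "\<lambda>t. \<sigma> (g t) - t"]
    by (metis has_field_derivative_at_within)
  show ?thesis
  proof (rule that[OF e(1)])
    fix t assume "\<bar>t - s\<bar> < e"
    then have t: "t \<in> ball s e" by (simp add: dist_real_def abs_minus_commute)
    moreover have "s \<in> ball s e" using e(1) by simp
    ultimately have "\<sigma> (g t) = \<sigma> (g s) + (t - s)" using k[of t] k[of s] by simp
    then show "t \<in> I \<and> g t \<in> U \<and> \<sigma> (g t) = \<sigma> (g s) + (t - s)" using e(2) t by auto
  qed
qed

text \<open>\<open>Y\<close> carries no Lipschitz condition. Instead, a chart coordinate advances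
  with unit speed along both curves, and a point of \<open>K\<close> in the chart is determined by
  its coordinate; so the set of agreement is open. It is closed by continuity.\<close>

lemma integral_curve_unique:
  assumes g: "integral_curve g I" and h: "integral_curve h I" and I: "open I" "connected I"
    and s: "s \<in> I" "g s = h s" and t: "t \<in> I"
  shows "g t = h t"
proof -
  define E where "E = {t \<in> I. g t = h t}"
  have "open E"
  proof (subst open_contains_ball, intro ballI)
    fix r assume r: "r \<in> E"
    then have rI: "r \<in> I" "h r = g r" "g r \<in> K" using g by (auto simp: E_def integral_curve_def)
    obtain U a c \<sigma> where ch: "open U" "g r \<in> U"
       "\<forall>z\<in>U \<inter> K. \<bar>\<sigma> z\<bar> < (a::real) \<and> c (\<sigma> z) = z \<and> (\<exists>D. (\<sigma> has_derivative D) (at z) \<and> D (Y z) = 1)"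
      using charts[OF rI(3)] by blast
    have \<sigma>: "\<exists>D. (\<sigma> has_derivative D) (at z) \<and> D (Y z) = 1" if "z \<in> U \<inter> K" for z using ch(3) that by blast
    obtain e1 where e1: "e1 > 0" "\<And>t. \<bar>t - r\<bar> < e1 \<Longrightarrow> t \<in> I \<and> g t \<in> U \<and> \<sigma> (g t) = \<sigma> (g r) + (t - r)"
      using chart_coordinate_along_integral_curve[OF ch(1) \<sigma> g I(1) rI(1) ch(2)] by blast
    obtain e2 where e2: "e2 > 0" "\<And>t. \<bar>t - r\<bar> < e2 \<Longrightarrow> t \<in> I \<and> h t \<in> U \<and> \<sigma> (h t) = \<sigma> (h r) + (t - r)"
      using chart_coordinate_along_integral_curve[OF ch(1) \<sigma> h I(1) rI(1)] ch(2) rI(2) by metis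
    have "ball r (min e1 e2) \<subseteq> E"
    proof
      fix t assume "t \<in> ball r (min e1 e2)"
      then have "\<bar>t - r\<bar> < e1" "\<bar>t - r\<bar> < e2" by (auto simp: dist_real_def abs_minus_commute)
      note t = e1(2)[OF this(1)] e2(2)[OF this(2)]
      have "g t \<in> K" "h t \<in> K" using t g h by (auto simp: integral_curve_def)
      then have "c (\<sigma> (g t)) = g t" "c (\<sigma> (h t)) = h t" using t ch(3) by blast+
      moreover have "\<sigma> (g t) = \<sigma> (h t)" using t rI(2) by simp
      ultimately show "t \<in> E" using t by (simp add: E_def)
    qed
    then show "\<exists>e>0. ball r e \<subseteq> E" using e1(1) e2(1) by (intro exI[of _ "min e1 e2"]) auto
  qed
  moreover have "open (I \<inter> (\<lambda>t. g t - h t) -` (- {0}))"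
    by (intro continuous_open_preimage I continuous_intros integral_curve_continuous g h)
  moreover have "E \<inter> (I \<inter> (\<lambda>t. g t - h t) -` (- {0})) \<inter> I = {}" "I \<subseteq> E \<union> (I \<inter> (\<lambda>t. g t - h t) -` (- {0}))"
    by (auto simp: E_def)
  ultimately have "E \<inter> I = {} \<or> (I \<inter> (\<lambda>t. g t - h t) -` (- {0})) \<inter> I = {}"
    using connectedD[OF I(2)] by blast
  moreover have "s \<in> E \<inter> I" using s by (simp add: E_def)
  ultimately show ?thesis using t by auto
qed

text \<open>The bound \<open>a / 4\<close> leaves room for time shifts: the chart curve restarted at
  \<sigma>(z) still lives on (-a/2, a/2). The bound \<open>e\<close> keeps such shifts short against
  a prescribed time.\<close>

lemma local_chart_ball:
  assumes p: "p \<in> K" and "e > 0"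
  obtains d a c \<sigma> where "d > 0" "a > (0 :: real)" "c 0 = p" "integral_curve c {-a<..<a}"
    "\<And>z. z \<in> K \<Longrightarrow> dist z p < d \<Longrightarrow> \<bar>\<sigma> z\<bar> < min e (a / 4) \<and> c (\<sigma> z) = z"
proof -
  obtain U a c \<sigma> where ch: "open U" "p \<in> U" "a > 0" "c 0 = p" "\<sigma> p = (0 :: real)"
       "\<forall>t. \<bar>t\<bar> < a \<longrightarrow> c t \<in> K \<and> (c has_vector_derivative Y (c t)) (at t)"
       "\<forall>z\<in>U \<inter> K. \<bar>\<sigma> z\<bar> < a \<and> c (\<sigma> z) = z \<and> (\<exists>D. (\<sigma> has_derivative D) (at z) \<and> D (Y z) = 1)"
    using charts[OF p] by blast
  have "\<exists>D. (\<sigma> has_derivative D) (at p)" using ch(2,7) p by blast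
  then have "isCont \<sigma> p" using has_derivative_continuous by blast
  moreover have "min e (a / 4) > 0" using ch(3) \<open>e > 0\<close> by simp
  ultimately obtain d1 where d1: "d1 > 0" "\<forall>z. dist z p < d1 \<longrightarrow> dist (\<sigma> z) (\<sigma> p) < min e (a / 4)"
    unfolding continuous_at_eps_delta by blast
  obtain d2 where d2: "d2 > 0" "ball p d2 \<subseteq> U" using ch(1,2) openE by blast
  show ?thesis
  proof (rule that[of "min d1 d2" a c \<sigma>])
    show "integral_curve c {-a<..<a}" using ch(6) by (auto simp: integral_curve_def abs_less_iff)
    fix z assume z: "z \<in> K" "dist z p < min d1 d2"
    then have "z \<in> U" using d2(2) by (auto simp: dist_commute)
    moreover have "dist (\<sigma> z) (\<sigma> p) < min e (a / 4)" using d1(2) z(2) by simp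
    ultimately show "\<bar>\<sigma> z\<bar> < min e (a / 4) \<and> c (\<sigma> z) = z"
      using ch(5,7) z(1) by (simp add: dist_real_def)
  qed (use d1 d2 ch in auto)
qed

section \<open>Curves with infinite forward lifetime\<close>

lemma uniform_existence:
  obtains a where "a > 0" "\<And>p. p \<in> K \<Longrightarrow> \<exists>c. integral_curve c {-a<..<a} \<and> c 0 = p"
proof -
  have "\<forall>p\<in>K. \<exists>d>0. \<exists>a>0. \<forall>q\<in>K. dist q p < d \<longrightarrow> (\<exists>c. integral_curve c {-a<..<a} \<and> c 0 = q)"
  proof
    fix p assume "p \<in> K"
    obtain d a c \<sigma> where ch: "d > 0" "a > (0 :: real)" "c 0 = p" "integral_curve c {-a<..<a}"
      "\<And>z. z \<in> K \<Longrightarrow> dist z p < d \<Longrightarrow> \<bar>\<sigma> z\<bar> < min 1 (a / 4) \<and> c (\<sigma> z) = z"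
      using local_chart_ball[OF \<open>p \<in> K\<close> zero_less_one] by blast
    have "\<exists>c. integral_curve c {-(a/2)<..<a/2} \<and> c 0 = q" if q: "q \<in> K" "dist q p < d" for q
    proof (intro exI[of _ "\<lambda>t. c (t + \<sigma> q)"] conjI)
      have "\<bar>\<sigma> q\<bar> < a / 4" "c (\<sigma> q) = q" using ch(5)[OF q] by auto
      then show "integral_curve (\<lambda>t. c (t + \<sigma> q)) {-(a/2)<..<a/2}" "c (0 + \<sigma> q) = q"
        by (auto intro!: integral_curve_shift[OF ch(4)])
    qed
    then show "\<exists>d>0. \<exists>a>0. \<forall>q\<in>K. dist q p < d \<longrightarrow> (\<exists>c. integral_curve c {-a<..<a} \<and> c 0 = q)"
      using ch(1,2) by (intro exI[of _ d] conjI exI[of _ "a / 2"]) auto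
  qed
  then obtain d a where da: "\<And>p. p \<in> K \<Longrightarrow> d p > 0" "\<And>p. p \<in> K \<Longrightarrow> a p > 0"
    "\<And>p q. p \<in> K \<Longrightarrow> q \<in> K \<Longrightarrow> dist q p < d p \<Longrightarrow> \<exists>c. integral_curve c {-a p<..<a p} \<and> c 0 = q"
    by metis
  have "K \<subseteq> (\<Union>p\<in>K. ball p (d p))" using da(1) by force
  then obtain F where F: "F \<subseteq> K" "finite F" "K \<subseteq> (\<Union>p\<in>F. ball p (d p))"
    using compactE_image[OF compact_K, of K "\<lambda>p. ball p (d p)"] by (metis open_ball)
  define a0 where "a0 = Min (insert 1 (a ` F))"
  show ?thesis
  proof (rule that[of a0])
    show "a0 > 0" unfolding a0_def using F da(2) by (subst Min_gr_iff) auto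
    fix q assume "q \<in> K"
    then obtain p where p: "p \<in> F" "dist q p < d p" using F(3) by (auto simp: dist_commute)
    then obtain c where c: "integral_curve c {-a p<..<a p}" "c 0 = q" using da(3) F(1) \<open>q \<in> K\<close> by blast
    have "a0 \<le> a p" unfolding a0_def using F p by (intro Min_le) auto
    then have "{-a0<..<a0} \<subseteq> {-a p<..<a p}" by auto
    with c show "\<exists>c. integral_curve c {-a0<..<a0} \<and> c 0 = q" using integral_curve_subset by blast
  qed
qed

text \<open>A curve of lifetime \<open>a\<close> started at time \<open>T - a / 2\<close> reaches
  \<open>a / 2\<close> beyond \<open>T\<close>. The gain does not depend on \<open>T\<close>, so
  iteration covers all forward times.\<close>

lemma forward_extension:
  assumes "a > 0" and ex: "\<And>p. p \<in> K \<Longrightarrow> \<exists>c. integral_curve c {-a<..<a} \<and> c 0 = p"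
    and g: "integral_curve g {-a<..<T}" and "T \<ge> a"
  obtains h where "integral_curve h {-a<..<T + a / 2}" "\<And>t. t \<in> {-a<..<T} \<Longrightarrow> h t = g t"
proof -
  define S where "S = T - a / 2"
  have "g S \<in> K" using g \<open>T \<ge> a\<close> \<open>a > 0\<close> by (auto simp: integral_curve_def S_def)
  then obtain c where c: "integral_curve c {-a<..<a}" "c 0 = g S" using ex by blast
  define k where "k t = c (t + - S)" for t
  have k: "integral_curve k {S - a<..<S + a}"
    unfolding k_def[abs_def] by (rule integral_curve_shift[OF c(1)]) auto
  have agree: "k t = g t" if "S - a < t" "t < T" for t
    by (rule integral_curve_unique[of k "{S - a<..<T}" g S])
       (use that \<open>T \<ge> a\<close> \<open>a > 0\<close> c(2) in \<open>auto intro: integral_curve_subset[OF k] integral_curve_subset[OF g] simp: S_def k_def\<close>)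
  define h where "h t = (if t < T then g t else k t)" for t
  have hg: "h t = g t" if "t \<in> {-a<..<T}" for t using that by (simp add: h_def)
  have hk: "h t = k t" if "t \<in> {S - a<..<S + a}" for t using that agree by (auto simp: h_def)
  have "integral_curve h {-a<..<T}" by (rule integral_curve_cong[OF g _ hg]) auto
  moreover have "integral_curve h {S - a<..<S + a}" by (rule integral_curve_cong[OF k _ hk]) auto
  moreover have "{-a<..<T + a / 2} \<subseteq> {-a<..<T} \<union> {S - a<..<S + a}"
    using \<open>a > 0\<close> by (auto simp: S_def)
  ultimately have "integral_curve h {-a<..<T + a / 2}" unfolding integral_curve_def by blast
  then show ?thesis using hg by (rule that)
qed

text \<open>Forward times suffice because recurrence will close the orbit; the margin
  \<open>-a\<close> makes 0 an interior time, where derivatives and uniqueness apply.\<close>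

lemma forward_integral_curve:
  assumes p: "p \<in> K"
  obtains a g where "a > (0 :: real)" "integral_curve g {-a<..}" "g 0 = p"
proof -
  obtain a where a: "a > 0" "\<And>p. p \<in> K \<Longrightarrow> \<exists>c. integral_curve c {-a<..<a} \<and> c 0 = p"
    using uniform_existence by blast
  have "\<exists>g. integral_curve g {-a<..<a + real n * (a / 2)} \<and> g 0 = p" for n
  proof (induction n)
    case 0
    then show ?case using a(2)[OF p] by simp
  next
    case (Suc n)
    then obtain g where g: "integral_curve g {-a<..<a + real n * (a / 2)}" "g 0 = p" by blast
    obtain h where "integral_curve h {-a<..<a + real n * (a / 2) + a / 2}" "\<And>t. t \<in> {-a<..<a + real n * (a / 2)} \<Longrightarrow> h t = g t"
      using forward_extension[OF a g(1)] a(1) by auto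
    moreover from this have "h 0 = p" using g(2) a(1) by (simp add: add_pos_nonneg)
    moreover have "a + real (Suc n) * (a / 2) = a + real n * (a / 2) + a / 2" by (simp add: field_simps)
    ultimately show ?case by (intro exI[of _ h]) (simp only: simp_thms)
  qed
  then obtain G where G: "\<And>n. integral_curve (G n) {-a<..<a + real n * (a / 2)}" "\<And>n. G n 0 = p" by metis
  have agree: "G n t = G m t" if "n \<le> m" "-a < t" "t < a + real n * (a / 2)" for n m t
  proof (rule integral_curve_unique[of "G n" "{-a<..<a + real n * (a / 2)}" "G m" 0 t])
    have "real n * (a / 2) \<le> real m * (a / 2)" using that(1) a(1) by (intro mult_right_mono) auto
    then show "integral_curve (G m) {-a<..<a + real n * (a / 2)}"
      by (intro integral_curve_subset[OF G(1)]) auto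
  qed (use G that a(1) in \<open>auto intro: add_pos_nonneg\<close>)
  define N where "N t = nat \<lceil>2 * \<bar>t\<bar> / a\<rceil>" for t
  have N: "t < a + real (N t) * (a / 2)" for t
  proof -
    have "2 * \<bar>t\<bar> / a \<le> real (N t)" unfolding N_def by (rule real_nat_ceiling_ge)
    then have "\<bar>t\<bar> \<le> real (N t) * (a / 2)" using a(1) by (simp add: field_simps)
    then show ?thesis using a(1) by linarith
  qed
  define g where "g t = G (N t) t" for t
  have gG: "g t = G n t" if "t \<in> {-a<..<a + real n * (a / 2)}" for n t
  proof (cases "n \<le> N t")
    case True
    then show ?thesis using agree[OF True] that by (simp add: g_def)
  next
    case False
    then show ?thesis using agree[of "N t" n t] N[of t] that by (simp add: g_def)
  qed
  have g: "integral_curve g {-a<..}"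
  proof -
    have "integral_curve g {-a<..<a + real n * (a / 2)}" for n
      by (rule integral_curve_cong[OF G(1) _ gG]) auto
    moreover have "t \<in> {-a<..<a + real (N t) * (a / 2)}" if "t \<in> {-a<..}" for t using N[of t] that by simp
    ultimately show ?thesis unfolding integral_curve_def by blast
  qed
  have "g 0 = p" using G(2) by (simp add: g_def)
  with a(1) g show ?thesis by (rule that)
qed

section \<open>Closed orbits\<close>

lemma integral_curve_translate_eq:
  assumes g: "integral_curve g {-a<..}" and "P \<ge> 0" and s: "s > -a" "g (s + P) = g s" and t: "t > -a"
  shows "g (t + P) = g t"
  by (rule integral_curve_unique[of "\<lambda>t. g (t + P)" "{-a<..}" g s])
     (use assms in \<open>auto intro!: integral_curve_shift[OF g]\<close>)

text \<open>By compactness, two integer times \<open>t1 < t2\<close> land in one chart, hence on one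
  chart curve, at parameters \<open>x\<close> and \<open>y\<close>. Following it for time
  \<open>x - y\<close> after \<open>t2\<close> leads back to the point at time \<open>t1\<close>. As
  |x| and |y| are below 1/4 and \<open>t2 - t1 \<ge> 1\<close>, the resulting period is positive;
  uniqueness carries it to time 0.\<close>

lemma integral_curve_returns:
  assumes a: "a > 0" and g: "integral_curve g {-a<..}"
  obtains P where "P > 0" "g P = g 0"
proof -
  have gK: "g t \<in> K" if "t > -a" for t using g that by (simp add: integral_curve_def)
  have "seq_compact K" using compact_K compact_imp_seq_compact by blast
  moreover have "\<forall>n. g (real (Suc n)) \<in> K" using gK a by (auto intro: less_trans[of _ 0])
  ultimately obtain q r where q: "q \<in> K" "strict_mono r" "((\<lambda>n. g (real (Suc n))) \<circ> r) \<longlonglongrightarrow> q"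
    unfolding seq_compact_def by (metis (no_types, lifting))
  obtain d b c \<sigma> where ch: "d > 0" "b > (0 :: real)" "c 0 = q" "integral_curve c {-b<..<b}"
    "\<And>z. z \<in> K \<Longrightarrow> dist z q < d \<Longrightarrow> \<bar>\<sigma> z\<bar> < min (1/4) (b / 4) \<and> c (\<sigma> z) = z"
    using local_chart_ball[OF q(1), of "1/4"] by (metis zero_less_divide_1_iff zero_less_numeral)
  obtain n0 where n0: "\<And>n. n \<ge> n0 \<Longrightarrow> dist (g (real (Suc (r n)))) q < d"
    using q(3) ch(1) unfolding lim_sequentially o_def by blast
  define t1 where "t1 = real (Suc (r n0))"
  define t2 where "t2 = real (Suc (r (Suc n0)))"
  have "r n0 < r (Suc n0)" using q(2) by (simp add: strict_mono_def)
  then have t: "t1 > 0" "t2 \<ge> t1 + 1" by (auto simp: t1_def t2_def)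
  define x where "x = \<sigma> (g t1)"
  define y where "y = \<sigma> (g t2)"
  have "dist (g t1) q < d" "dist (g t2) q < d" unfolding t1_def t2_def by (rule n0; simp)+
  then have xy: "\<bar>x\<bar> < min (1/4) (b / 4)" "c x = g t1" "\<bar>y\<bar> < min (1/4) (b / 4)" "c y = g t2"
    unfolding x_def y_def using ch(5) gK t a by auto
  define I where "I = {-(min 1 b / 2)<..<min 1 b / 2}"
  have "g ((x - y) + t2) = c ((x - y) + y)"
  proof (rule integral_curve_unique[of "\<lambda>s. g (s + t2)" I "\<lambda>s. c (s + y)" 0])
    show "integral_curve (\<lambda>s. g (s + t2)) I"
      by (rule integral_curve_shift[OF g]) (use t a in \<open>auto simp: I_def\<close>)
    show "integral_curve (\<lambda>s. c (s + y)) I"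
      by (rule integral_curve_shift[OF ch(4)]) (use xy(3) in \<open>auto simp: I_def\<close>)
    show "open I" "connected I" "0 \<in> I" "x - y \<in> I" using ch(2) xy by (auto simp: I_def)
    show "g (0 + t2) = c (0 + y)" using xy by simp
  qed
  then have ret: "g (t1 + (t2 - t1 + (x - y))) = g t1" using xy by (simp add: algebra_simps)
  define P where "P = t2 - t1 + (x - y)"
  have "P > 0" using t(2) xy by (auto simp: P_def)
  moreover have "g (0 + P) = g 0"
    by (rule integral_curve_translate_eq[OF g, of P t1]) (use \<open>P > 0\<close> ret t(1) a in \<open>auto simp: P_def\<close>)
  ultimately show ?thesis by (intro that[of P]) auto
qed

text \<open>The chart coordinate grows at unit speed near time 0, so there is no return before some
  \<open>e > 0\<close>. The return times from \<open>e\<close> on form a closed set, which contains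
  its infimum.\<close>

lemma integral_curve_least_period:
  assumes a: "a > 0" and g: "integral_curve g {-a<..}"
  obtains P where "P > 0" "g P = g 0" "\<And>t. t > 0 \<Longrightarrow> g t = g 0 \<Longrightarrow> P \<le> t"
proof -
  have "g 0 \<in> K" using g a by (simp add: integral_curve_def)
  obtain U b c \<sigma> where ch: "open U" "g 0 \<in> U"
     "\<forall>z\<in>U \<inter> K. \<bar>\<sigma> z\<bar> < (b::real) \<and> c (\<sigma> z) = z \<and> (\<exists>D. (\<sigma> has_derivative D) (at z) \<and> D (Y z) = 1)"
    using charts[OF \<open>g 0 \<in> K\<close>] by blast
  have \<sigma>: "\<exists>D. (\<sigma> has_derivative D) (at z) \<and> D (Y z) = 1" if "z \<in> U \<inter> K" for z using ch(3) that by blast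
  have "0 \<in> {-a<..}" using a by simp
  then obtain e where e: "e > 0" "\<And>t. \<bar>t - 0\<bar> < e \<Longrightarrow> t \<in> {-a<..} \<and> g t \<in> U \<and> \<sigma> (g t) = \<sigma> (g 0) + (t - 0)"
    using chart_coordinate_along_integral_curve[OF ch(1) \<sigma> g open_greaterThan _ ch(2)] by blast
  have ge_e: "t \<ge> e" if "t > 0" "g t = g 0" for t
    using e(2)[of t] that by force
  define S where "S = {e..} \<inter> g -` {g 0}"
  have "continuous_on {e..} g"
    using integral_curve_continuous[OF g] by (rule continuous_on_subset) (use e(1) a in auto)
  then have "closed S" unfolding S_def by (intro continuous_closed_preimage) auto
  moreover obtain P0 where "P0 > 0" "g P0 = g 0" using integral_curve_returns[OF a g] by blast
  then have "S \<noteq> {}" using ge_e by (auto simp: S_def)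
  moreover have "bdd_below S" by (auto simp: S_def bdd_below_def)
  ultimately have "Inf S \<in> S" using closed_contains_Inf by blast
  moreover have "Inf S \<le> t" if "t > 0" "g t = g 0" for t
    using ge_e[OF that] that \<open>bdd_below S\<close> by (intro cInf_lower) (auto simp: S_def)
  ultimately show ?thesis using e(1) by (intro that[of "Inf S"]) (auto simp: S_def)
qed

text \<open>Minimality of the period makes the loop simple. The last conclusion, relative openness
  in \<open>K\<close>, holds because a chart around a point of the orbit exhibits all nearby points
  of \<open>K\<close> as lying on that orbit; it yields finiteness by compactness.\<close>

lemma simple_loop_through_point:
  assumes p: "p \<in> K"
  obtains h W where "simple_path h" "pathfinish h = pathstart h" "p \<in> path_image h" 
    "open W" "path_image h = W \<inter> K"
proof -
  obtain a g where a: "a > (0 :: real)" and g: "integral_curve g {-a<..}" "g 0 = p"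
    using forward_integral_curve[OF p] by blast
  obtain P where P: "P > 0" "g P = g 0" "\<And>t. t > 0 \<Longrightarrow> g t = g 0 \<Longrightarrow> P \<le> t"
    using integral_curve_least_period[OF a g(1)] by blast
  have gK: "g t \<in> K" if "t > -a" for t using g(1) that by (simp add: integral_curve_def)
  have per: "g (t + P) = g t" if "t > -a" for t
    by (rule integral_curve_translate_eq[OF g(1), of P 0]) (use P a that in auto)
  have per_nat: "g (t + real n * P) = g t" if "t \<ge> 0" for t n
  proof (induction n)
    case (Suc n)
    have "t + real n * P > -a" using that a P(1) by (smt (verit) mult_nonneg_nonneg of_nat_0_le_iff)
    from per[OF this] Suc show ?case by (simp add: algebra_simps)
  qed simp
  define h where "h s = g (P * s)" for s
  have img: "path_image h = g ` {0..P}"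
  proof -
    have "(\<lambda>s. P * s) ` {0..1} = {0..P}" using P(1) image_mult_atLeastAtMost[of P 0 1] by simp
    then show ?thesis unfolding path_image_def h_def by (metis image_image)
  qed
  have in_img: "g t \<in> path_image h" if "t \<ge> 0" for t
  proof -
    define n where "n = nat \<lfloor>t / P\<rfloor>"
    have n: "real n \<le> t / P" "t / P < real n + 1" using that P(1) unfolding n_def by (auto simp: of_nat_nat)
    then have "0 \<le> t - real n * P" "t - real n * P \<le> P" using P(1) by (auto simp: field_simps)
    moreover from this have "g t = g (t - real n * P)" using per_nat[of "t - real n * P" n] by simp
    ultimately show ?thesis unfolding img by auto
  qed
  have "continuous_on {0..1} h"
    unfolding h_def using a P(1)
    by (intro continuous_on_compose2[OF integral_curve_continuous[OF g(1)]] continuous_intros)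
       (auto intro: less_le_trans[of _ 0])
  moreover have "x = 0 \<and> y = 1" if xy: "x \<in> {0..1}" "y \<in> {0..1}" "h x = h y" "x < y" for x y
  proof -
    have pos: "P * (y - x) > 0" using P(1) xy by simp
    have "g (P * x + P * (y - x)) = g (P * x)" using xy(3) by (simp add: h_def algebra_simps)
    moreover have "P * x > - a" using a P(1) xy(1) by (auto intro: less_le_trans[of _ 0])
    ultimately have "g (0 + P * (y - x)) = g 0"
      using integral_curve_translate_eq[OF g(1), of "P * (y - x)" "P * x" 0] pos a by simp
    then have "P \<le> P * (y - x)" using P(3)[OF pos] by simp
    then have "1 \<le> y - x" using P(1) by simp
    with xy show ?thesis by auto
  qed
  ultimately have "simple_path h"
    unfolding simple_path_def loop_free_def path_def by (metis linorder_neqE_linordered_idom)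
  moreover have "pathfinish h = pathstart h" using P(2) by (simp add: pathfinish_def pathstart_def h_def)
  moreover have "p \<in> path_image h" using in_img[of 0] g(2) by simp
  moreover have "\<exists>d>0. ball q d \<inter> K \<subseteq> path_image h" if q: "q \<in> path_image h" for q
  proof -
    obtain t where t: "0 \<le> t" "t \<le> P" "q = g t" using q unfolding img by auto
    have "q \<in> K" using gK[of t] t a by simp
    then obtain d b c \<sigma> where ch: "d > 0" "b > (0 :: real)" "c 0 = q" "integral_curve c {-b<..<b}"
      "\<And>z. z \<in> K \<Longrightarrow> dist z q < d \<Longrightarrow> \<bar>\<sigma> z\<bar> < min P (b / 4) \<and> c (\<sigma> z) = z"
      using local_chart_ball[OF _ P(1)] by blast
    have "z \<in> path_image h" if z: "z \<in> ball q d" "z \<in> K" for z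
    proof -
      have \<sigma>z: "\<bar>\<sigma> z\<bar> < P" "\<bar>\<sigma> z\<bar> < b" "c (\<sigma> z) = z" using ch(5)[OF z(2)] z(1) ch(2) by (auto simp: dist_commute)
      define I where "I = {-(min P b)<..<min P b}"
      \<comment> \<open>The additional period keeps the time nonnegative although the shift
        \<sigma>(z) may be negative.\<close>
      have "g (\<sigma> z + (t + P)) = c (\<sigma> z)"
      proof (rule integral_curve_unique[of "\<lambda>s. g (s + (t + P))" I c 0])
        show "integral_curve (\<lambda>s. g (s + (t + P))) I"
          by (rule integral_curve_shift[OF g(1)]) (use t a in \<open>auto simp: I_def\<close>)
        show "integral_curve c I" by (rule integral_curve_subset[OF ch(4)]) (auto simp: I_def)
        show "open I" "connected I" "0 \<in> I" "\<sigma> z \<in> I" using ch(2) \<sigma>z P(1) by (auto simp: I_def)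
        show "g (0 + (t + P)) = c 0" using per[of t] t a ch(3) by simp
      qed
      moreover have "\<sigma> z + (t + P) \<ge> 0" using \<sigma>z(1) t(1) by linarith
      ultimately show ?thesis using in_img \<sigma>z(3) by metis
    qed
    then show ?thesis using ch(1) by blast
  qed
  then obtain d where d: "\<And>q. q \<in> path_image h \<Longrightarrow> d q > 0 \<and> ball q (d q) \<inter> K \<subseteq> path_image h" by metis
  moreover have "path_image h = (\<Union>q\<in>path_image h. ball q (d q)) \<inter> K"
  proof
    have "path_image h \<subseteq> K" unfolding img using gK a by auto
    then show "path_image h \<subseteq> (\<Union>q\<in>path_image h. ball q (d q)) \<inter> K" using d by force
    show "(\<Union>q\<in>path_image h. ball q (d q)) \<inter> K \<subseteq> path_image h" using d by blast
  qed
  moreover have "open (\<Union>q\<in>path_image h. ball q (d q))" by blast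
  ultimately show ?thesis by (intro that[of h "\<Union>q\<in>path_image h. ball q (d q)"])
qed

theorem finite_union_of_simple_loops:
  obtains \<Gamma> where "finite \<Gamma>" "\<And>h. h \<in> \<Gamma> \<Longrightarrow> simple_path h \<and> pathfinish h = pathstart h"
    "K = (\<Union>h\<in>\<Gamma>. path_image h)"
proof -
  have "\<forall>p\<in>K. \<exists>h W. simple_path h \<and> pathfinish h = pathstart h \<and> p \<in> path_image h \<and> open W \<and> path_image h = W \<inter> K"
    using simple_loop_through_point by metis
  then obtain h W where hW: "\<And>p. p \<in> K \<Longrightarrow> simple_path (h p) \<and> pathfinish (h p) = pathstart (h p) \<and> 
      p \<in> path_image (h p) \<and> open (W p) \<and> path_image (h p) = W p \<inter> K" by metis
  have "K \<subseteq> (\<Union>p\<in>K. W p)" using hW by blast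
  then obtain F where F: "F \<subseteq> K" "finite F" "K \<subseteq> (\<Union>p\<in>F. W p)"
    using compactE_image[OF compact_K, of K W] hW by metis
  show ?thesis
  proof (rule that[of "h ` F"])
    show "K = (\<Union>h\<in>h ` F. path_image h)"
    proof
      show "K \<subseteq> (\<Union>h\<in>h ` F. path_image h)"
      proof
        fix z assume "z \<in> K"
        then obtain p where "p \<in> F" "z \<in> W p" using F(3) by blast
        then show "z \<in> (\<Union>h\<in>h ` F. path_image h)" using hW[of p] F(1) \<open>z \<in> K\<close> by auto
      qed
      show "(\<Union>h\<in>h ` F. path_image h) \<subseteq> K" using hW F(1) by auto
    qed
  qed (use F hW in auto)
qed

end

section \<open>The frontier in the cylinder\<close>

context periodic_overdetermined
begin

lemma closure_inv_int: "z + of_int k * \<tau> \<in> closure \<Omega> \<longleftrightarrow> z \<in> closure \<Omega>"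
  by (rule closure_translation_invariant) (rule inv_int)

lemma frontier_inv_int: "z + of_int k * \<tau> \<in> frontier \<Omega> \<longleftrightarrow> z \<in> frontier \<Omega>"
  using closure_inv_int[of z k] inv_int[of z k] open_dom by (simp add: frontier_def interior_open)

lemma f_periodic_int_closure:
  assumes "z \<in> closure \<Omega>"
  shows "f (z + of_int k * \<tau>) = f z"
proof -
  have "continuous_on (closure \<Omega>) (\<lambda>z. f (z + of_int k * \<tau>) - f z)"
    by (intro continuous_intros cont_f continuous_on_compose2[OF cont_f]) (use closure_inv_int in auto)
  then have "f (z + of_int k * \<tau>) - f z = 0"
    by (rule continuous_constant_on_closure) (use f_periodic_int assms in auto)
  then show ?thesis by simp
qed

lemma frontier_inv_cyl:
  assumes "cyl \<tau> z \<in> cyl \<tau> ` frontier \<Omega>"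
  shows "z \<in> frontier \<Omega>"
proof -
  obtain w where w: "w \<in> frontier \<Omega>" "cyl \<tau> z = cyl \<tau> w" using assms by blast
  obtain k :: int where "z = w + of_int k * \<tau>" using cyl_eqD[OF \<tau>_nonzero w(2)] .
  then show ?thesis using w(1) frontier_inv_int by simp
qed

lemma f_eq_if_cyl_eq_frontier:
  assumes "cyl \<tau> z = cyl \<tau> w" "w \<in> frontier \<Omega>"
  shows "f z = f w"
proof -
  obtain k :: int where "z = w + of_int k * \<tau>" using cyl_eqD[OF \<tau>_nonzero assms(1)] .
  then show ?thesis using f_periodic_int_closure[of w k] assms(2) by (simp add: frontier_def)
qed

lemma compact_cyl_frontier:
  assumes strip: "\<And>z. z \<in> frontier \<Omega> \<Longrightarrow> \<bar>Im (z / \<tau>)\<bar> < R"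
  shows "compact (cyl \<tau> ` frontier \<Omega>)"
proof -
  define Q where "Q = (\<lambda>(x, y). \<tau> * Complex x y) ` ({0..1} \<times> {-R..R})"
  have "continuous_on S (\<lambda>(x, y). \<tau> * Complex x y)" for S
    unfolding Complex_eq case_prod_beta by (intro continuous_intros)
  then have "compact Q" unfolding Q_def by (intro compact_continuous_image compact_Times) auto
  then have "compact (Q \<inter> frontier \<Omega>)" by (rule compact_Int_closed[OF _ frontier_closed])
  moreover have "continuous_on S (cyl \<tau>)" for S
    unfolding cyl_def using \<tau>_nonzero by (intro continuous_intros) auto
  ultimately have "compact (cyl \<tau> ` (Q \<inter> frontier \<Omega>))" by (intro compact_continuous_image)
  moreover have "cyl \<tau> z \<in> cyl \<tau> ` (Q \<inter> frontier \<Omega>)" if z: "z \<in> frontier \<Omega>" for z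
  proof -
    let ?k = "\<lfloor>Re (z / \<tau>)\<rfloor>"
    define w where "w = \<tau> * Complex (frac (Re (z / \<tau>))) (Im (z / \<tau>))"
    have zw: "z = w + of_int ?k * \<tau>"
      by (subst Im_eqD[OF refl, of z]) (simp add: w_def Complex_eq frac_def algebra_simps)
    then have "w \<in> frontier \<Omega>" using z frontier_inv_int[of w ?k] by simp
    moreover have "w \<in> Q"
      unfolding w_def Q_def using strip[OF z]
      by (intro image_eqI[of _ _ "(frac (Re (z / \<tau>)), Im (z / \<tau>))"]) (auto simp: frac_lt_1 less_imp_le)
    moreover have "cyl \<tau> z = cyl \<tau> w"
    proof -
      have "2 * of_real pi * \<i> * z / \<tau> = 2 * of_real pi * \<i> * w / \<tau> + of_real (of_int (2 * ?k) * pi) * \<i>"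
        by (subst zw) (use \<tau>_nonzero in \<open>simp add: field_simps\<close>)
      then show ?thesis unfolding cyl_def exp_eq by blast
    qed
    ultimately show ?thesis by blast
  qed
  ultimately show ?thesis by (metis (no_types, lifting) Int_lower2 image_mono image_subsetI subset_antisym)
qed

text \<open>The field is the image of \<open>\<i> * cnj f\<close>, that is of i\<nabla>u, under
  \<open>cyl\<close>, whose derivative is 2\<pi>i/\<tau> times itself. \<open>Ln\<close> picks some
  preimage, and periodicity of \<open>f\<close> on the frontier makes the choice irrelevant. The
  charts are arclength charts transported by \<open>cyl\<close>.\<close>

lemma compact_flow_cyl_frontier:
  assumes "smooth_domain \<Omega>" and strip: "\<And>z. z \<in> frontier \<Omega> \<Longrightarrow> \<bar>Im (z / \<tau>)\<bar> < R"
  shows "compact_flow (cyl \<tau> ` frontier \<Omega>) 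
    (\<lambda>w. 2 * of_real pi * \<i> / \<tau> * w * (\<i> * cnj (f (\<tau> / (2 * of_real pi * \<i>) * Ln w))))"
    (is "compact_flow ?K ?Y")
proof
  show "compact ?K" by (rule compact_cyl_frontier[OF strip])
  define \<kappa> where "\<kappa> = 2 * of_real pi * \<i> / \<tau>"
  have \<kappa>: "\<kappa> \<noteq> 0" "\<tau> / (2 * of_real pi * \<i>) = 1 / \<kappa>" using \<tau>_nonzero by (auto simp: \<kappa>_def)
  have cyl_\<kappa>: "cyl \<tau> z = exp (\<kappa> * z)" for z by (simp add: cyl_def \<kappa>_def)
  have Y: "?Y (cyl \<tau> z) = \<kappa> * cyl \<tau> z * (\<i> * cnj (f z))" if "z \<in> frontier \<Omega>" for z
    using f_eq_if_cyl_eq_frontier[OF cyl_Ln[OF \<tau>_nonzero cyl_nonzero] that] by (simp add: \<kappa>_def)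
  fix p assume "p \<in> ?K"
  then obtain z0 where z0: "z0 \<in> frontier \<Omega>" "p = cyl \<tau> z0" by blast
  have p0: "p \<noteq> 0" by (simp add: z0)
  obtain U a c \<sigma> where ch: "open U" "z0 \<in> U" "a > (0 :: real)" "c 0 = z0" "\<sigma> z0 = (0 :: real)"
    "\<And>t. \<bar>t\<bar> < a \<Longrightarrow> c t \<in> frontier \<Omega> \<and> (c has_vector_derivative \<i> * cnj (f (c t))) (at t)"
    "\<And>z. z \<in> U \<inter> frontier \<Omega> \<Longrightarrow> \<bar>\<sigma> z\<bar> < a \<and> c (\<sigma> z) = z \<and>
        (\<exists>D. (\<sigma> has_derivative D) (at z) \<and> D (\<i> * cnj (f z)) = 1)"
    using arclength_chart[OF assms(1) z0(1)] by blast
  define V where "V = {w. Re (w / p) > 0}"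
  \<comment> \<open>The branch of the inverse of \<open>cyl\<close> through \<open>z0\<close>, on a
    half-plane \<open>V\<close> around \<open>p\<close> that avoids the cut.\<close>
  define G where "G w = z0 + Ln (w / p) / \<kappa>" for w
  have "open V" unfolding V_def using p0 by (intro open_Collect_less continuous_intros) auto
  have V_nz: "w / p \<noteq> 0 \<and> w / p \<notin> \<real>\<^sub>\<le>\<^sub>0 \<and> w \<noteq> 0" if "w \<in> V" for w
    using that p0 by (auto simp: V_def complex_nonpos_Reals_iff)
  have cyl_G: "cyl \<tau> (G w) = w" if "w \<in> V" for w
  proof -
    have "\<kappa> * G w = \<kappa> * z0 + Ln (w / p)" using \<kappa> by (simp add: G_def distrib_left)
    then have "cyl \<tau> (G w) = exp (\<kappa> * z0) * exp (Ln (w / p))" by (simp add: cyl_\<kappa> exp_add)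
    also have "\<dots> = p * (w / p)" using V_nz[OF that] by (simp add: z0(2) cyl_\<kappa>)
    finally show ?thesis using p0 by simp
  qed
  have DG: "(G has_field_derivative 1 / (\<kappa> * w)) (at w)" if "w \<in> V" for w
    unfolding G_def using V_nz[OF that] p0 \<kappa>(1)
    by (auto intro!: derivative_eq_intros simp: field_simps)
  have "continuous_on V G" using DG by (intro DERIV_continuous_on[of _ G "\<lambda>w. 1 / (\<kappa> * w)"]) (auto intro: has_field_derivative_at_within)
  then have "open (V \<inter> G -` U)" by (rule continuous_open_preimage[OF _ \<open>open V\<close> ch(1)])
  moreover have "p \<in> V \<inter> G -` U" using p0 ch(2) by (simp add: V_def G_def)
  moreover have "cyl \<tau> (c t) \<in> ?K \<and> ((\<lambda>t. cyl \<tau> (c t)) has_vector_derivative ?Y (cyl \<tau> (c t))) (at t)"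
    if t: "\<bar>t\<bar> < a" for t
  proof
    note ct = ch(6)[OF t]
    show "cyl \<tau> (c t) \<in> ?K" using ct by blast
    have "(cyl \<tau> has_field_derivative \<kappa> * cyl \<tau> (c t)) (at (c t))"
      unfolding cyl_\<kappa>[abs_def] by (auto intro!: derivative_eq_intros)
    from field_vector_diff_chain_at[OF conjunct2[OF ct] this]
    show "((\<lambda>t. cyl \<tau> (c t)) has_vector_derivative ?Y (cyl \<tau> (c t))) (at t)"
      unfolding Y[OF conjunct1[OF ct]] by (simp add: o_def mult_ac)
  qed
  moreover have "\<bar>\<sigma> (G w)\<bar> < a \<and> cyl \<tau> (c (\<sigma> (G w))) = w \<and>
      (\<exists>D. ((\<lambda>w. \<sigma> (G w)) has_derivative D) (at w) \<and> D (?Y w) = 1)" if w: "w \<in> (V \<inter> G -` U) \<inter> ?K" for w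
  proof -
    have wV: "w \<in> V" using w by blast
    have Gw: "G w \<in> U \<inter> frontier \<Omega>" using w frontier_inv_cyl[of "G w"] cyl_G[OF wV] by auto
    from ch(7)[OF this] obtain D where D: "\<bar>\<sigma> (G w)\<bar> < a" "c (\<sigma> (G w)) = G w"
      "(\<sigma> has_derivative D) (at (G w))" "D (\<i> * cnj (f (G w))) = 1" by blast
    have "(G has_derivative (\<lambda>h. 1 / (\<kappa> * w) * h)) (at w)"
      using DG[OF wV] unfolding has_field_derivative_def .
    from has_derivative_compose[OF this D(3)]
    have "((\<lambda>w. \<sigma> (G w)) has_derivative (\<lambda>h. D (1 / (\<kappa> * w) * h))) (at w)" .
    moreover have "1 / (\<kappa> * w) * ?Y w = \<i> * cnj (f (G w))"
      using Y[of "G w"] Gw cyl_G[OF wV] V_nz[OF wV] \<kappa>(1) by simp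
    ultimately show ?thesis using D cyl_G[OF wV] by metis
  qed
  ultimately show "\<exists>U a c \<sigma>. open U \<and> p \<in> U \<and> a > 0 \<and> c 0 = p \<and> \<sigma> p = (0 :: real) \<and>
       (\<forall>t. \<bar>t\<bar> < a \<longrightarrow> c t \<in> ?K \<and> (c has_vector_derivative ?Y (c t)) (at t)) \<and>
       (\<forall>z\<in>U \<inter> ?K. \<bar>\<sigma> z\<bar> < a \<and> c (\<sigma> z) = z \<and> (\<exists>D. (\<sigma> has_derivative D) (at z) \<and> D (?Y z) = 1))"
    using ch(3,4,5) z0(2) p0
    by (intro exI[of _ "V \<inter> G -` U"] exI[of _ a] exI[of _ "\<lambda>t. cyl \<tau> (c t)"] exI[of _ "\<lambda>w. \<sigma> (G w)"])
       (simp add: G_def)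
qed

lemma jordan_curves_cyl_frontier:
  assumes "smooth_domain \<Omega>" "\<And>z. z \<in> frontier \<Omega> \<Longrightarrow> \<bar>Im (z / \<tau>)\<bar> < R"
  shows "\<exists>\<Gamma>. finite \<Gamma> \<and> (\<forall>g\<in>\<Gamma>. jordan_curve g \<and> path_image g \<subseteq> - {0}) \<and>
    cyl \<tau> ` frontier \<Omega> = (\<Union>g\<in>\<Gamma>. path_image g)"
proof -
  obtain \<Gamma> where \<Gamma>: "finite \<Gamma>" "\<And>h. h \<in> \<Gamma> \<Longrightarrow> simple_path h \<and> pathfinish h = pathstart h"
    "cyl \<tau> ` frontier \<Omega> = (\<Union>h\<in>\<Gamma>. path_image h)"
    using compact_flow.finite_union_of_simple_loops[OF compact_flow_cyl_frontier[OF assms]] by blast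
  have "path_image g \<subseteq> - {0}" if "g \<in> \<Gamma>" for g
  proof -
    have "path_image g \<subseteq> cyl \<tau> ` frontier \<Omega>" unfolding \<Gamma>(3) using that by blast
    then show ?thesis by auto
  qed
  then show ?thesis
    by (intro exI[of _ \<Gamma>] conjI ballI \<Gamma>(1,3)) (use \<Gamma>(2) in \<open>auto simp: jordan_curve_def\<close>)
qed

end

section \<open>From the definitions to the analytic setting\<close>

text \<open>A chart covers both sides of the real axis: a point just below the axis comes from
  neither \<Omega> nor its frontier, hence from the open complement of the closure.\<close>

lemma smooth_domain_exterior_disc:
  assumes "smooth_domain \<Omega>"
  shows "\<exists>w r. r > 0 \<and> ball w r \<inter> \<Omega> = {}"
proof -
  obtain p where p: "p \<in> frontier \<Omega>" using assms unfolding smooth_domain_def by blast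
  obtain \<epsilon> \<psi> D where "\<epsilon> > 0" and sd: "smooth_diffeo \<psi> (ball p \<epsilon>) D"
    and up: "\<psi> ` (ball p \<epsilon> \<inter> \<Omega>) = D \<inter> {x. Im x > 0}"
    and re: "\<psi> ` (ball p \<epsilon> \<inter> frontier \<Omega>) = D \<inter> {x. Im x = 0}"
    using assms p unfolding smooth_domain_def by blast
  have "open D" and im: "\<psi> ` ball p \<epsilon> = D" using sd by (auto simp: smooth_diffeo_def)
  have "\<psi> p \<in> \<psi> ` (ball p \<epsilon> \<inter> frontier \<Omega>)" using p \<open>\<epsilon> > 0\<close> by simp
  then have \<psi>p: "\<psi> p \<in> D" "Im (\<psi> p) = 0" using re by auto
  obtain d where d: "d > 0" "ball (\<psi> p) d \<subseteq> D" using \<open>open D\<close> \<psi>p(1) openE by blast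
  define \<zeta> where "\<zeta> = \<psi> p - \<i> * of_real (d / 2)"
  have "\<zeta> \<in> D" using d by (auto simp: \<zeta>_def dist_norm norm_mult subset_iff)
  then obtain q where q: "q \<in> ball p \<epsilon>" "\<psi> q = \<zeta>" using im by blast
  have "Im \<zeta> < 0" using \<psi>p(2) d(1) by (simp add: \<zeta>_def)
  then have "q \<notin> \<Omega>" "q \<notin> frontier \<Omega>" using up re q by force+
  then have "q \<notin> closure \<Omega>" using interior_subset by (auto simp: frontier_def)
  then obtain r where "r > 0" "ball q r \<subseteq> - closure \<Omega>"
    using open_contains_ball[of "- closure \<Omega>"] by auto
  then show ?thesis using closure_subset by (intro exI[of _ q] exI[of _ r]) blast
qed

lemma associated_function_overdetermined:
  assumes "smooth_domain \<Omega>" "connected \<Omega>" "associated_function \<Omega> u"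
  obtains f where "overdetermined \<Omega> u f" "\<And>z. z \<in> \<Omega> \<Longrightarrow> cgrad u z = cnj (f z)"
proof -
  obtain G where G: "continuous_on (closure \<Omega>) G" "\<And>z. z \<in> \<Omega> \<Longrightarrow> G z = cgrad u z"
    "\<And>z. z \<in> frontier \<Omega> \<Longrightarrow> norm (G z) = 1"
    using assms(3) unfolding associated_function_def by blast
  have op: "open \<Omega>" using assms(1) by (simp add: smooth_domain_def)
  have harm: "harmonic_on \<Omega> u" using assms(3) by (simp add: associated_function_def)
  have "overdetermined \<Omega> u (\<lambda>z. cnj (G z))"
  proof
    show "frontier \<Omega> \<noteq> {}" using assms(1) by (simp add: smooth_domain_def)
    show "(\<lambda>z. cnj (G z)) holomorphic_on \<Omega>"
      by (rule holomorphic_transform[OF harmonic_on_gradient(1)[OF op harm]]) (simp add: G(2))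
    show "continuous_on (closure \<Omega>) (\<lambda>z. cnj (G z))" by (intro continuous_intros G(1))
    show "(u has_derivative (\<lambda>h. Re (cnj (G z) * h))) (at z)" if "z \<in> \<Omega>" for z
      using harmonic_on_gradient(2)[OF op harm that] by (simp add: G(2)[OF that])
    show "\<exists>w r. r > 0 \<and> ball w r \<inter> \<Omega> = {}" by (rule smooth_domain_exterior_disc[OF assms(1)])
  qed (use assms op G(3) in \<open>auto simp: associated_function_def\<close>)
  then show ?thesis using G(2) by (intro that) auto
qed

theorem mainTheorem7:
  fixes \<Omega> :: "complex set" and u :: "complex \<Rightarrow> real" and \<tau> :: complex
  assumes "exceptional_domain \<Omega>"
    and "\<not> is_half_plane \<Omega>"
    and "associated_function \<Omega> u"
    and "\<tau> \<noteq> 0"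
    and "(\<lambda>z. z + \<tau>) ` \<Omega> = \<Omega>"
    and "finite (components (cyl \<tau> ` frontier \<Omega>))"
  shows "(\<forall>z\<in>\<Omega>. norm (cgrad u z) < 1)
    \<and> (\<exists>\<Gamma>. finite \<Gamma> \<and> (\<forall>g\<in>\<Gamma>. jordan_curve g \<and> path_image g \<subseteq> - {0})
             \<and> cyl \<tau> ` frontier \<Omega> = (\<Union>g\<in>\<Gamma>. path_image g))
    \<and> (\<exists>R>0. frontier \<Omega> \<subseteq> {z. \<bar>Im (z / \<tau>)\<bar> < R}
        \<and> ({z. Im (z / \<tau>) \<ge> R} \<subseteq> \<Omega> \<or> {z. Im (z / \<tau>) \<ge> R} \<inter> \<Omega> = {})
        \<and> ({z. Im (z / \<tau>) \<le> -R} \<subseteq> \<Omega> \<or> {z. Im (z / \<tau>) \<le> -R} \<inter> \<Omega> = {})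
        \<and> ({z. Im (z / \<tau>) \<ge> R} \<subseteq> \<Omega> \<or> {z. Im (z / \<tau>) \<le> -R} \<subseteq> \<Omega>)
        \<and> ({z. Im (z / \<tau>) \<ge> R} \<subseteq> \<Omega> \<longrightarrow>
             (\<exists>L. \<forall>\<epsilon>>0. \<exists>M. \<forall>z. Im (z / \<tau>) \<ge> R \<and> Im (z / \<tau>) > M \<longrightarrow> norm (cgrad u z - L) < \<epsilon>))
        \<and> ({z. Im (z / \<tau>) \<le> -R} \<subseteq> \<Omega> \<longrightarrow>
             (\<exists>L. \<forall>\<epsilon>>0. \<exists>M. \<forall>z. Im (z / \<tau>) \<le> -R \<and> Im (z / \<tau>) < -M \<longrightarrow> norm (cgrad u z - L) < \<epsilon>)))"
proof -
  have sm: "smooth_domain \<Omega>" "connected \<Omega>" using assms(1) by (auto simp: exceptional_domain_def)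
  obtain f where f: "overdetermined \<Omega> u f" "\<And>z. z \<in> \<Omega> \<Longrightarrow> cgrad u z = cnj (f z)"
    using associated_function_overdetermined[OF sm assms(3)] by blast
  have inv: "z + \<tau> \<in> \<Omega> \<longleftrightarrow> z \<in> \<Omega>" for z
    using assms(5) by (metis (no_types, lifting) add_right_cancel image_iff)
  then have inv': "z + - \<tau> \<in> \<Omega> \<longleftrightarrow> z \<in> \<Omega>" for z by (metis add.assoc add.left_inverse add.right_neutral)
  interpret p: periodic_overdetermined \<Omega> u f \<tau>
    using f(1) assms(4) inv by (simp add: periodic_overdetermined_def periodic_overdetermined_axioms_def)
  \<comment> \<open>The lower end is the upper end for -\<tau>. Since \<open>cyl (- \<tau>)\<close>
    is the reciprocal of \<open>cyl \<tau>\<close>, inversion carries the boundary components to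
    connected pieces that again cover the frontier.\<close>
  interpret n: periodic_overdetermined \<Omega> u f "- \<tau>"
    using f(1) assms(4) inv' by (simp add: periodic_overdetermined_def periodic_overdetermined_axioms_def)
  let ?C = "components (cyl \<tau> ` frontier \<Omega>)"
  have cyl_minus: "cyl (- \<tau>) z = inverse (cyl \<tau> z)" for z by (simp add: cyl_def exp_minus)
  have cover0: "\<Union>?C = cyl \<tau> ` frontier \<Omega>" by (rule Union_components)
  have "connected C" if "C \<in> ?C" for C using that by (rule in_components_connected)
  then obtain R1 where R1: "\<And>z. z \<in> frontier \<Omega> \<Longrightarrow> Im (z / \<tau>) < R1"
    using p.frontier_bounded_above[OF assms(6) _ cover0] by blast
  have cover: "\<Union>((`) inverse ` ?C) = cyl (- \<tau>) ` frontier \<Omega>"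
  proof -
    have "\<Union>((`) inverse ` ?C) = inverse ` \<Union>?C" by blast
    also note cover0
    finally show ?thesis by (simp add: cyl_minus image_image)
  qed
  have conn: "connected (inverse ` C)" if "C \<in> ?C" for C
  proof (rule connected_continuous_image)
    have "0 \<notin> C" using in_components_subset[OF that] by auto
    then show "continuous_on C inverse" by (intro continuous_intros) auto
    show "connected C" by (rule in_components_connected[OF that])
  qed
  have "connected C" if "C \<in> (`) inverse ` ?C" for C using conn that by blast
  then obtain R2 where R2: "\<And>z. z \<in> frontier \<Omega> \<Longrightarrow> Im (z / - \<tau>) < R2"
    using n.frontier_bounded_above[OF finite_imageI[OF assms(6)] _ cover] by blast
  define R where "R = max 1 (max R1 R2)"
  have strip: "\<bar>Im (z / \<tau>)\<bar> < R" if "z \<in> frontier \<Omega>" for z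
    using R1[OF that] R2[OF that] by (auto simp: R_def)
  have lower_eq: "{z. Im (z / \<tau>) \<le> -R} = {z. Im (z / - \<tau>) \<ge> R}" by auto
  have upper: "{z. Im (z / \<tau>) \<ge> R} \<subseteq> \<Omega> \<or> {z. Im (z / \<tau>) \<ge> R} \<inter> \<Omega> = {}"
    by (rule p.halfplane_dichotomy) (use strip in force)
  have lower: "{z. Im (z / \<tau>) \<le> -R} \<subseteq> \<Omega> \<or> {z. Im (z / \<tau>) \<le> -R} \<inter> \<Omega> = {}"
    unfolding lower_eq by (rule n.halfplane_dichotomy) (use strip in force)
  have one: "{z. Im (z / \<tau>) \<ge> R} \<subseteq> \<Omega> \<or> {z. Im (z / \<tau>) \<le> -R} \<subseteq> \<Omega>"
  proof (rule ccontr)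
    assume "\<not> ?thesis"
    then have "{z. Im (z / \<tau>) \<ge> R} \<inter> \<Omega> = {}" "{z. Im (z / \<tau>) \<le> -R} \<inter> \<Omega> = {}"
      using upper lower by blast+
    then have "\<bar>Im (z / \<tau>)\<bar> < R" if "z \<in> \<Omega>" for z using that by force
    then show False by (rule p.not_contained_in_strip)
  qed
  have lim: "\<exists>L. \<forall>\<epsilon>>0. \<exists>M. \<forall>z. Im (z / \<tau>') \<ge> R \<and> Im (z / \<tau>') > M \<longrightarrow> norm (cgrad u z - L) < \<epsilon>"
    if sub: "{z. Im (z / \<tau>') \<ge> R} \<subseteq> \<Omega>" and per: "periodic_overdetermined \<Omega> u f \<tau>'" for \<tau>'
  proof -
    obtain L where L: "\<And>e. e > 0 \<Longrightarrow> \<exists>M. \<forall>z. Im (z / \<tau>') \<ge> R \<and> Im (z / \<tau>') > M \<longrightarrow> norm (f z - L) < e"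
      using periodic_overdetermined.f_limit[OF per sub] by blast
    have "norm (cgrad u z - cnj L) = norm (f z - L)" if "Im (z / \<tau>') \<ge> R" for z
    proof -
      have "cgrad u z - cnj L = cnj (f z - L)" using f(2)[of z] sub that by auto
      then show ?thesis by (simp only: complex_mod_cnj)
    qed
    with L show ?thesis by (intro exI[of _ "cnj L"]) metis
  qed
  have lim_upper: "{z. Im (z / \<tau>) \<ge> R} \<subseteq> \<Omega> \<longrightarrow>
       (\<exists>L. \<forall>\<epsilon>>0. \<exists>M. \<forall>z. Im (z / \<tau>) \<ge> R \<and> Im (z / \<tau>) > M \<longrightarrow> norm (cgrad u z - L) < \<epsilon>)"
    using lim[OF _ p.periodic_overdetermined_axioms] by blast
  have minus: "Im (z / - \<tau>) \<ge> R \<and> Im (z / - \<tau>) > M \<longleftrightarrow> Im (z / \<tau>) \<le> -R \<and> Im (z / \<tau>) < -M" for z M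
    by auto
  have lim_lower: "{z. Im (z / \<tau>) \<le> -R} \<subseteq> \<Omega> \<longrightarrow>
       (\<exists>L. \<forall>\<epsilon>>0. \<exists>M. \<forall>z. Im (z / \<tau>) \<le> -R \<and> Im (z / \<tau>) < -M \<longrightarrow> norm (cgrad u z - L) < \<epsilon>)"
    using lim[OF _ n.periodic_overdetermined_axioms] unfolding lower_eq minus by blast
  have grad: "\<forall>z\<in>\<Omega>. norm (cgrad u z) < 1"
    using p.norm_f_less_1[OF assms(2)] f(2) by simp
  have "R > 0" by (simp add: R_def)
  moreover have "frontier \<Omega> \<subseteq> {z. \<bar>Im (z / \<tau>)\<bar> < R}" using strip by blast
  ultimately show ?thesis
    by (intro conjI exI[of _ R] grad p.jordan_curves_cyl_frontier[OF sm(1) strip] upper lower one lim_upper lim_lower)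
qed

end
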